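(* Let $p\in\mathcal B$ and, for $t\in[0,T]$, let $$\xi_t:=\exp^{\sqcup\!\sqcup}\big(p|_{\widehat{\mathbb W}_{t,T}}\big),\qquad u_t:=\mathbb E[\xi_t]\in T((\mathbb C^2))$$ (expectation taken coefficientwise). Then: 1. $u_t\in\mathcal A_\infty$ for all $t\in[0,T]$, and $$\mathbb E\big[\exp\big(\langle p,\mathbb X\otimes\widehat{\mathbb W}_{t,T}\rangle\big)\big]=\langle u_t,\mathbb X\rangle,\qquad \mathbb X\in G,\ t\in[0,T].$$ In particular, $\mathbb E\big[\exp(\langle p,\widehat{\mathbb W}_T\rangle)\,\big|\,\mathcal F_t\big]=\langle u_t,\widehat{\mathbb W}_t\rangle$ for all $t\in[0,T]$. 2. There is a constant $C_{p,T}>0$, depending only on $p$ and $T$, such that for all $\mathbb X\in G$, $$\sup_{t\in[0,T]}\|u_t\|_{\mathbb X}\le\exp\big(C_{p,T}(1+M_p(\mathbb X))^{\deg_{\mathbf 1}(p)}\big)<+\infty.$$ 3. The map $t\mapsto u_t^{\varnothing}$ is continuous on $[0,T]$.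
   Context: Words and tensors. $V$ is the set of finite words over the alphabet $\{\mathbf 0,\mathbf 1\}$, including the empty word $\varnothing$; $|v|$ is the length of $v$, $|v|_{\mathbf i}$ the number of occurrences of the letter $\mathbf i$, and $vw$ is concatenation. $T((\mathbb C^2))$ is the set of families $p=(p^v)_{v\in V}$ of complex numbers, written $p=\sum_v p^v v$; $T((\mathbb R^2))$ is the real analogue; $T(\mathbb C^2)\subset T((\mathbb C^2))$ consists of those with finitely many nonzero coefficients. $\otimes$ is the concatenation product, $(p\otimes q)^u=\sum_{vw=u}p^vq^w$; $pv$ means $p\otimes v$; $\mathbf 1^{\otimes k}$ is the word $\mathbf 1\cdots\mathbf 1$ with $k$ letters. $\deg(p)=\max\{|v|:p^v\ne0\}$, $\deg_{\mathbf i}(p)=\max\{|v|_{\mathbf i}:p^v\neq0\}$, with value $-\infty$ for $p=0$. Shuffle. $\sqcup\!\sqcup$ is the bilinear product on $T((\mathbb C^2))$ determined by $v\mathbf i\sqcup\!\sqcup w\mathbf j=(v\sqcup\!\sqcup w\mathbf j)\mathbf i+(v\mathbf i\sqcup\!\sqcup w)\mathbf j$, $v\sqcup\!\sqcup\varnothing=\varnothing\sqcup\!\sqcup v=v$. For $\ell\in T((\mathbb C^2))$ put $\overline\ell=\ell-\ell^\varnothing\varnothing$ and $\exp^{\sqcup\!\sqcup}(\ell)=e^{\ell^\varnothing}\sum_{n\ge0}\overline\ell^{\,\sqcup\!\sqcup n}/n!$ (each coefficient is a finite sum). Pairing and norms. $\langle p,\mathbb X\rangle=\sum_{n\ge0}\sum_{|v|=n}p^v\mathbb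 X^v$, $\|p\|_{\mathbb X}=\sum_{n\ge0}\big|\sum_{|v|=n}p^v\mathbb X^v\big|$. $G$ is the set of group-like elements: $\mathbb X\in T((\mathbb R^2))$ with $\mathbb X^\varnothing=1$ and $\langle v,\mathbb X\rangle\langle w,\mathbb X\rangle=\langle v\sqcup\!\sqcup w,\mathbb X\rangle$ for all words $v,w$. $\mathcal A_{\mathbb X}=\{\ell\in T((\mathbb C^2)):\|\ell\|_{\mathbb X}<\infty\}$, $\mathcal A_\infty=\bigcap_{\mathbb X\in G}\mathcal A_{\mathbb X}$. For $p\in T(\mathbb C^2)$: $M_p(\mathbb X)=\max_{1\le|v|\le\deg(p)}|\mathbb X^v|$ (equal to $0$ if no such $v$; an exponent $\deg_{\mathbf 1}(p)$ is read as $0$ if $p=0$). Shifts. $p|_w=\sum_v p^{vw}v$; for $p\in T(\mathbb C^2)$ and $\mathbb Y\in T((\mathbb R^2))$, $p|_{\mathbb Y}=\sum_w\mathbb Y^w\,p|_w$. Signature. $W$ is a one-dimensional Brownian motion generating the filtration $(\mathcal F_t)_{t\ge0}$; $T>0$ is fixed; $\widehat{\mathbb W}_{s,t}\in T((\mathbb R^2))$ is the Stratonovich signature over $[s,t]$ of $\widehat W_t=(\widehat W^0_t,\widehat W^1_t)=(t,W_t)$: $\widehat{\mathbb W}_{s,t}^{\varnothing}=1$ and $\widehat{\mathbb W}_{s,t}^{v\mathbf i}=\int_s^t\widehat{\mathbb W}_{s,r}^{v}\circ d\widehat W^i_r$; $\widehat{\mathbb W}_t:=\widehat{\mathbb W}_{0,t}$.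 Class $\mathcal B$. $p\in\mathcal B\subset T(\mathbb C^2)$ iff there are $\alpha,\beta\in\{z\in\mathbb C:\mathrm{Re}\,z>0\}\cup\{0\}$, $\gamma\in\mathbb C$, integers $m,n\ge1$ and $q,r,s\in T(\mathbb C^2)$ with $\deg_{\mathbf 1}(q)<2n$, $\deg_{\mathbf 0}(q)\le0$ (i.e. $q$ only involves words in the letter $\mathbf 1$ and $\varnothing$; $q=0$ allowed), $\deg_{\mathbf 1}(r)<2m$, $\deg_{\mathbf 1}(s)<\min(2m,2n)$, such that $$p=-\alpha(\mathbf 1^{\otimes 2n}+q)-\beta(\mathbf 1^{\otimes 2m}+r)\mathbf 0+\alpha\beta s+\gamma\varnothing.$$ *)

theory Defs
  imports "HOL-Probability.Probability"
begin

section \<open>Words and tensors\<close>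

datatype letter = L0 | L1

type_synonym word = "letter list"

type_synonym 'a tensor = "word \<Rightarrow> 'a"

definition word_tensor :: "word \<Rightarrow> 'a::zero_neq_one tensor" where
  "word_tensor v = (\<lambda>u. if u = v then 1 else 0)"

definition finite_tensors :: "complex tensor set" where
  "finite_tensors = {p. finite {v. p v \<noteq> 0}}"

definition tensor_mult :: "'a::comm_semiring_1 tensor \<Rightarrow> 'a tensor \<Rightarrow> 'a tensor"
    (infixl "\<otimes>\<^sub>t" 70) where
  "p \<otimes>\<^sub>t q = (\<lambda>u. \<Sum>(v, w)\<in>{(v, w). v @ w = u}. p v * q w)"

text \<open>Degrees take values in the extended reals, so that the degree of the zero tensor
  is minus infinity (the supremum of the empty set).\<close>

definition deg :: "complex tensor \<Rightarrow> ereal" where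
  "deg p = (SUP v\<in>{v. p v \<noteq> 0}. ereal (real (length v)))"

definition deg_letter :: "letter \<Rightarrow> complex tensor \<Rightarrow> ereal" where
  "deg_letter i p = (SUP v\<in>{v. p v \<noteq> 0}. ereal (real (count_list v i)))"

section \<open>Shuffle product and shuffle exponential\<close>

text \<open>The shuffle of two words is a multiset of words. The defining recursion of the
  product strips the last letters, so it is run on reversed words; the lemma
  \<open>word_shuffle_snoc\<close> below is the recursion in its original form.\<close>

fun shuffle_rev :: "word \<Rightarrow> word \<Rightarrow> word multiset" where
  "shuffle_rev [] w = {#w#}"
| "shuffle_rev v [] = {#v#}"
| "shuffle_rev (i # v) (j # w) =
     image_mset (Cons i) (shuffle_rev v (j # w)) + image_mset (Cons j) (shuffle_rev (i # v) w)"

definition word_shuffle :: "word \<Rightarrow> word \<Rightarrow> word multiset" where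
  "word_shuffle v w = image_mset rev (shuffle_rev (rev v) (rev w))"

lemma word_shuffle_Nil [simp]: "word_shuffle [] w = {#w#}" "word_shuffle v [] = {#v#}"
  by (cases "rev v"; simp add: word_shuffle_def rev_swap)+

lemma word_shuffle_snoc:
  "word_shuffle (v @ [i]) (w @ [j]) =
     image_mset (\<lambda>u. u @ [i]) (word_shuffle v (w @ [j])) +
     image_mset (\<lambda>u. u @ [j]) (word_shuffle (v @ [i]) w)"
  by (simp add: word_shuffle_def image_mset.compositionality comp_def)

text \<open>Bilinear extension to infinite families: only pairs of words whose lengths add up to
  the length of \<open>u\<close> contribute to the coefficient at \<open>u\<close>, and there are finitely many.\<close>

definition shuffle :: "'a::comm_semiring_1 tensor \<Rightarrow> 'a tensor \<Rightarrow> 'a tensor"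
    (infixl "\<squnion>\<^sub>t" 70) where
  "p \<squnion>\<^sub>t q = (\<lambda>u. \<Sum>(v, w)\<in>{(v, w). length v + length w = length u}.
      p v * q w * of_nat (count (word_shuffle v w) u))"

primrec shuffle_power :: "complex tensor \<Rightarrow> nat \<Rightarrow> complex tensor" where
  "shuffle_power p 0 = word_tensor []"
| "shuffle_power p (Suc n) = p \<squnion>\<^sub>t shuffle_power p n"

text \<open>For each word \<open>u\<close> the series below has only finitely many nonzero terms, namely those
  with \<open>n \<le> length u\<close>, because the tensor being raised to powers has no constant term.\<close>

definition shuffle_exp :: "complex tensor \<Rightarrow> complex tensor" where
  "shuffle_exp l = (\<lambda>u. exp (l []) *
      (\<Sum>n. shuffle_power (\<lambda>v. l v - l [] * word_tensor [] v) n u / fact n))"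

section \<open>Pairing, norms and group-like elements\<close>

definition pairing :: "complex tensor \<Rightarrow> real tensor \<Rightarrow> complex" where
  "pairing p X = (\<Sum>n. \<Sum>v | length v = n. p v * complex_of_real (X v))"

definition tensor_norm :: "complex tensor \<Rightarrow> real tensor \<Rightarrow> ennreal" where
  "tensor_norm p X = (\<Sum>n. ennreal (cmod (\<Sum>v | length v = n. p v * complex_of_real (X v))))"

definition group_like :: "real tensor set" where
  "group_like = {X. X [] = 1 \<and>
     (\<forall>v w. pairing (word_tensor v) X * pairing (word_tensor w) X
           = pairing (word_tensor v \<squnion>\<^sub>t word_tensor w) X)}"

definition A_space :: "real tensor \<Rightarrow> complex tensor set" where
  "A_space X = {l. tensor_norm l X < \<infinity>}"

definition A_infinity :: "complex tensor set" where
  "A_infinity = (\<Inter>X\<in>group_like. A_space X)"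

text \<open>All the absolute values are nonnegative, so the inserted \<open>0\<close> only matters when there
  is no other element.\<close>

definition M_bound :: "complex tensor \<Rightarrow> real tensor \<Rightarrow> real" where
  "M_bound p X =
     Max (insert 0 ((\<lambda>v. \<bar>X v\<bar>) ` {v. 1 \<le> length v \<and> ereal (real (length v)) \<le> deg p}))"

section \<open>Shifts\<close>

definition shift_word :: "complex tensor \<Rightarrow> word \<Rightarrow> complex tensor" where
  "shift_word p w = (\<lambda>v. p (v @ w))"

text \<open>For finitely supported \<open>p\<close> the index set is finite.\<close>

definition shift_tensor :: "complex tensor \<Rightarrow> real tensor \<Rightarrow> complex tensor" where
  "shift_tensor p Y =
     (\<lambda>v. \<Sum>w | shift_word p w v \<noteq> 0. complex_of_real (Y w) * shift_word p w v)"

section \<open>Brownian motion and its filtration\<close>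

locale brownian_motion = prob_space M for M :: "'a measure" +
  fixes W :: "real \<Rightarrow> 'a \<Rightarrow> real"
  assumes measurable_W: "0 \<le> t \<Longrightarrow> W t \<in> borel_measurable M"
    and start_zero: "AE \<omega> in M. W 0 \<omega> = 0"
    and continuous_paths: "AE \<omega> in M. continuous_on {0..} (\<lambda>t. W t \<omega>)"
    and gaussian_increments: "0 \<le> s \<Longrightarrow> s < t \<Longrightarrow>
      distributed M lborel (\<lambda>\<omega>. W t \<omega> - W s \<omega>) (normal_density 0 (sqrt (t - s)))"
    and independent_increments: "0 \<le> \<tau> 0 \<Longrightarrow> (\<And>k. k < n \<Longrightarrow> \<tau> k \<le> \<tau> (Suc k)) \<Longrightarrow>
      indep_vars (\<lambda>_. borel) (\<lambda>k \<omega>. W (\<tau> (Suc k)) \<omega> - W (\<tau> k) \<omega>) {..<n :: nat}"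

definition natural_filtration :: "'a measure \<Rightarrow> (real \<Rightarrow> 'a \<Rightarrow> real) \<Rightarrow> real \<Rightarrow> 'a measure" where
  "natural_filtration M W t =
     sigma (space M) {W s -` A \<inter> space M | s A. 0 \<le> s \<and> s \<le> t \<and> A \<in> sets borel}"

definition complex_cond_exp ::
    "'a measure \<Rightarrow> 'a measure \<Rightarrow> ('a \<Rightarrow> complex) \<Rightarrow> 'a \<Rightarrow> complex" where
  "complex_cond_exp M F f =
     (\<lambda>\<omega>. Complex (real_cond_exp M F (\<lambda>\<omega>. Re (f \<omega>)) \<omega>) (real_cond_exp M F (\<lambda>\<omega>. Im (f \<omega>)) \<omega>))"

section \<open>Stratonovich integrals and the signature of time-augmented Brownian motion\<close>

definition partition_of :: "real \<Rightarrow> real \<Rightarrow> (nat \<Rightarrow> real) \<Rightarrow> nat \<Rightarrow> bool" where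
  "partition_of s t \<pi> N \<longleftrightarrow> \<pi> 0 = s \<and> \<pi> N = t \<and> (\<forall>k<N. \<pi> k \<le> \<pi> (Suc k))"

definition mesh :: "(nat \<Rightarrow> real) \<Rightarrow> nat \<Rightarrow> real" where
  "mesh \<pi> N = Max (insert 0 ((\<lambda>k. \<pi> (Suc k) - \<pi> k) ` {..<N}))"

definition stratonovich_sum ::
    "(real \<Rightarrow> 'a \<Rightarrow> real) \<Rightarrow> (real \<Rightarrow> 'a \<Rightarrow> real) \<Rightarrow> (nat \<Rightarrow> real) \<Rightarrow> nat \<Rightarrow> 'a \<Rightarrow> real" where
  "stratonovich_sum Y X \<pi> N \<omega> =
     (\<Sum>k<N. (Y (\<pi> k) \<omega> + Y (\<pi> (Suc k)) \<omega>) / 2 * (X (\<pi> (Suc k)) \<omega> - X (\<pi> k) \<omega>))"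

definition tendsto_in_probability ::
    "'a measure \<Rightarrow> (nat \<Rightarrow> 'a \<Rightarrow> real) \<Rightarrow> ('a \<Rightarrow> real) \<Rightarrow> bool" where
  "tendsto_in_probability M Z I \<longleftrightarrow>
     (\<forall>\<epsilon>>0. (\<lambda>n. measure M {\<omega> \<in> space M. \<bar>Z n \<omega> - I \<omega>\<bar> > \<epsilon>}) \<longlonglongrightarrow> 0)"

text \<open>The Stratonovich integral of \<open>Y\<close> against \<open>X\<close> over \<open>[s, t]\<close> as the limit in probability of
  the symmetrised Riemann sums along every sequence of deterministic partitions whose mesh
  tends to zero. Such a limit is unique up to almost sure equality.\<close>

definition has_stratonovich_integral ::
    "'a measure \<Rightarrow> (real \<Rightarrow> 'a \<Rightarrow> real) \<Rightarrow> (real \<Rightarrow> 'a \<Rightarrow> real) \<Rightarrow> real \<Rightarrow> real \<Rightarrow> ('a \<Rightarrow> real) \<Rightarrow> bool" where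
  "has_stratonovich_integral M Y X s t I \<longleftrightarrow>
     I \<in> borel_measurable M \<and>
     (\<forall>\<pi> N. (\<forall>n. partition_of s t (\<pi> n) (N n)) \<longrightarrow> (\<lambda>n. mesh (\<pi> n) (N n)) \<longlonglongrightarrow> 0 \<longrightarrow>
        tendsto_in_probability M (\<lambda>n. stratonovich_sum Y X (\<pi> n) (N n)) I)"

fun time_augmented :: "(real \<Rightarrow> 'a \<Rightarrow> real) \<Rightarrow> letter \<Rightarrow> real \<Rightarrow> 'a \<Rightarrow> real" where
  "time_augmented W L0 t \<omega> = t"
| "time_augmented W L1 t \<omega> = W t \<omega>"

text \<open>\<open>S s t \<omega>\<close> is the signature over \<open>[s, t]\<close>. The predicate determines every coefficient of
  \<open>S s t\<close> up to almost sure equality, by induction on the word.\<close>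

definition is_signature ::
    "'a measure \<Rightarrow> (real \<Rightarrow> 'a \<Rightarrow> real) \<Rightarrow> (real \<Rightarrow> real \<Rightarrow> 'a \<Rightarrow> real tensor) \<Rightarrow> bool" where
  "is_signature M W S \<longleftrightarrow>
     (\<forall>s t. 0 \<le> s \<longrightarrow> s \<le> t \<longrightarrow>
        (\<forall>\<omega>\<in>space M. S s t \<omega> [] = 1) \<and>
        (\<forall>v i. has_stratonovich_integral M (\<lambda>r \<omega>. S s r \<omega> v) (time_augmented W i) s t
                 (\<lambda>\<omega>. S s t \<omega> (v @ [i]))))"

section \<open>The class of admissible tensors\<close>

definition class_B :: "complex tensor set" where
  "class_B = {p. \<exists>\<alpha> \<beta> \<gamma> :: complex. \<exists>m n :: nat. \<exists>q r s.
     \<alpha> \<in> {z. Re z > 0} \<union> {0} \<and> \<beta> \<in> {z. Re z > 0} \<union> {0} \<and> m \<ge> 1 \<and> n \<ge> 1 \<and>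
     q \<in> finite_tensors \<and> r \<in> finite_tensors \<and> s \<in> finite_tensors \<and>
     deg_letter L1 q < ereal (real (2 * n)) \<and> deg_letter L0 q \<le> 0 \<and>
     deg_letter L1 r < ereal (real (2 * m)) \<and>
     deg_letter L1 s < ereal (real (min (2 * m) (2 * n))) \<and>
     p = (\<lambda>u. - \<alpha> * (word_tensor (replicate (2 * n) L1) u + q u)
              - \<beta> * ((\<lambda>v. word_tensor (replicate (2 * m) L1) v + r v) \<otimes>\<^sub>t word_tensor [L0]) u
              + \<alpha> * \<beta> * s u + \<gamma> * word_tensor [] u)}"

section \<open>The processes \<open>\<xi>\<close> and \<open>u\<close>\<close>

definition xi ::
    "complex tensor \<Rightarrow> real \<Rightarrow> (real \<Rightarrow> real \<Rightarrow> 'a \<Rightarrow> real tensor) \<Rightarrow> real \<Rightarrow> 'a \<Rightarrow> complex tensor" where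
  "xi p T S t \<omega> = shuffle_exp (shift_tensor p (S t T \<omega>))"

definition expected_xi ::
    "'a measure \<Rightarrow> complex tensor \<Rightarrow> real \<Rightarrow> (real \<Rightarrow> real \<Rightarrow> 'a \<Rightarrow> real tensor) \<Rightarrow> real \<Rightarrow> complex tensor" where
  "expected_xi M p T S t = (\<lambda>v. \<integral>\<omega>. xi p T S t \<omega> v \<partial>M)"

end

theory Submission
  imports Defs
begin

text \<open>
Iterated Stratonovich integrals against time and one Brownian path contain no genuine stochastic
integral: integrations over the letter 1 can be carried out explicitly, and what remains are ordinary
integrals in time. The coefficient of a word \<open>v01\<^sup>k\<close> is the integral over \<open>\<tau>\<close> of the coefficient of
\<open>v\<close> at time \<open>\<tau>\<close> times \<open>(f t - f \<tau>)\<^sup>k / k!\<close>, and the word \<open>1\<^sup>k\<close> has the coefficient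
\<open>(f t - f s)\<^sup>k / k!\<close>. The definition \<open>path_sig\<close> takes this as the signature of an arbitrary continuous path
\<open>f\<close>. Chen's identity (\<open>path_sig_Chen\<close>) is proved directly. On a short interval the trapezoid rule used in
the Stratonovich integral is exact up to terms that are cubic in the increment of \<open>f\<close> or of smaller order
than the length of the interval (\<open>local_error_bound\<close>). Along partitions for which the cubic variation
vanishes, trapezoid sums therefore converge to the next coefficient, and since the trapezoid rule obeys
the product rule exactly, the shuffle identity follows in the same way (\<open>path_sig_shuffle_step\<close>). Brownian
paths have vanishing cubic variation along suitable partitions, so the Stratonovich signature is almost
surely the explicit one (\<open>signature_explicit\<close>), and it is group-like.

The exponential moments exist for a deterministic reason. In the pairing of \<open>p\<close> with the signature over
\<open>[t, T]\<close>, the words \<open>1\<^sup>2\<^sup>n\<close> and \<open>1\<^sup>2\<^sup>m0\<close> contribute \<open>- \<alpha>\<close> times a multiple of \<open>(f T - f t)\<^sup>2\<^sup>n\<close> and \<open>- \<beta>\<close>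
times a multiple of the integral of \<open>(f r - f t)\<^sup>2\<^sup>m\<close>. All other words of \<open>p\<close>, and all coefficients of the
shifted tensor at nonempty words, are bounded by constants, by lower powers of \<open>f T - f t\<close> and by integrals of lower
powers of \<open>f r - f t\<close> (\<open>path_sig_growth\<close>). They are absorbed by the leading terms even after multiplication by a large number
\<open>M\<close>, at the price of a constant times \<open>(1 + M)\<close> to the power \<open>deg\<^sub>1 p\<close> (\<open>class_B_exponent_bound\<close>). This bound is
uniform over all continuous paths; the exponentials are thus almost surely bounded, and the constant of
the theorem depends on \<open>p\<close> and \<open>T\<close> only.

Against a group-like \<open>X\<close>, pairings graded by word length turn shuffle products into Cauchy products. Hence
the pairing of a shuffle exponential is the exponential of the pairing, and its norm is at most the
exponential of a norm (\<open>shuffle_exp_group_like\<close>). Together with the pathwise bound, expectation and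
summation over the levels may be interchanged, which gives the membership in all the spaces, the formula
for the expectation and the norm bound (\<open>expected_group_like\<close>). For the conditional expectation, Chen's
identity separates the signature up to time \<open>t\<close> from the one after \<open>t\<close>; the latter is a function of
increments independent of the past (\<open>past_future_independent\<close>), so the past can be frozen. Continuity in
\<open>t\<close> follows from Chen's identity as well, by dominated convergence.\<close>

section \<open>Words, pairings and shifts\<close>

lemma UNIV_letter: "(UNIV :: letter set) = {L0, L1}"
  using letter.exhaust by auto

lemma finite_words [simp]: "finite {v :: word. length v = n}"
proof -
  have "finite (UNIV :: letter set)" by (simp add: UNIV_letter)
  from finite_lists_length_eq[OF this, of n] show ?thesis by simp
qed

lemma finite_words_le [simp]: "finite {v :: word. length v \<le> n}"
proof -
  have "finite (UNIV :: letter set)" by (simp add: UNIV_letter)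
  from finite_lists_length_le[OF this, of n] show ?thesis by simp
qed

lemma splits_eq: "{(v, w). v @ w = u} = (\<lambda>k. (take k u, drop k u)) ` {..length u}"
proof -
  have "(v, w) \<in> (\<lambda>k. (take k u, drop k u)) ` {..length u}" if "v @ w = u" for v w
    using that by (intro image_eqI[of _ _ "length v"]) auto
  then show ?thesis by auto
qed

lemma finite_splits [simp]: "finite {(v, w). v @ w = (u :: word)}"
  by (simp add: splits_eq)

lemma tensor_mult_Nil: "(p \<otimes>\<^sub>t q) [] = p [] * q []"
  by (simp add: tensor_mult_def)

text \<open>Recursion on the last letter; iterated integrals are built by appending letters on the right.\<close>

lemma tensor_mult_snoc:
  "(p \<otimes>\<^sub>t q) (u @ [i]) = (p \<otimes>\<^sub>t (\<lambda>w. q (w @ [i]))) u + p (u @ [i]) * q []"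
proof -
  have "{(v, w). v @ w = u @ [i]} =
      insert (u @ [i], []) ((\<lambda>(v, w). (v, w @ [i])) ` {(v, w). v @ w = u})"
  proof (intro set_eqI iffI)
    fix x assume "x \<in> {(v, w). v @ w = u @ [i]}"
    then obtain v w where x: "x = (v, w)" "v @ w = u @ [i]" by auto
    show "x \<in> insert (u @ [i], []) ((\<lambda>(v, w). (v, w @ [i])) ` {(v, w). v @ w = u})"
    proof (cases w rule: rev_cases)
      case (snoc w' j)
      then have "v @ w' = u" "j = i" using x by auto
      then show ?thesis using x snoc by (auto intro!: image_eqI[of _ _ "(v, w')"])
    qed (use x in auto)
  qed auto
  moreover have "inj_on (\<lambda>(v, w). (v, w @ [i])) {(v, w). v @ w = u}"
    by (auto simp: inj_on_def)
  moreover have "(u @ [i], []) \<notin> (\<lambda>(v, w). (v, w @ [i])) ` {(v, w). v @ w = u}"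
    by auto
  ultimately show ?thesis
    using finite_splits[of u] unfolding tensor_mult_def
    by (simp add: sum.reindex case_prod_unfold add.commute)
qed

text \<open>Pairings are graded by word length because shuffling adds lengths: against a group-like element
the graded pairing turns shuffle products into Cauchy products of sequences.\<close>

definition level :: "complex tensor \<Rightarrow> real tensor \<Rightarrow> nat \<Rightarrow> complex" where
  "level p X n = (\<Sum>v | length v = n. p v * complex_of_real (X v))"

lemma pairing_level: "pairing p X = (\<Sum>n. level p X n)"
  by (simp add: pairing_def level_def)

lemma tensor_norm_level: "tensor_norm p X = (\<Sum>n. ennreal (cmod (level p X n)))"
  by (simp add: tensor_norm_def level_def)

lemma level_eq_0:
  assumes "\<And>v. p v \<noteq> 0 \<Longrightarrow> length v \<le> N" "n > N"
  shows "level p X n = 0"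
  using assms by (fastforce simp: level_def intro!: sum.neutral)

lemma pairing_finite:
  assumes "finite A" "\<And>v. p v \<noteq> 0 \<Longrightarrow> v \<in> A"
  shows "pairing p X = (\<Sum>v\<in>A. p v * complex_of_real (X v))"
proof -
  define N where "N = Max (length ` A)"
  have N: "length v \<le> N" if "v \<in> A" for v
    using that assms(1) by (simp add: N_def)
  have "pairing p X = (\<Sum>n\<le>N. level p X n)"
    unfolding pairing_level
    by (rule suminf_finite) (use N assms level_eq_0[of p N] in auto)
  also have "\<dots> = (\<Sum>n\<le>N. \<Sum>v | v \<in> A \<and> length v = n. p v * complex_of_real (X v))"
    unfolding level_def using assms
    by (intro sum.cong refl sum.mono_neutral_right) auto
  also have "\<dots> = (\<Sum>v\<in>A. p v * complex_of_real (X v))"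
    using sum.group[of A "{..N}" length "\<lambda>v. p v * complex_of_real (X v)"] N assms(1) by auto
  finally show ?thesis .
qed

lemma shift_tensor_finite:
  assumes "finite A" "\<And>v w. p (v @ w) \<noteq> 0 \<Longrightarrow> w \<in> A"
  shows "shift_tensor p Y v = (\<Sum>w\<in>A. complex_of_real (Y w) * p (v @ w))"
  unfolding shift_tensor_def shift_word_def
  by (rule sum.mono_neutral_left) (use assms in auto)

text \<open>A word \<open>u\<close> of \<open>p\<close> is cut as \<open>u = vw\<close> on both sides; the left side sums over \<open>u\<close> first, the right
side over the prefix \<open>v\<close> first.\<close>

lemma pairing_tensor_mult:
  assumes "finite {v. p v \<noteq> 0}"
  shows "pairing p (X \<otimes>\<^sub>t Y) = pairing (shift_tensor p Y) X"
proof -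
  define S where "S = {v. p v \<noteq> 0}"
  define N where "N = Max (length ` S)"
  have N: "length v \<le> N" if "p v \<noteq> 0" for v
    using that assms(1) by (simp add: N_def S_def)
  define A where "A = {v :: word. length v \<le> N}"
  have fin: "finite A" by (simp add: A_def)
  have inA: "p (v @ w) \<noteq> 0 \<Longrightarrow> v \<in> A" "p (v @ w) \<noteq> 0 \<Longrightarrow> w \<in> A" for v w
    using N[of "v @ w"] by (auto simp: A_def)
  have sh: "shift_tensor p Y v = (\<Sum>w\<in>A. complex_of_real (Y w) * p (v @ w))" for v
    by (rule shift_tensor_finite) (use fin inA in auto)
  have "pairing (shift_tensor p Y) X = (\<Sum>v\<in>A. shift_tensor p Y v * complex_of_real (X v))"
  proof (rule pairing_finite[OF fin])
    fix v assume "shift_tensor p Y v \<noteq> 0"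
    then obtain w where "p (v @ w) \<noteq> 0"
      unfolding sh by (elim sum.not_neutral_contains_not_neutral) auto
    then show "v \<in> A" using inA by auto
  qed
  also have "\<dots> = (\<Sum>(v, w)\<in>A \<times> A. p (v @ w) * complex_of_real (X v * Y w))"
    by (subst sum.cartesian_product[symmetric]) (simp add: sh sum_distrib_left mult_ac)
  also have "\<dots> = (\<Sum>(v, w)\<in>{(v, w). v @ w \<in> S}. p (v @ w) * complex_of_real (X v * Y w))"
    by (rule sum.mono_neutral_right) (use fin inA in \<open>auto simp: S_def\<close>)
  also have "\<dots> = (\<Sum>u\<in>S. \<Sum>(v, w)\<in>{(v, w). v @ w = u}. p (v @ w) * complex_of_real (X v * Y w))"
  proof -
    have "{(v, w). v @ w \<in> S} \<subseteq> A \<times> A" using inA by (auto simp: S_def)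
    then have f: "finite {(v, w). v @ w \<in> S}" using fin finite_subset by blast
    have eq: "{x. x \<in> {(v, w). v @ w \<in> S} \<and> (case x of (v, w) \<Rightarrow> v @ w) = u} = {(v, w). v @ w = u}"
      if "u \<in> S" for u using that by auto
    have "finite S" using assms by (simp add: S_def)
    let ?h = "\<lambda>x. case x of (v, w) \<Rightarrow> p (v @ w) * complex_of_real (X v * Y w)"
    have "sum ?h {(v, w). v @ w \<in> S} =
        (\<Sum>u\<in>S. sum ?h {x. x \<in> {(v, w). v @ w \<in> S} \<and> (case x of (v, w) \<Rightarrow> v @ w) = u})"
      by (rule sum.group[OF f \<open>finite S\<close>, symmetric]) auto
    also have "\<dots> = (\<Sum>u\<in>S. sum ?h {(v, w). v @ w = u})"
      by (rule sum.cong[OF refl], rule sum.cong[OF eq refl])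
    finally show ?thesis .
  qed
  also have "\<dots> = (\<Sum>u\<in>S. p u * complex_of_real ((X \<otimes>\<^sub>t Y) u))"
    unfolding tensor_mult_def of_real_sum sum_distrib_left by (intro sum.cong refl) auto
  also have "\<dots> = pairing p (X \<otimes>\<^sub>t Y)"
    by (rule pairing_finite[symmetric]) (use assms in \<open>auto simp: S_def\<close>)
  finally show ?thesis ..
qed

lemma shift_tensor_Nil:
  assumes "finite {v. p v \<noteq> 0}"
  shows "shift_tensor p Y [] = pairing p Y"
  unfolding shift_tensor_def shift_word_def
  by (subst pairing_finite[OF assms]) (auto simp: mult.commute)

section \<open>Shuffle exponentials tested against group-like elements\<close>

lemma length_in_word_shuffle: "u \<in># word_shuffle v w \<Longrightarrow> length u = length v + length w"
proof -
  have *: "u \<in># shuffle_rev v w \<Longrightarrow> length u = length v + length w" for u v w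
    by (induction v w arbitrary: u rule: shuffle_rev.induct) auto
  show "u \<in># word_shuffle v w \<Longrightarrow> length u = length v + length w"
    by (auto simp: word_shuffle_def dest!: *)
qed

lemma sum_mset_count:
  fixes f :: "'b \<Rightarrow> 'a :: comm_semiring_1"
  assumes "finite A" "set_mset M \<subseteq> A"
  shows "(\<Sum>x\<in>#M. f x) = (\<Sum>x\<in>A. of_nat (count M x) * f x)"
  using assms(2)
proof (induction M)
  case (add x M)
  have "(\<Sum>y\<in>A. of_nat (count (add_mset x M) y) * f y) =
      (\<Sum>y\<in>A. (if y = x then f x else 0) + of_nat (count M y) * f y)"
    by (intro sum.cong) (auto simp: algebra_simps)
  then show ?case using add assms(1) by (simp add: sum.distrib)
qed simp

lemma sum_mset_word_shuffle:
  fixes X :: "word \<Rightarrow> 'a :: comm_semiring_1"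
  assumes "length v + length w = n"
  shows "(\<Sum>u\<in>#word_shuffle v w. X u) = (\<Sum>u | length u = n. of_nat (count (word_shuffle v w) u) * X u)"
proof -
  have "set_mset (word_shuffle v w) \<subseteq> {u. length u = n}"
    using length_in_word_shuffle assms by auto
  then show ?thesis by (intro sum_mset_count) auto
qed

lemma pairing_word_tensor: "pairing (word_tensor v) X = complex_of_real (X v)"
  by (subst pairing_finite[of "{v}"]) (auto simp: word_tensor_def split: if_splits)

lemma finite_length_pairs: "finite {(v :: word, w :: word). length v + length w = n}"
  by (rule finite_subset[of _ "{v. length v \<le> n} \<times> {w. length w \<le> n}"])
     (auto intro!: finite_cartesian_product)

lemma pairing_shuffle_words:
  "pairing (word_tensor v \<squnion>\<^sub>t word_tensor w) X = complex_of_real (\<Sum>u\<in>#word_shuffle v w. X u)"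
proof -
  define n where "n = length v + length w"
  have 1: "(word_tensor v \<squnion>\<^sub>t word_tensor w) u =
      (if length u = n then of_nat (count (word_shuffle v w) u) else 0 :: complex)" for u
  proof -
    have "(word_tensor v \<squnion>\<^sub>t word_tensor w) u =
        (\<Sum>x\<in>{(v' :: word, w' :: word). length v' + length w' = length u}.
          if x = (v, w) then of_nat (count (word_shuffle v w) u) else 0 :: complex)"
      unfolding shuffle_def by (intro sum.cong) (auto simp: word_tensor_def split: if_splits)
    then show ?thesis using finite_length_pairs by (auto simp: sum.delta n_def)
  qed
  have "pairing (word_tensor v \<squnion>\<^sub>t word_tensor w) X =
      (\<Sum>u | length u = n. of_nat (count (word_shuffle v w) u) * complex_of_real (X u))"
    by (subst pairing_finite[of "{u. length u = n}"]) (auto simp: 1 split: if_splits)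
  then show ?thesis
    by (subst sum_mset_word_shuffle[of v w n]) (auto simp: n_def)
qed

lemma group_like_iff:
  "X \<in> group_like \<longleftrightarrow> X [] = 1 \<and> (\<forall>v w. X v * X w = (\<Sum>u\<in>#word_shuffle v w. X u))"
  unfolding group_like_def pairing_word_tensor pairing_shuffle_words mem_Collect_eq
  by (simp only: of_real_mult[symmetric] of_real_eq_iff)

text \<open>Group-likeness factorises the sum over all shuffles of two words, and every shuffle of words of
lengths \<open>i\<close> and \<open>j\<close> has length \<open>i + j\<close>.\<close>

lemma level_shuffle:
  assumes "X \<in> group_like"
  shows "level (a \<squnion>\<^sub>t b) X n = (\<Sum>i\<le>n. level a X i * level b X (n - i))"
proof -
  have X: "X v * X w = (\<Sum>u\<in>#word_shuffle v w. X u)" for v w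
    using assms by (simp add: group_like_iff)
  let ?P = "{(v :: word, w :: word). length v + length w = n}"
  let ?c = "\<lambda>v w u. of_nat (count (word_shuffle v w) u)"
  have "level (a \<squnion>\<^sub>t b) X n =
      (\<Sum>u | length u = n. \<Sum>(v, w)\<in>?P. a v * b w * (?c v w u * complex_of_real (X u)))"
    unfolding level_def shuffle_def sum_distrib_right by (intro sum.cong) (auto simp: mult_ac)
  also have "\<dots> = (\<Sum>(v, w)\<in>?P. a v * b w * (\<Sum>u | length u = n. ?c v w u * complex_of_real (X u)))"
    unfolding sum_distrib_left by (subst sum.swap) (auto intro!: sum.cong)
  also have "\<dots> = (\<Sum>(v, w)\<in>?P. a v * b w * complex_of_real (X v * X w))"
    unfolding X by (intro sum.cong refl) (auto simp: sum_mset_word_shuffle[of _ _ n])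
  also have "?P = (\<Union>i\<le>n. {v. length v = i} \<times> {w. length w = n - i})"
    by auto
  also have "(\<Sum>(v, w)\<in>(\<Union>i\<le>n. {v :: word. length v = i} \<times> {w :: word. length w = n - i}).
        a v * b w * complex_of_real (X v * X w)) =
      (\<Sum>i\<le>n. \<Sum>(v, w)\<in>{v. length v = i} \<times> {w. length w = n - i}. a v * b w * complex_of_real (X v * X w))"
    by (rule sum.UNION_disjoint) auto
  also have "\<dots> = (\<Sum>i\<le>n. level a X i * level b X (n - i))"
    unfolding level_def sum_product
    by (intro sum.cong refl) (simp add: sum.cartesian_product mult_ac)
  finally show ?thesis .
qed

lemma level_word_tensor_Nil:
  assumes "X [] = 1"
  shows "level (word_tensor []) X n = (if n = 0 then 1 else 0)"
proof -
  have "level (word_tensor []) X n = (\<Sum>v :: word | length v = n. if v = [] then 1 else 0)"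
    unfolding level_def by (rule sum.cong) (auto simp: word_tensor_def assms)
  then show ?thesis by (auto simp: sum.delta)
qed

text \<open>The levels of a shuffle power are iterated Cauchy products, so Mertens' theorem for absolutely
convergent series controls both the sum and the sum of the absolute values.\<close>

lemma shuffle_power_levels:
  assumes X: "X \<in> group_like" and sl: "summable (\<lambda>n. cmod (level l X n))"
  shows "summable (\<lambda>n. cmod (level (shuffle_power l k) X n)) \<and>
    (\<Sum>n. cmod (level (shuffle_power l k) X n)) \<le> (\<Sum>n. cmod (level l X n)) ^ k \<and>
    (\<Sum>n. level (shuffle_power l k) X n) = (\<Sum>n. level l X n) ^ k"
proof (induction k)
  case 0
  have X1: "X [] = 1" using X by (simp add: group_like_iff)
  note lN = level_word_tensor_Nil[where X = X, OF X1]
  have "(\<lambda>n. if n = 0 then 1 else 0 :: real) sums 1" "(\<lambda>n. if n = 0 then 1 else 0 :: complex) sums 1"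
    using sums_single[of 0 "\<lambda>_. 1 :: real"] sums_single[of 0 "\<lambda>_. 1 :: complex"] by (simp_all add: eq_commute)
  moreover have "cmod (level (word_tensor []) X n) = (if n = 0 then 1 else 0)" for n
    by (simp add: lN)
  ultimately show ?case
    by (simp add: lN sums_iff)
next
  case (Suc k)
  let ?a = "level l X" and ?b = "level (shuffle_power l k) X"
  have lev: "level (shuffle_power l (Suc k)) X n = (\<Sum>i\<le>n. ?a i * ?b (n - i))" for n
    by (simp add: level_shuffle[OF X])
  have sb: "summable (\<lambda>n. cmod (?b n))" using Suc by blast
  have C: "(\<lambda>n. \<Sum>i\<le>n. ?a i * ?b (n - i)) sums ((\<Sum>n. ?a n) * (\<Sum>n. ?b n))"
    by (rule Cauchy_product_sums[OF sl sb])
  have R: "(\<lambda>n. \<Sum>i\<le>n. cmod (?a i) * cmod (?b (n - i))) sums ((\<Sum>n. cmod (?a n)) * (\<Sum>n. cmod (?b n)))"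
    by (rule Cauchy_product_sums) (use sl sb in auto)
  have le: "cmod (\<Sum>i\<le>n. ?a i * ?b (n - i)) \<le> (\<Sum>i\<le>n. cmod (?a i) * cmod (?b (n - i)))" for n
    by (rule order_trans[OF norm_sum]) (simp add: norm_mult)
  have s: "summable (\<lambda>n. cmod (\<Sum>i\<le>n. ?a i * ?b (n - i)))"
    by (rule summable_comparison_test'[OF sums_summable[OF R]]) (use le in auto)
  have "(\<Sum>n. cmod (\<Sum>i\<le>n. ?a i * ?b (n - i))) \<le> (\<Sum>n. cmod (?a n)) * (\<Sum>n. cmod (?b n))"
    using suminf_le[OF le s sums_summable[OF R]] sums_unique[OF R] by simp
  also have "\<dots> \<le> (\<Sum>n. cmod (?a n)) * (\<Sum>n. cmod (?a n)) ^ k"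
    using Suc by (intro mult_left_mono suminf_nonneg sl) auto
  finally show ?case
    using s sums_unique[OF C] Suc by (simp add: level_shuffle[OF X])
qed

text \<open>Each factor without constant term contributes at least one letter.\<close>

lemma shuffle_power_eq_0:
  assumes "l [] = 0" "length u < k"
  shows "shuffle_power l k u = 0"
  using assms(2)
proof (induction k arbitrary: u)
  case (Suc k)
  have "l v * shuffle_power l k w = 0" if "length v + length w = length u" for v w
  proof (cases "v = []")
    case False
    then have "length w < k" using that Suc.prems by (cases v) auto
    then show ?thesis using Suc.IH by simp
  qed (simp add: assms)
  then show ?case by (auto simp: shuffle_def intro!: sum.neutral)
qed simp

definition reduced :: "complex tensor \<Rightarrow> complex tensor" where
  "reduced l = (\<lambda>v. l v - l [] * word_tensor [] v)"

lemma reduced_Nil [simp]: "reduced l [] = 0"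
  and reduced_other: "v \<noteq> [] \<Longrightarrow> reduced l v = l v"
  by (simp_all add: reduced_def word_tensor_def)

lemma shuffle_exp_reduced:
  "shuffle_exp l u = exp (l []) * (\<Sum>k. shuffle_power (reduced l) k u / fact k)"
  by (simp add: shuffle_exp_def reduced_def)

lemma level_shuffle_exp:
  "level (shuffle_exp l) X n = exp (l []) * (\<Sum>k. level (shuffle_power (reduced l) k) X n / fact k)"
proof -
  have "shuffle_exp l u = exp (l []) * (\<Sum>k\<le>n. shuffle_power (reduced l) k u / fact k)"
    if "length u = n" for u
    unfolding shuffle_exp_reduced
    by (subst suminf_finite[of "{..n}"]) (use that in \<open>auto simp: shuffle_power_eq_0\<close>)
  then have "level (shuffle_exp l) X n =
      exp (l []) * (\<Sum>k\<le>n. level (shuffle_power (reduced l) k) X n / fact k)"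
    unfolding level_def sum_distrib_left sum_divide_distrib sum_distrib_right
    by (subst sum.swap) (simp add: sum_distrib_left sum_distrib_right mult_ac)
  also have "(\<Sum>k\<le>n. level (shuffle_power (reduced l) k) X n / fact k) =
      (\<Sum>k. level (shuffle_power (reduced l) k) X n / fact k)"
    by (rule suminf_finite[symmetric]) (auto simp: level_def shuffle_power_eq_0)
  finally show ?thesis .
qed

text \<open>Fubini for series, read off from termwise integration against the counting measure.\<close>

lemma double_series:
  fixes f :: "nat \<Rightarrow> nat \<Rightarrow> complex"
  assumes f: "\<And>k. summable (\<lambda>n. cmod (f k n))"
    and s: "summable (\<lambda>k. \<Sum>n. cmod (f k n))"
    and sk: "\<And>n. summable (\<lambda>k. cmod (f k n))"
  shows "summable (\<lambda>n. cmod (\<Sum>k. f k n))"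
    "(\<Sum>n. cmod (\<Sum>k. f k n)) \<le> (\<Sum>k. \<Sum>n. cmod (f k n))"
    "(\<Sum>n. \<Sum>k. f k n) = (\<Sum>k. \<Sum>n. f k n)"
proof -
  let ?M = "count_space (UNIV :: nat set)"
  have i: "integrable ?M (f k)" for k
    using f by (simp add: integrable_count_space_nat_iff)
  have i': "integrable ?M (\<lambda>n. cmod (f k n))" for k
    using i by (rule integrable_norm)
  have n: "(\<integral>n. cmod (f k n) \<partial>?M) = (\<Sum>n. cmod (f k n))" for k
    by (rule integral_count_space_nat[OF i'])
  have ii: "integrable ?M (\<lambda>n. \<Sum>k. f k n)"
    by (rule integrable_suminf[OF i]) (use s sk n in auto)
  have ii': "integrable ?M (\<lambda>n. \<Sum>k. cmod (f k n))"
    by (rule integrable_suminf[OF i']) (use s sk n in auto)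
  show 1: "summable (\<lambda>n. cmod (\<Sum>k. f k n))"
    using ii by (simp add: integrable_count_space_nat_iff)
  have 2: "summable (\<lambda>n. \<Sum>k. cmod (f k n))"
    using ii' by (simp add: integrable_count_space_nat_iff suminf_nonneg sk)
  have "(\<Sum>n. cmod (\<Sum>k. f k n)) \<le> (\<Sum>n. \<Sum>k. cmod (f k n))"
    by (intro suminf_le 1 2 summable_norm sk)
  also have "\<dots> = (\<integral>n. (\<Sum>k. cmod (f k n)) \<partial>?M)"
    by (rule integral_count_space_nat[OF ii', symmetric])
  also have "\<dots> = (\<Sum>k. \<integral>n. cmod (f k n) \<partial>?M)"
    by (rule integral_suminf[OF i']) (use s sk n in auto)
  finally show "(\<Sum>n. cmod (\<Sum>k. f k n)) \<le> (\<Sum>k. \<Sum>n. cmod (f k n))"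
    by (simp add: n)
  have "(\<Sum>n. \<Sum>k. f k n) = (\<integral>n. (\<Sum>k. f k n) \<partial>?M)"
    by (rule integral_count_space_nat[OF ii, symmetric])
  also have "\<dots> = (\<Sum>k. \<integral>n. f k n \<partial>?M)"
    by (rule integral_suminf[OF i]) (use s sk n in auto)
  finally show "(\<Sum>n. \<Sum>k. f k n) = (\<Sum>k. \<Sum>n. f k n)"
    by (simp add: integral_count_space_nat[OF i])
qed

text \<open>Taking levels is multiplicative on shuffle products, hence sends the shuffle exponential to the
exponential series; the same computation with absolute values bounds the norm.\<close>

lemma shuffle_exp_group_like:
  assumes X: "X \<in> group_like" and sl: "summable (\<lambda>n. cmod (level (reduced l) X n))"
  shows "summable (\<lambda>n. cmod (level (shuffle_exp l) X n))"
    "(\<Sum>n. cmod (level (shuffle_exp l) X n)) \<le> exp (Re (l []) + (\<Sum>n. cmod (level (reduced l) X n)))"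
    "pairing (shuffle_exp l) X = exp (l [] + pairing (reduced l) X)"
proof -
  let ?a = "\<Sum>n. cmod (level (reduced l) X n)"
  let ?B = "\<lambda>k. level (shuffle_power (reduced l) k) X"
  let ?f = "\<lambda>k n. ?B k n / fact k"
  note P = shuffle_power_levels[OF X sl]
  have ea: "(\<lambda>k. ?a ^ k / fact k) sums exp ?a"
    using exp_converges[of ?a] by (simp add: divide_inverse mult.commute)
  have ec: "(\<lambda>k. pairing (reduced l) X ^ k / fact k) sums exp (pairing (reduced l) X)"
    using exp_converges[of "pairing (reduced l) X"]
    by (simp add: divide_inverse mult.commute scaleR_conv_of_real)
  have f: "summable (\<lambda>n. cmod (?f k n))" for k
    using P[of k] by (auto simp: norm_divide intro: summable_divide)
  have fn: "(\<Sum>n. cmod (?f k n)) = (\<Sum>n. cmod (?B k n)) / fact k" for k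
    using P[of k] by (simp add: norm_divide suminf_divide)
  have fle: "(\<Sum>n. cmod (?f k n)) \<le> ?a ^ k / fact k" for k
    unfolding fn using P[of k] by (intro divide_right_mono) auto
  have s: "summable (\<lambda>k. \<Sum>n. cmod (?f k n))"
    by (rule summable_comparison_test'[OF sums_summable[OF ea]])
       (use fle f in \<open>auto intro!: suminf_nonneg simp: abs_of_nonneg suminf_nonneg\<close>)
  have sk: "summable (\<lambda>k. cmod (?f k n))" for n
    by (rule summable_finite[of "{..n}"]) (auto simp: level_def shuffle_power_eq_0)
  note D = double_series[OF f s sk]
  have L: "level (shuffle_exp l) X n = exp (l []) * (\<Sum>k. ?f k n)" for n
    by (rule level_shuffle_exp)
  show "summable (\<lambda>n. cmod (level (shuffle_exp l) X n))"
    unfolding L norm_mult by (intro summable_mult D(1))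
  have "(\<Sum>n. cmod (\<Sum>k. ?f k n)) \<le> (\<Sum>k. ?a ^ k / fact k)"
    by (rule order_trans[OF D(2)]) (intro suminf_le fle s sums_summable[OF ea])
  also have "\<dots> = exp ?a" using ea by (simp add: sums_iff)
  finally show "(\<Sum>n. cmod (level (shuffle_exp l) X n)) \<le> exp (Re (l []) + ?a)"
    unfolding L norm_mult by (subst suminf_mult[OF D(1)]) (simp add: exp_add mult_left_mono)
  have sf: "summable (\<lambda>n. \<Sum>k. ?f k n)" by (rule summable_norm_cancel[OF D(1)])
  have "pairing (shuffle_exp l) X = exp (l []) * (\<Sum>n. \<Sum>k. ?f k n)"
    unfolding pairing_level L by (rule suminf_mult[OF sf])
  also have "(\<Sum>n. \<Sum>k. ?f k n) = (\<Sum>k. pairing (reduced l) X ^ k / fact k)"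
    unfolding D(3)
  proof (rule suminf_cong)
    fix k
    have "summable (\<lambda>n. ?B k n)" using P[of k] by (blast intro: summable_norm_cancel)
    then show "(\<Sum>n. ?B k n / fact k) = pairing (reduced l) X ^ k / fact k"
      using P[of k] by (simp add: suminf_divide pairing_level)
  qed
  also have "\<dots> = exp (pairing (reduced l) X)" using ec by (simp add: sums_iff)
  finally show "pairing (shuffle_exp l) X = exp (l [] + pairing (reduced l) X)"
    by (simp add: exp_add)
qed

text \<open>The bound on \<open>X\<close> is demanded on the support of \<open>l\<close> only, since \<^const>\<open>M_bound\<close> sees words of
bounded length only.\<close>

lemma level_reduced_finite:
  assumes A: "finite A" "\<And>v. l v \<noteq> 0 \<Longrightarrow> v \<in> A" and B: "\<And>v. v \<noteq> [] \<Longrightarrow> l v \<noteq> 0 \<Longrightarrow> \<bar>X v\<bar> \<le> B"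
  shows "summable (\<lambda>n. cmod (level (reduced l) X n))"
    "(\<Sum>n. cmod (level (reduced l) X n)) \<le> B * (\<Sum>v\<in>A - {[]}. cmod (l v))"
    "X [] = 1 \<Longrightarrow> l [] + pairing (reduced l) X = pairing l X"
proof -
  define N where "N = Max (length ` A)"
  have N: "length v \<le> N" if "v \<in> A" for v
    using that A(1) by (simp add: N_def)
  have inA: "v \<in> A" if "reduced l v \<noteq> 0" for v
    using that A(2) by (cases "v = []") (auto simp: reduced_other)
  have z: "level (reduced l) X n = 0" if "n > N" for n
    using level_eq_0[of "reduced l" N n X] N inA that by blast
  show "summable (\<lambda>n. cmod (level (reduced l) X n))"
    by (rule summable_finite[of "{..N}"]) (use z in auto)
  have "(\<Sum>n. cmod (level (reduced l) X n)) = (\<Sum>n\<le>N. cmod (level (reduced l) X n))"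
    by (rule suminf_finite) (use z in auto)
  also have "\<dots> \<le> (\<Sum>n\<le>N. \<Sum>v | v \<in> A - {[]} \<and> length v = n. B * cmod (l v))"
  proof (rule sum_mono)
    fix n
    have "level (reduced l) X n = (\<Sum>v | v \<in> A - {[]} \<and> length v = n. reduced l v * complex_of_real (X v))"
      unfolding level_def by (rule sum.mono_neutral_right) (use inA in auto)
    also have "cmod \<dots> \<le> (\<Sum>v | v \<in> A - {[]} \<and> length v = n. B * cmod (l v))"
    proof (rule sum_norm_le)
      fix v assume "v \<in> {v \<in> A - {[]}. length v = n}"
      then have "v \<noteq> []" by auto
      then show "cmod (reduced l v * complex_of_real (X v)) \<le> B * cmod (l v)"
        using B[of v] by (cases "l v = 0") (auto simp: reduced_other norm_mult mult.commute mult_right_mono)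
    qed
    finally show "cmod (level (reduced l) X n) \<le> (\<Sum>v | v \<in> A - {[]} \<and> length v = n. B * cmod (l v))" .
  qed
  also have "\<dots> = (\<Sum>v\<in>A - {[]}. B * cmod (l v))"
    using sum.group[of "A - {[]}" "{..N}" length "\<lambda>v. B * cmod (l v)"] N A(1) by auto
  finally show "(\<Sum>n. cmod (level (reduced l) X n)) \<le> B * (\<Sum>v\<in>A - {[]}. cmod (l v))"
    by (simp add: sum_distrib_left)
  assume X1: "X [] = 1"
  have r: "pairing (reduced l) X = (\<Sum>v\<in>insert [] A. reduced l v * complex_of_real (X v))"
    by (rule pairing_finite) (use A inA in auto)
  have p: "pairing l X = (\<Sum>v\<in>insert [] A. l v * complex_of_real (X v))"
    by (rule pairing_finite) (use A in auto)
  have "(\<Sum>v\<in>A - {[]}. reduced l v * complex_of_real (X v)) = (\<Sum>v\<in>A - {[]}. l v * complex_of_real (X v))"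
    by (rule sum.cong) (auto simp: reduced_other)
  then show "l [] + pairing (reduced l) X = pairing l X"
    unfolding r p using A(1) X1 by (simp add: sum.insert_remove)
qed

text \<open>A coefficient at \<open>u\<close> of a shuffle product involves only words not longer than \<open>u\<close>, with
multiplicities depending on \<open>u\<close>. Hence the coefficients at \<open>u\<close> of the powers of a tensor bounded
by \<open>R\<close> grow at most geometrically, with ratio proportional to \<open>R\<close>. Norms do not
control single coefficients, as they allow for cancellation between words of the same length.\<close>

lemma shuffle_exp_coeff_bound:
  "\<exists>K\<ge>0. \<forall>l R. (\<forall>v. cmod (reduced l v) \<le> R) \<longrightarrow> cmod (shuffle_exp l u) \<le> exp (Re (l []) + K * R)"
proof -
  define c where "c u = (\<Sum>(v, w)\<in>{(v, w). length v + length w = length u}.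
    real (count (word_shuffle v w) u))" for u
  define N where "N = length u"
  define K where "K = (\<Sum>u | length u \<le> N. c u)"
  have c0: "0 \<le> c u" for u unfolding c_def by (rule sum_nonneg) auto
  have cK: "c v \<le> K" if "length v \<le> N" for v
    unfolding K_def by (rule member_le_sum) (use that c0 in auto)
  have K0: "0 \<le> K" unfolding K_def by (rule sum_nonneg) (use c0 in auto)
  have "cmod (shuffle_exp l u) \<le> exp (Re (l []) + K * R)" if l: "\<And>v. cmod (reduced l v) \<le> R" for l R
  proof -
    have R0: "0 \<le> R" using l[of u] norm_ge_zero order_trans by blast
    have pow: "cmod (shuffle_power (reduced l) k v) \<le> (K * R) ^ k" if "length v \<le> N" for k v
      using that
    proof (induction k arbitrary: v)
      case 0
      then show ?case by (simp add: word_tensor_def)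
    next
      case (Suc k)
      have "cmod (shuffle_power (reduced l) (Suc k) v) \<le>
          (\<Sum>(x, y)\<in>{(x, y). length x + length y = length v}.
            real (count (word_shuffle x y) v) * (R * (K * R) ^ k))"
        unfolding shuffle_power.simps shuffle_def
      proof (rule sum_norm_le, clarify)
        fix x y :: word assume xy: "length x + length y = length v"
        have "cmod (reduced l x) * cmod (shuffle_power (reduced l) k y) \<le> R * (K * R) ^ k"
          by (rule mult_mono) (use l R0 Suc xy in auto)
        from mult_right_mono[OF this, of "real (count (word_shuffle x y) v)"]
        show "cmod (reduced l x * shuffle_power (reduced l) k y * of_nat (count (word_shuffle x y) v)) \<le>
          real (count (word_shuffle x y) v) * (R * (K * R) ^ k)"
          by (simp add: norm_mult mult_ac)
      qed
      also have "\<dots> = c v * (R * (K * R) ^ k)"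
        by (simp add: c_def sum_distrib_right case_prod_unfold)
      also have "\<dots> \<le> K * (R * (K * R) ^ k)"
        by (rule mult_right_mono) (use cK Suc R0 K0 in auto)
      finally show ?case by (simp add: mult_ac)
    qed
    have ea: "(\<lambda>k. (K * R) ^ k / fact k) sums exp (K * R)"
      using exp_converges[of "K * R"] by (simp add: divide_inverse mult.commute)
    have le: "cmod (shuffle_power (reduced l) k u / fact k) \<le> (K * R) ^ k / fact k" for k
      using pow[of u k] by (simp add: N_def norm_divide divide_right_mono)
    have "cmod (\<Sum>k. shuffle_power (reduced l) k u / fact k) \<le> (\<Sum>k. (K * R) ^ k / fact k)"
      by (rule norm_suminf_le[OF le sums_summable[OF ea]])
    also have "\<dots> = exp (K * R)" using ea by (simp add: sums_iff)
    finally show ?thesis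
      unfolding shuffle_exp_reduced norm_mult by (simp add: exp_add)
  qed
  then show ?thesis using K0 by blast
qed

section \<open>The signature of a continuous path\<close>

lemma tensor_mult_take: "(p \<otimes>\<^sub>t q) u = (\<Sum>k\<le>length u. p (take k u) * q (drop k u))"
proof -
  have "inj_on (\<lambda>k. (take k u, drop k u)) {..length u}"
    by (rule inj_on_inverseI[where g = "\<lambda>x. length (fst x)"]) auto
  then show ?thesis
    unfolding tensor_mult_def splits_eq by (simp add: sum.reindex)
qed

lemma tensor_mult_pure:
  "(p \<otimes>\<^sub>t q) (replicate k L1) = (\<Sum>j\<le>k. p (replicate j L1) * q (replicate (k - j) L1))"
  by (auto simp: tensor_mult_take min_def intro!: sum.cong)

lemma tensor_mult_L0:
  "(p \<otimes>\<^sub>t q) (v @ L0 # replicate k L1) = (p \<otimes>\<^sub>t (\<lambda>w. q (w @ L0 # replicate k L1))) v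
     + (\<Sum>j\<le>k. p (v @ L0 # replicate j L1) * q (replicate (k - j) L1))"
proof (induction k arbitrary: q)
  case 0
  then show ?case by (simp add: tensor_mult_snoc)
next
  case (Suc k)
  have r: "replicate j L1 @ [L1] = replicate (Suc j) L1" for j
    by (metis replicate_Suc replicate_append_same)
  have "(p \<otimes>\<^sub>t q) (v @ L0 # replicate (Suc k) L1) = (p \<otimes>\<^sub>t q) ((v @ L0 # replicate k L1) @ [L1])"
    by (simp only: append.assoc append_Cons r)
  also have "\<dots> = (p \<otimes>\<^sub>t (\<lambda>w. q (w @ L0 # replicate (Suc k) L1))) v
     + (\<Sum>j\<le>k. p (v @ L0 # replicate j L1) * q (replicate (Suc (k - j)) L1))
     + p (v @ L0 # replicate (Suc k) L1) * q []"
    by (subst tensor_mult_snoc, subst Suc) (simp only: append.assoc append_Cons r)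
  also have "(\<Sum>j\<le>k. p (v @ L0 # replicate j L1) * q (replicate (Suc (k - j)) L1)) =
      (\<Sum>j\<le>k. p (v @ L0 # replicate j L1) * q (replicate (Suc k - j) L1))"
    by (intro sum.cong refl) (simp add: Suc_diff_le)
  finally show ?case by (simp add: add.assoc)
qed

lemma not_L0: "x \<noteq> L0 \<longleftrightarrow> x = L1"
  by (cases x) auto

lemma count_list_letters: "count_list v L0 + count_list v L1 = length v"
  by (induction v) (auto simp: not_L0)

lemma count_list_replicate: "count_list (replicate k x) y = (if x = y then k else 0)"
  by (induction k) auto

text \<open>Every word is either a power of the letter 1 or splits uniquely at its last letter 0. The explicit
signature is defined along this splitting.\<close>

lemma word_induct_L0 [case_names pure L0]:
  assumes "\<And>k. P (replicate k L1)" "\<And>v k. P v \<Longrightarrow> P (v @ L0 # replicate k L1)"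
  shows "P v"
proof (induction v rule: measure_induct_rule[of length])
  case (less v)
  have rep: "zs = replicate (length zs) L1" if "L0 \<notin> set zs" for zs
    using that by (intro replicate_eqI refl) (metis not_L0)
  show ?case
  proof (cases "L0 \<in> set v")
    case True
    then obtain ys zs where v: "v = ys @ L0 # zs" "L0 \<notin> set zs" by (metis split_list_last)
    then have "P (ys @ L0 # replicate (length zs) L1)" by (intro assms(2) less) auto
    then show ?thesis using v rep[of zs] by simp
  next
    case False
    then show ?thesis using assms(1)[of "length v"] rep[of v] by simp
  qed
qed

text \<open>The word is read backwards, and the number \<open>k\<close> counts the letters 1 met since the last letter 0.
Integrating \<open>k\<close> times against the path produces the power \<open>(f t - f \<tau>) ^ k / fact k\<close>, so that only the
letters 0 leave an integral, and that one is an ordinary integral in time.\<close>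

fun sig_aux :: "(real \<Rightarrow> real) \<Rightarrow> real \<Rightarrow> word \<Rightarrow> nat \<Rightarrow> real \<Rightarrow> real" where
  "sig_aux f s [] k t = (f t - f s) ^ k / fact k"
| "sig_aux f s (L1 # v) k t = sig_aux f s v (Suc k) t"
| "sig_aux f s (L0 # v) k t = integral {s..t} (\<lambda>\<tau>. sig_aux f s v 0 \<tau> * ((f t - f \<tau>) ^ k / fact k))"

text \<open>The coefficients of the signature of the path \<open>(r, f r)\<close> over \<open>[s, t]\<close>, defined for every continuous
\<open>f\<close> although \<open>f\<close> may have unbounded variation.\<close>

definition path_sig :: "(real \<Rightarrow> real) \<Rightarrow> real \<Rightarrow> real \<Rightarrow> real tensor" where
  "path_sig f s t v = sig_aux f s (rev v) 0 t"

lemma sig_aux_L1s: "sig_aux f s (replicate j L1 @ v) k t = sig_aux f s v (k + j) t"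
  by (induction j arbitrary: k) auto

lemma path_sig_pure: "path_sig f s t (replicate k L1) = (f t - f s) ^ k / fact k"
  using sig_aux_L1s[of f s k "[]" 0 t] by (simp add: path_sig_def)

lemma path_sig_L0: "path_sig f s t (v @ L0 # replicate k L1) =
    integral {s..t} (\<lambda>\<tau>. path_sig f s \<tau> v * ((f t - f \<tau>) ^ k / fact k))"
  by (simp add: path_sig_def sig_aux_L1s)

lemma path_sig_Nil [simp]: "path_sig f s t [] = 1"
  using path_sig_pure[of f s t 0] by simp

lemma path_sig_refl: "v \<noteq> [] \<Longrightarrow> path_sig f s s v = 0"
  by (induction v rule: word_induct_L0) (auto simp: path_sig_pure path_sig_L0)

lemma binomial_fact_sum:
  "(x + y :: real) ^ k / fact k = (\<Sum>j\<le>k. x ^ j / fact j * (y ^ (k - j) / fact (k - j)))"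
  using exp_series_add_commuting[of x y k] by (simp add: divide_inverse mult_ac)

text \<open>The binomial theorem separates the upper end point from the integration variable.\<close>

lemma path_sig_continuous:
  assumes f: "continuous_on {s..T} f"
  shows "continuous_on {s..T} (\<lambda>t. path_sig f s t v)"
proof (induction v rule: word_induct_L0)
  case (pure k)
  show ?case unfolding path_sig_pure by (intro continuous_intros f) auto
next
  case (L0 v k)
  have int: "(\<lambda>\<tau>. path_sig f s \<tau> v * ((- f \<tau>) ^ j / fact j)) integrable_on {s..T}" for j
    by (intro integrable_continuous_interval continuous_intros f L0) auto
  have "path_sig f s t (v @ L0 # replicate k L1) =
      (\<Sum>j\<le>k. f t ^ j / fact j * integral {s..t} (\<lambda>\<tau>. path_sig f s \<tau> v * ((- f \<tau>) ^ (k - j) / fact (k - j))))"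
    if "t \<in> {s..T}" for t
  proof -
    have int': "(\<lambda>\<tau>. path_sig f s \<tau> v * ((- f \<tau>) ^ j / fact j)) integrable_on {s..t}" for j
      by (rule integrable_on_subinterval[OF int]) (use that in auto)
    have "path_sig f s t (v @ L0 # replicate k L1) = integral {s..t}
        (\<lambda>\<tau>. \<Sum>j\<le>k. f t ^ j / fact j * (path_sig f s \<tau> v * ((- f \<tau>) ^ (k - j) / fact (k - j))))"
      unfolding path_sig_L0 diff_conv_add_uminus binomial_fact_sum
      by (simp add: sum_distrib_left mult_ac)
    also have "\<dots> = (\<Sum>j\<le>k. f t ^ j / fact j * integral {s..t} (\<lambda>\<tau>. path_sig f s \<tau> v * ((- f \<tau>) ^ (k - j) / fact (k - j))))"
      by (subst integral_sum; (intro finite_atMost integrable_on_mult_right int' | simp))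
    finally show ?thesis .
  qed
  moreover have "continuous_on {s..T} (\<lambda>t. \<Sum>j\<le>k. f t ^ j / fact j *
      integral {s..t} (\<lambda>\<tau>. path_sig f s \<tau> v * ((- f \<tau>) ^ (k - j) / fact (k - j))))"
    by (intro continuous_intros f indefinite_integral_continuous_1 int) auto
  ultimately show ?case by (metis (no_types, lifting) continuous_on_cong)
qed

lemma integrand_continuous:
  assumes f: "continuous_on {s..T} f" and "{a..b} \<subseteq> {s..T}"
  shows "continuous_on {a..b} (\<lambda>\<tau>. path_sig f s \<tau> v * ((c - f \<tau>) ^ k / fact k))"
  by (rule continuous_on_subset[OF _ assms(2)])
     (intro continuous_intros path_sig_continuous f; simp)

text \<open>The integral belonging to the last letter 0 is cut at \<open>u\<close>. On the left of \<open>u\<close> the binomial theorem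
splits \<open>f t - f \<tau>\<close> at \<open>f u\<close>; on the right of \<open>u\<close> the induction hypothesis applies to the integrand.\<close>

lemma path_sig_Chen:
  assumes f: "continuous_on {s..T} f" and su: "s \<le> u" and "u \<le> t" "t \<le> T"
  shows "path_sig f s t v = (path_sig f s u \<otimes>\<^sub>t path_sig f u t) v"
  using assms(3,4)
proof (induction v arbitrary: t rule: word_induct_L0)
  case (pure k)
  show ?case
    using binomial_fact_sum[of "f u - f s" "f t - f u" k]
    by (simp add: tensor_mult_pure path_sig_pure)
next
  case (L0 v k)
  have fu: "continuous_on {u..T} f" using f su by (auto intro: continuous_on_subset)
  have sub: "{s..u} \<subseteq> {s..T}" "{u..t} \<subseteq> {u..T}" using L0.prems by auto
  let ?g = "\<lambda>\<tau>. path_sig f s \<tau> v * ((f t - f \<tau>) ^ k / fact k)"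
  have i1: "?g integrable_on {s..t}"
    by (intro integrable_continuous_interval integrand_continuous[OF f]) (use L0 in auto)
  have "path_sig f s t (v @ L0 # replicate k L1) = integral {s..u} ?g + integral {u..t} ?g"
    unfolding path_sig_L0 by (rule Henstock_Kurzweil_Integration.integral_combine[symmetric]) (use L0 su i1 in auto)
  also have "integral {s..u} ?g = integral {s..u} (\<lambda>\<tau>. \<Sum>j\<le>k.
      path_sig f s \<tau> v * ((f u - f \<tau>) ^ j / fact j) * ((f t - f u) ^ (k - j) / fact (k - j)))"
  proof (rule Henstock_Kurzweil_Integration.integral_cong)
    fix \<tau>
    show "?g \<tau> = (\<Sum>j\<le>k. path_sig f s \<tau> v * ((f u - f \<tau>) ^ j / fact j) * ((f t - f u) ^ (k - j) / fact (k - j)))"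
      using binomial_fact_sum[of "f u - f \<tau>" "f t - f u" k] by (simp add: sum_distrib_left mult_ac)
  qed
  also have "\<dots> = (\<Sum>j\<le>k. path_sig f s u (v @ L0 # replicate j L1) * path_sig f u t (replicate (k - j) L1))"
    unfolding path_sig_L0 path_sig_pure
    by (subst integral_sum;
        (intro finite_atMost integrable_on_mult_left integrable_continuous_interval integrand_continuous[OF f] sub
         | simp))
  also have "integral {u..t} ?g = integral {u..t} (\<lambda>\<tau>. \<Sum>j\<le>length v.
      path_sig f s u (take j v) * (path_sig f u \<tau> (drop j v) * ((f t - f \<tau>) ^ k / fact k)))"
  proof (rule Henstock_Kurzweil_Integration.integral_cong)
    fix \<tau> assume "\<tau> \<in> {u..t}"
    then have "path_sig f s \<tau> v = (\<Sum>j\<le>length v. path_sig f s u (take j v) * path_sig f u \<tau> (drop j v))"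
      using L0 by (subst L0.IH) (auto simp: tensor_mult_take)
    then show "?g \<tau> = (\<Sum>j\<le>length v. path_sig f s u (take j v) * (path_sig f u \<tau> (drop j v) * ((f t - f \<tau>) ^ k / fact k)))"
      by (simp only: sum_distrib_right mult.assoc)
  qed
  also have "\<dots> = (path_sig f s u \<otimes>\<^sub>t (\<lambda>w. path_sig f u t (w @ L0 # replicate k L1))) v"
    unfolding path_sig_L0 tensor_mult_take
    by (subst integral_sum;
        (intro finite_atMost integrable_on_mult_right integrable_continuous_interval integrand_continuous[OF fu] sub
         | simp))
  finally show ?case by (simp add: tensor_mult_L0)
qed

text \<open>In Chen's identity for a fixed large interval, the coefficient over \<open>[t, T]\<close> is expressed by
coefficients of shorter words over \<open>[t, T]\<close> and by coefficients over \<open>[s, t]\<close>, which are already known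
to be continuous in their upper end point.\<close>

lemma path_sig_continuous_start:
  assumes f: "continuous_on {s..T} f"
  shows "continuous_on {s..T} (\<lambda>t. path_sig f t T v)"
proof (induction v rule: measure_induct_rule[of length])
  case (less v)
  have "path_sig f t T v = path_sig f s T v - (\<Sum>k\<in>{1..length v}. path_sig f s t (take k v) * path_sig f t T (drop k v))"
    if "t \<in> {s..T}" for t
  proof -
    have "{..length v} = insert 0 {1..length v}" by auto
    then show ?thesis
      using path_sig_Chen[OF f, of t T v] that by (simp add: tensor_mult_take)
  qed
  moreover have "continuous_on {s..T} (\<lambda>t. path_sig f s T v -
      (\<Sum>k\<in>{1..length v}. path_sig f s t (take k v) * path_sig f t T (drop k v)))"
    by (intro continuous_intros path_sig_continuous f less) auto
  ultimately show ?case by (metis (no_types, lifting) continuous_on_cong)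
qed

text \<open>Every letter 0 contributes the length of the interval and every letter 1 the oscillation of \<open>f\<close>.\<close>

lemma path_sig_osc_bound:
  assumes f: "continuous_on {a..b} f" and om: "\<And>x y. x \<in> {a..b} \<Longrightarrow> y \<in> {a..b} \<Longrightarrow> \<bar>f x - f y\<bar> \<le> \<omega>"
    and t: "t \<in> {a..b}"
  shows "\<bar>path_sig f a t v\<bar> \<le> (b - a) ^ count_list v L0 * \<omega> ^ count_list v L1"
  using t
proof (induction v arbitrary: t rule: word_induct_L0)
  case (pure k)
  then have "\<bar>f t - f a\<bar> ^ k / fact k \<le> \<omega> ^ k / 1"
    using om[of t a] by (intro frac_le power_mono) auto
  then show ?case by (simp add: path_sig_pure power_abs count_list_replicate)
next
  case (L0 v k)
  have om0: "0 \<le> \<omega>" using om[of t t] L0 by auto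
  let ?B = "(b - a) ^ count_list v L0 * \<omega> ^ count_list v L1 * \<omega> ^ k"
  have "norm (integral {a..t} (\<lambda>\<tau>. path_sig f a \<tau> v * ((f t - f \<tau>) ^ k / fact k))) \<le> ?B * (t - a)"
  proof (rule integral_bound)
    fix \<tau> assume \<tau>: "\<tau> \<in> {a..t}"
    have "\<bar>f t - f \<tau>\<bar> ^ k / fact k \<le> \<omega> ^ k / 1"
      using om[of t \<tau>] \<tau> L0 by (intro frac_le power_mono) auto
    then show "norm (path_sig f a \<tau> v * ((f t - f \<tau>) ^ k / fact k)) \<le> ?B"
      unfolding norm_mult using \<tau> L0 om0 by (intro mult_mono L0.IH) (auto simp: power_abs)
  next
    show "continuous_on {a..t} (\<lambda>\<tau>. path_sig f a \<tau> v * ((f t - f \<tau>) ^ k / fact k))"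
      by (rule integrand_continuous[OF f]) (use L0 in auto)
  qed (use L0 in auto)
  also have "\<dots> \<le> ?B * (b - a)"
    using L0 om0 by (intro mult_left_mono) auto
  finally show ?case by (simp add: path_sig_L0 count_list_replicate power_add mult_ac)
qed

section \<open>Trapezoid sums and the shuffle identity\<close>

definition coord :: "(real \<Rightarrow> real) \<Rightarrow> letter \<Rightarrow> real \<Rightarrow> real" where
  "coord f i t = (case i of L0 \<Rightarrow> t | L1 \<Rightarrow> f t)"

text \<open>By Chen's identity the error of one trapezoid step is a combination of these terms, one for each
suffix \<open>y\<close> of the word. The average of the two end values of the integrand contributes half of the
coefficient of \<open>y\<close>, except for empty \<open>y\<close>, where both end values contribute.\<close>

definition local_error :: "(real \<Rightarrow> real) \<Rightarrow> letter \<Rightarrow> real \<Rightarrow> real \<Rightarrow> word \<Rightarrow> real" where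
  "local_error f i a b y = path_sig f a b (y @ [i])
     - (if y = [] then 1 else path_sig f a b y / 2) * (coord f i b - coord f i a)"

lemma path_sig_letter: "a \<le> b \<Longrightarrow> path_sig f a b [i] = coord f i b - coord f i a"
  using path_sig_pure[of f a b 1] path_sig_L0[of f a b "[]" 0]
  by (cases i) (auto simp: coord_def)

text \<open>For the words \<open>i\<close> and \<open>11\<close> the trapezoid rule is exact, for longer powers of the letter 1 both terms
are at least cubic in the increment, and otherwise there is a letter 0 together with another letter.\<close>

lemma local_error_bound:
  assumes f: "continuous_on {a..b} f" and om: "\<And>x y. x \<in> {a..b} \<Longrightarrow> y \<in> {a..b} \<Longrightarrow> \<bar>f x - f y\<bar> \<le> \<omega>"
    and ab: "a \<le> b" "b - a \<le> 1" "\<omega> \<le> 1"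
  shows "\<bar>local_error f i a b y\<bar> \<le> 2 * (\<bar>f b - f a\<bar> ^ 3 + (b - a) * (b - a + \<omega>))"
proof -
  define h where "h = b - a"
  define \<delta> where "\<delta> = f b - f a"
  have h: "0 \<le> h" "h \<le> 1" using ab by (auto simp: h_def)
  have om0: "0 \<le> \<omega>" using om[of a a] ab by auto
  have \<delta>: "\<bar>\<delta>\<bar> \<le> \<omega>" using om[of b a] ab by (auto simp: \<delta>_def)
  have R0: "0 \<le> h * (h + \<omega>)" using h om0 by auto
  show ?thesis
  proof (cases "y = []")
    case True
    then show ?thesis using ab R0 by (simp add: local_error_def path_sig_letter h_def)
  next
    case y: False
    show ?thesis
    proof (cases "L0 \<in> set (y @ [i])")
      case False
      then have i: "i = L1" by (cases i) auto
      define k where "k = length y"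
      have yk: "y = replicate k L1"
        unfolding k_def using False by (intro replicate_eqI refl) (metis not_L0 Un_iff set_append)
      have yk1: "y @ [i] = replicate (Suc k) L1"
        using yk i by (metis replicate_Suc replicate_append_same)
      have k0: "k \<ge> 1" using y by (cases y) (auto simp: k_def)
      have le: "local_error f i a b y = \<delta> ^ Suc k / fact (Suc k) - \<delta> ^ k / fact k / 2 * \<delta>"
        unfolding local_error_def using y
        by (simp only: yk1 path_sig_pure) (simp add: yk path_sig_pure i coord_def \<delta>_def)
      show ?thesis
      proof (cases "k = 1")
        case True
        then show ?thesis using R0 by (simp add: le h_def power2_eq_square)
      next
        case False
        then have k2: "k \<ge> 2" using k0 by auto
        have "\<bar>local_error f i a b y\<bar> \<le> \<bar>\<delta>\<bar> ^ Suc k / fact (Suc k) + \<bar>\<delta>\<bar> ^ Suc k / (2 * fact k)"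
          unfolding le by (rule order_trans[OF abs_triangle_ineq4]) (simp add: abs_mult power_abs mult_ac)
        also have "\<dots> \<le> \<bar>\<delta>\<bar> ^ Suc k / 1 + \<bar>\<delta>\<bar> ^ Suc k / 1"
        proof (intro add_mono frac_le)
          have "(1 :: real) \<le> fact k" by simp
          then show "1 \<le> (2 * fact k :: real)" by linarith
        qed (auto simp del: fact_Suc)
        also have "\<dots> = 2 * \<bar>\<delta>\<bar> ^ Suc k" by simp
        also have "\<dots> \<le> 2 * \<bar>\<delta>\<bar> ^ 3"
          using k2 \<delta> ab by (intro mult_left_mono power_decreasing) auto
        finally show ?thesis using R0 by (simp add: h_def \<delta>_def)
      qed
    next
      case True
      define c0 c1 where "c0 = count_list (y @ [i]) L0" and "c1 = count_list (y @ [i]) L1"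
      have c0: "c0 \<ge> 1" using True unfolding c0_def
        by (metis count_list_0_iff less_one linorder_not_less)
      have "c0 + c1 = length (y @ [i])" 
        unfolding c0_def c1_def by (rule count_list_letters)
      then have c01: "c0 + c1 \<ge> 2" using y by (cases y) auto
      have B: "h ^ c0 * \<omega> ^ c1 \<le> h * (h + \<omega>)"
      proof (cases "c1 = 0")
        case True
        then have "h ^ c0 \<le> h ^ 2" using c01 h by (intro power_decreasing) auto
        then show ?thesis using True h om0 by (simp add: power2_eq_square distrib_left) (smt (verit) mult_nonneg_nonneg)
      next
        case False
        have "h ^ c0 \<le> h ^ 1" "\<omega> ^ c1 \<le> \<omega> ^ 1"
          using c0 False h om0 ab power_decreasing[of 1 c0 h] power_decreasing[of 1 c1 \<omega>] by auto
        then have "h ^ c0 * \<omega> ^ c1 \<le> h * \<omega>" using h om0 by (intro mult_mono) auto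
        also have "\<dots> \<le> h * (h + \<omega>)" using h by (intro mult_left_mono) auto
        finally show ?thesis .
      qed
      have 1: "\<bar>path_sig f a b (y @ [i])\<bar> \<le> h ^ c0 * \<omega> ^ c1"
        unfolding c0_def c1_def h_def by (rule path_sig_osc_bound[OF f om]) (use ab in auto)
      have "\<bar>path_sig f a b y\<bar> \<le> h ^ count_list y L0 * \<omega> ^ count_list y L1"
        unfolding h_def by (rule path_sig_osc_bound[OF f om]) (use ab in auto)
      moreover have "\<bar>coord f i b - coord f i a\<bar> \<le> (if i = L0 then h else \<omega>)"
        using \<delta> h by (cases i) (auto simp: coord_def h_def \<delta>_def)
      ultimately have "\<bar>path_sig f a b y\<bar> * \<bar>coord f i b - coord f i a\<bar> \<le>
          h ^ count_list y L0 * \<omega> ^ count_list y L1 * (if i = L0 then h else \<omega>)"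
        using h om0 by (intro mult_mono) auto
      also have "\<dots> = h ^ c0 * \<omega> ^ c1"
        by (cases i) (auto simp: c0_def c1_def)
      also have "\<dots> \<le> h ^ c0 * \<omega> ^ c1 * 2" using h om0 by simp
      finally have 2: "\<bar>path_sig f a b y / 2 * (coord f i b - coord f i a)\<bar> \<le> h ^ c0 * \<omega> ^ c1"
        by (simp add: abs_mult)
      have "\<bar>local_error f i a b y\<bar> \<le> 2 * (h * (h + \<omega>))"
        unfolding local_error_def using y 1 2 B by (simp add: abs_le_iff)
      also have "\<dots> \<le> 2 * (\<bar>\<delta>\<bar> ^ 3 + h * (h + \<omega>))" by simp
      finally show ?thesis by (simp only: h_def \<delta>_def)
    qed
  qed
qed

definition trapezoid_error :: "(real \<Rightarrow> real) \<Rightarrow> real \<Rightarrow> word \<Rightarrow> letter \<Rightarrow> real \<Rightarrow> real \<Rightarrow> real" where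
  "trapezoid_error f s v i a b = path_sig f s b (v @ [i]) - path_sig f s a (v @ [i])
     - (path_sig f s a v + path_sig f s b v) / 2 * (coord f i b - coord f i a)"

lemma trapezoid_error_local:
  assumes f: "continuous_on {s..T} f" and "s \<le> a" "a \<le> b" "b \<le> T"
  shows "trapezoid_error f s v i a b =
    (\<Sum>k\<le>length v. path_sig f s a (take k v) * local_error f i a b (drop k v))"
proof -
  let ?P = "path_sig f s a" and ?Q = "path_sig f a b" and ?d = "coord f i b - coord f i a"
  have 1: "path_sig f s b (v @ [i]) = (\<Sum>k\<le>length v. ?P (take k v) * ?Q (drop k v @ [i])) + ?P (v @ [i])"
    unfolding path_sig_Chen[OF f assms(2,3,4), of "v @ [i]"] tensor_mult_snoc
    by (simp add: tensor_mult_take)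
  have 2: "path_sig f s b v = (\<Sum>k\<le>length v. ?P (take k v) * ?Q (drop k v))"
    unfolding path_sig_Chen[OF f assms(2,3,4), of v] by (simp add: tensor_mult_take)
  have 3: "?P v = (\<Sum>k\<le>length v. ?P (take k v) * (if drop k v = [] then 1 else 0))"
  proof -
    have "(\<Sum>k\<le>length v. ?P (take k v) * (if drop k v = [] then 1 else 0)) =
        (\<Sum>k\<le>length v. if k = length v then ?P v else 0)"
      by (intro sum.cong) auto
    then show ?thesis by simp
  qed
  have 4: "(?P v + path_sig f s b v) / 2 =
      (\<Sum>k\<le>length v. ?P (take k v) * (if drop k v = [] then 1 else ?Q (drop k v) / 2))"
    unfolding 2 by (subst 3) (auto simp: sum.distrib[symmetric] sum_divide_distrib intro!: sum.cong)
  show ?thesis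
    unfolding trapezoid_error_def local_error_def 1 4
    by (simp add: sum_distrib_right right_diff_distrib sum_subtractf mult.assoc)
qed

text \<open>Distance and oscillation are kept at most 1 so that their higher powers are dominated by lower ones.\<close>

definition close_points :: "(real \<Rightarrow> real) \<Rightarrow> real set \<Rightarrow> real \<Rightarrow> real \<Rightarrow> real \<Rightarrow> bool" where
  "close_points f Q a b \<omega> \<longleftrightarrow> a \<in> Q \<and> b \<in> Q \<and> a \<le> b \<and> b - a \<le> 1 \<and> \<omega> \<le> 1 \<and>
     (\<forall>x\<in>{a..b}. \<forall>y\<in>{a..b}. \<bar>f x - f y\<bar> \<le> \<omega>)"

lemma close_pointsD:
  assumes "close_points f Q a b \<omega>"
  shows "a \<in> Q" "b \<in> Q" "a \<le> b" "b - a \<le> 1" "\<omega> \<le> 1"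
    "\<forall>x\<in>{a..b}. \<forall>y\<in>{a..b}. \<bar>f x - f y\<bar> \<le> \<omega>"
  using assms by (auto simp: close_points_def)

text \<open>An error of this size has vanishing sums along partitions with vanishing mesh and vanishing cubic
variation of \<open>f\<close>. The points are restricted to \<open>Q\<close> because some identities will only be known at
the points of countably many partitions.\<close>

definition negligible_on :: "(real \<Rightarrow> real) \<Rightarrow> real set \<Rightarrow> (real \<Rightarrow> real \<Rightarrow> real) \<Rightarrow> bool" where
  "negligible_on f Q E \<longleftrightarrow> (\<exists>C\<ge>0. \<forall>a b \<omega>. close_points f Q a b \<omega> \<longrightarrow>
     \<bar>E a b\<bar> \<le> C * (\<bar>f b - f a\<bar> ^ 3 + (b - a) * (b - a + \<omega>)))"

lemma negligible_scale_nonneg: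
  assumes "a \<le> b" "\<forall>x\<in>{a..b}. \<forall>y\<in>{a..b}. \<bar>f x - f y\<bar> \<le> \<omega>"
  shows "0 \<le> \<bar>f b - f a :: real\<bar> ^ 3 + (b - a) * (b - a + \<omega>)"
proof -
  have "0 \<le> \<omega>" using assms by force
  then show ?thesis using assms by (intro add_nonneg_nonneg mult_nonneg_nonneg) auto
qed

lemma negligible_onI:
  assumes "\<And>a b \<omega>. close_points f Q a b \<omega> \<Longrightarrow>
     \<bar>E a b\<bar> \<le> C * (\<bar>f b - f a\<bar> ^ 3 + (b - a) * (b - a + \<omega>))"
  shows "negligible_on f Q E"
  unfolding negligible_on_def
proof (intro exI[of _ "\<bar>C\<bar>"] conjI allI impI)
  fix a b \<omega> assume cl: "close_points f Q a b \<omega>"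
  note * = close_pointsD[OF cl]
  have "\<bar>E a b\<bar> \<le> C * (\<bar>f b - f a\<bar> ^ 3 + (b - a) * (b - a + \<omega>))" by (rule assms[OF cl])
  also have "\<dots> \<le> \<bar>C\<bar> * (\<bar>f b - f a\<bar> ^ 3 + (b - a) * (b - a + \<omega>))"
    by (rule mult_right_mono) (use negligible_scale_nonneg[OF *(3,6)] in auto)
  finally show "\<bar>E a b\<bar> \<le> \<bar>C\<bar> * (\<bar>f b - f a\<bar> ^ 3 + (b - a) * (b - a + \<omega>))" .
qed auto

lemma negligible_add:
  assumes "negligible_on f Q E" "negligible_on f Q F"
  shows "negligible_on f Q (\<lambda>a b. E a b + F a b)"
proof -
  obtain C where C: "\<And>a b \<omega>. close_points f Q a b \<omega> \<Longrightarrow>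
     \<bar>E a b\<bar> \<le> C * (\<bar>f b - f a\<bar> ^ 3 + (b - a) * (b - a + \<omega>))"
    using assms(1) unfolding negligible_on_def by blast
  obtain D where D: "\<And>a b \<omega>. close_points f Q a b \<omega> \<Longrightarrow>
     \<bar>F a b\<bar> \<le> D * (\<bar>f b - f a\<bar> ^ 3 + (b - a) * (b - a + \<omega>))"
    using assms(2) unfolding negligible_on_def by blast
  show ?thesis
  proof (rule negligible_onI[where C = "C + D"])
    fix a b \<omega> assume cl: "close_points f Q a b \<omega>"
    note * = close_pointsD[OF cl]
    show "\<bar>E a b + F a b\<bar> \<le> (C + D) * (\<bar>f b - f a\<bar> ^ 3 + (b - a) * (b - a + \<omega>))"
      using C[OF cl] D[OF cl] by (simp add: distrib_right)
  qed
qed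

lemma negligible_mult:
  assumes E: "negligible_on f Q E" and g: "\<And>a b. a \<in> Q \<Longrightarrow> b \<in> Q \<Longrightarrow> \<bar>g a b\<bar> \<le> K"
  shows "negligible_on f Q (\<lambda>a b. g a b * E a b)"
proof -
  obtain C where C0: "C \<ge> 0" and C: "\<And>a b \<omega>. close_points f Q a b \<omega> \<Longrightarrow>
     \<bar>E a b\<bar> \<le> C * (\<bar>f b - f a\<bar> ^ 3 + (b - a) * (b - a + \<omega>))"
    using assms(1) unfolding negligible_on_def by blast
  show ?thesis
  proof (rule negligible_onI[where C = "K * C"])
    fix a b \<omega> assume cl: "close_points f Q a b \<omega>"
    note * = close_pointsD[OF cl]
    have "0 \<le> K" using g[OF *(1,2)] by linarith
    then show "\<bar>g a b * E a b\<bar> \<le> K * C * (\<bar>f b - f a\<bar> ^ 3 + (b - a) * (b - a + \<omega>))"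
      using mult_mono[OF g[OF *(1,2)] C[OF cl]] by (simp add: abs_mult mult_ac)
  qed
qed

lemma negligible_zero: "negligible_on f Q (\<lambda>a b. 0)"
  by (rule negligible_onI[where C = 0]) auto

lemma negligible_sum_mset:
  "(\<And>u. negligible_on f Q (E u)) \<Longrightarrow> negligible_on f Q (\<lambda>a b. \<Sum>u\<in>#A. E u a b)"
  by (induction A) (auto intro: negligible_zero negligible_add)

lemma negligible_sum:
  "(\<And>u. u \<in> A \<Longrightarrow> negligible_on f Q (E u)) \<Longrightarrow> negligible_on f Q (\<lambda>a b. \<Sum>u\<in>A. E u a b)"
  by (induction A rule: infinite_finite_induct) (auto intro: negligible_zero negligible_add)

lemma negligible_cong:
  assumes "negligible_on f Q E" "\<And>a b. a \<in> Q \<Longrightarrow> b \<in> Q \<Longrightarrow> a \<le> b \<Longrightarrow> E' a b = E a b"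
  shows "negligible_on f Q E'"
  using assms unfolding negligible_on_def close_points_def by metis

lemma path_sig_bounded:
  assumes "continuous_on {s..T} f"
  obtains K where "\<And>a. a \<in> {s..T} \<Longrightarrow> \<bar>path_sig f s a v\<bar> \<le> K"
proof -
  have "bounded ((\<lambda>a. path_sig f s a v) ` {s..T})"
    by (intro compact_imp_bounded compact_continuous_image path_sig_continuous assms) auto
  then obtain K where "\<forall>x\<in>{s..T}. \<bar>path_sig f s x v\<bar> \<le> K"
    by (auto simp: bounded_iff)
  then show ?thesis using that by blast
qed

lemma trapezoid_error_negligible:
  assumes f: "continuous_on {s..T} f" and Q: "Q \<subseteq> {s..T}"
  shows "negligible_on f Q (trapezoid_error f s v i)"
proof (rule negligible_cong)
  show "negligible_on f Q (\<lambda>a b. \<Sum>k\<le>length v. path_sig f s a (take k v) * local_error f i a b (drop k v))"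
  proof (rule negligible_sum)
    fix k
    obtain K where "\<And>a. a \<in> {s..T} \<Longrightarrow> \<bar>path_sig f s a (take k v)\<bar> \<le> K"
      by (rule path_sig_bounded[OF f, of "take k v"]) blast
    moreover have "negligible_on f Q (\<lambda>a b. local_error f i a b (drop k v))"
    proof (rule negligible_onI, rule local_error_bound)
      fix a b \<omega> assume "close_points f Q a b \<omega>"
      then show "continuous_on {a..b} f"
        using Q by (intro continuous_on_subset[OF f]) (force simp: close_points_def)
    qed (auto simp: close_points_def)
    ultimately show "negligible_on f Q (\<lambda>a b. path_sig f s a (take k v) * local_error f i a b (drop k v))"
      using Q by (intro negligible_mult[where K = K]) auto
  qed
qed (use Q in \<open>auto intro!: trapezoid_error_local[OF f]\<close>)

text \<open>Brownian paths have nonzero quadratic variation, so the third power is the first one that can be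
asked to vanish; it suffices because the trapezoid rule is exact to second order.\<close>

definition null_cubic_variation ::
    "(real \<Rightarrow> real) \<Rightarrow> real \<Rightarrow> real \<Rightarrow> (nat \<Rightarrow> nat \<Rightarrow> real) \<Rightarrow> (nat \<Rightarrow> nat) \<Rightarrow> bool" where
  "null_cubic_variation f s t \<pi> N \<longleftrightarrow> (\<forall>n. partition_of s t (\<pi> n) (N n)) \<and>
     (\<lambda>n. mesh (\<pi> n) (N n)) \<longlonglongrightarrow> 0 \<and>
     (\<lambda>n. \<Sum>k<N n. \<bar>f (\<pi> n (Suc k)) - f (\<pi> n k)\<bar> ^ 3) \<longlonglongrightarrow> 0"

lemma partition_of_range:
  assumes "partition_of s t \<pi> N" "k \<le> N"
  shows "\<pi> k \<in> {s..t}"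
proof -
  have le: "\<pi> i \<le> \<pi> j" if "i \<le> j" "j \<le> N" for i j
    using that
  proof (induction j)
    case (Suc j)
    then show ?case using assms(1) by (cases "i = Suc j") (auto simp: partition_of_def intro: order_trans)
  qed auto
  show ?thesis using le[of 0 k] le[of k N] assms by (auto simp: partition_of_def)
qed

lemma mesh_bound: "k < N \<Longrightarrow> \<pi> (Suc k) - \<pi> k \<le> mesh \<pi> N"
  unfolding mesh_def by (rule Max_ge) auto

text \<open>The cubic terms add up to the cubic variation, the others to at most the length of the interval
times the sum of the mesh and the oscillation, which is small by uniform continuity.\<close>

lemma negligible_sum_tendsto:
  assumes f: "continuous_on {s..t} f" and P: "null_cubic_variation f s t \<pi> N"
    and E: "negligible_on f Q E" and Q: "\<And>n k. k \<le> N n \<Longrightarrow> \<pi> n k \<in> Q"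
  shows "(\<lambda>n. \<Sum>k<N n. E (\<pi> n k) (\<pi> n (Suc k))) \<longlonglongrightarrow> 0"
proof -
  obtain C where C0: "C \<ge> 0" and C: "\<And>a b \<omega>. close_points f Q a b \<omega> \<Longrightarrow>
     \<bar>E a b\<bar> \<le> C * (\<bar>f b - f a\<bar> ^ 3 + (b - a) * (b - a + \<omega>))"
    using E unfolding negligible_on_def by blast
  have part: "partition_of s t (\<pi> n) (N n)" for n using P by (simp add: null_cubic_variation_def)
  have mesh0: "(\<lambda>n. mesh (\<pi> n) (N n)) \<longlonglongrightarrow> 0" using P by (simp add: null_cubic_variation_def)
  define V where "V n = (\<Sum>k<N n. \<bar>f (\<pi> n (Suc k)) - f (\<pi> n k)\<bar> ^ 3)" for n
  have V0: "V \<longlonglongrightarrow> 0" using P by (simp add: null_cubic_variation_def V_def[abs_def])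
  have st: "s \<le> t" using partition_of_range[OF part[of 0], of 0] by auto
  show ?thesis
  proof (rule LIMSEQ_I)
    fix e :: real assume e: "e > 0"
    \<comment> \<open>the final estimate is \<open>2 (C + 1) (t - s + 1) \<epsilon>\<close>; the factor 4 makes it strict\<close>
    define \<epsilon> where "\<epsilon> = min 1 (e / (4 * (C + 1) * (t - s + 1)))"
    have \<epsilon>: "0 < \<epsilon>" "\<epsilon> \<le> 1" using e C0 st by (auto simp: \<epsilon>_def)
    have \<epsilon>e: "4 * (C + 1) * (t - s + 1) * \<epsilon> \<le> e"
    proof -
      have "0 < 4 * (C + 1) * (t - s + 1)" using C0 st by auto
      moreover have "\<epsilon> \<le> e / (4 * (C + 1) * (t - s + 1))" by (simp add: \<epsilon>_def)
      ultimately show ?thesis by (simp add: pos_le_divide_eq mult.commute)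
    qed
    have "uniformly_continuous_on {s..t} f"
      by (rule compact_uniformly_continuous[OF f]) auto
    then obtain d where d: "d > 0" "\<And>x y. x \<in> {s..t} \<Longrightarrow> y \<in> {s..t} \<Longrightarrow> dist y x < d \<Longrightarrow> dist (f y) (f x) < \<epsilon>"
      unfolding uniformly_continuous_on_def using \<epsilon> by metis
    have "eventually (\<lambda>n. mesh (\<pi> n) (N n) < min d \<epsilon>) sequentially"
      using mesh0 d \<epsilon> by (intro order_tendstoD) auto
    moreover have "eventually (\<lambda>n. V n < \<epsilon>) sequentially"
      using V0 \<epsilon> by (intro order_tendstoD) auto
    ultimately have "eventually (\<lambda>n. norm ((\<Sum>k<N n. E (\<pi> n k) (\<pi> n (Suc k))) - 0) < e) sequentially"
    proof eventually_elim
      case (elim n)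
      have bound: "\<bar>E (\<pi> n k) (\<pi> n (Suc k))\<bar> \<le>
          C * (\<bar>f (\<pi> n (Suc k)) - f (\<pi> n k)\<bar> ^ 3 + (\<pi> n (Suc k) - \<pi> n k) * (2 * \<epsilon>))" if k: "k < N n" for k
      proof -
        let ?a = "\<pi> n k" and ?b = "\<pi> n (Suc k)"
        have ab: "?a \<le> ?b" using part[of n] k by (simp add: partition_of_def)
        have h: "?b - ?a < min d \<epsilon>" using mesh_bound[of k "N n" "\<pi> n"] k elim by linarith
        have r: "?a \<in> {s..t}" "?b \<in> {s..t}"
          using partition_of_range[OF part[of n]] k by auto
        have osc: "\<forall>x\<in>{?a..?b}. \<forall>y\<in>{?a..?b}. \<bar>f x - f y\<bar> \<le> \<epsilon>"
        proof (intro ballI)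
          fix x y assume xy: "x \<in> {?a..?b}" "y \<in> {?a..?b}"
          then have "dist x y < d" using h by (auto simp: dist_real_def abs_if)
          then show "\<bar>f x - f y\<bar> \<le> \<epsilon>"
            using d(2)[of y x] xy r by (auto simp: dist_real_def)
        qed
        have "\<bar>E ?a ?b\<bar> \<le> C * (\<bar>f ?b - f ?a\<bar> ^ 3 + (?b - ?a) * (?b - ?a + \<epsilon>))"
          by (rule C) (use Q k ab h \<epsilon> osc in \<open>auto simp: close_points_def\<close>)
        also have "\<dots> \<le> C * (\<bar>f ?b - f ?a\<bar> ^ 3 + (?b - ?a) * (2 * \<epsilon>))"
          using h ab C0 by (intro mult_left_mono add_left_mono) auto
        finally show ?thesis .
      qed
      have tel: "(\<Sum>k<N n. \<pi> n (Suc k) - \<pi> n k) = t - s"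
        using part[of n] by (simp add: sum_lessThan_telescope partition_of_def)
      have "\<bar>\<Sum>k<N n. E (\<pi> n k) (\<pi> n (Suc k))\<bar> \<le> (\<Sum>k<N n.
          C * (\<bar>f (\<pi> n (Suc k)) - f (\<pi> n k)\<bar> ^ 3 + (\<pi> n (Suc k) - \<pi> n k) * (2 * \<epsilon>)))"
        by (rule order_trans[OF sum_abs]) (auto intro!: sum_mono bound)
      also have "\<dots> = C * (V n + (t - s) * (2 * \<epsilon>))"
        unfolding V_def tel[symmetric] sum_distrib_right
        by (simp add: sum_distrib_left[symmetric] sum.distrib)
      also have "\<dots> \<le> C * (\<epsilon> + (t - s) * (2 * \<epsilon>))"
        using elim C0 by (intro mult_left_mono) auto
      also have "\<dots> < e"
      proof -
        have "C * (\<epsilon> + (t - s) * (2 * \<epsilon>)) \<le> (C + 1) * (2 * (t - s + 1) * \<epsilon>)"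
        proof (rule mult_mono)
          have "0 \<le> (t - s) * \<epsilon>" using \<epsilon> st by auto
          then show "\<epsilon> + (t - s) * (2 * \<epsilon>) \<le> 2 * (t - s + 1) * \<epsilon>"
            using \<epsilon> by (simp add: algebra_simps)
        qed (use C0 \<epsilon> st in auto)
        moreover have "0 < (C + 1) * (2 * (t - s + 1) * \<epsilon>)" using C0 \<epsilon> st by auto
        moreover have "2 * ((C + 1) * (2 * (t - s + 1) * \<epsilon>)) \<le> e"
          using \<epsilon>e by (simp add: algebra_simps)
        ultimately show ?thesis by linarith
      qed
      finally show ?case by simp
    qed
    then show "\<exists>no. \<forall>n\<ge>no. norm ((\<Sum>k<N n. E (\<pi> n k) (\<pi> n (Suc k))) - 0) < e"
      by (simp add: eventually_sequentially)
  qed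
qed

lemma trapezoid_sums_tendsto:
  assumes f: "continuous_on {s..t} f" and P: "null_cubic_variation f s t \<pi> N"
  shows "(\<lambda>n. \<Sum>k<N n. (path_sig f s (\<pi> n k) v + path_sig f s (\<pi> n (Suc k)) v) / 2 *
      (coord f i (\<pi> n (Suc k)) - coord f i (\<pi> n k))) \<longlonglongrightarrow> path_sig f s t (v @ [i])"
proof -
  have part: "partition_of s t (\<pi> n) (N n)" for n using P by (simp add: null_cubic_variation_def)
  let ?F = "\<lambda>n k. path_sig f s (\<pi> n k) (v @ [i])"
  have "(\<lambda>n. \<Sum>k<N n. trapezoid_error f s v i (\<pi> n k) (\<pi> n (Suc k))) \<longlonglongrightarrow> 0"
    by (rule negligible_sum_tendsto[OF f P trapezoid_error_negligible[OF f order_refl]])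
       (use partition_of_range[OF part] in auto)
  from tendsto_diff[OF tendsto_const[of "path_sig f s t (v @ [i])"] this]
  have "(\<lambda>n. path_sig f s t (v @ [i]) - (\<Sum>k<N n. trapezoid_error f s v i (\<pi> n k) (\<pi> n (Suc k))))
      \<longlonglongrightarrow> path_sig f s t (v @ [i])" by simp
  moreover have "path_sig f s t (v @ [i]) - (\<Sum>k<N n. trapezoid_error f s v i (\<pi> n k) (\<pi> n (Suc k))) =
      (\<Sum>k<N n. (path_sig f s (\<pi> n k) v + path_sig f s (\<pi> n (Suc k)) v) / 2 *
      (coord f i (\<pi> n (Suc k)) - coord f i (\<pi> n k)))" for n
  proof -
    have "(\<Sum>k<N n. ?F n (Suc k) - ?F n k) = path_sig f s t (v @ [i])"
      using part[of n] sum_lessThan_telescope[of "?F n" "N n"]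
      by (simp add: partition_of_def path_sig_refl)
    then show ?thesis
      unfolding trapezoid_error_def by (simp add: sum_subtractf)
  qed
  ultimately show ?thesis by simp
qed


text \<open>To first order the increment is the average of the integrand times the increment of the path.\<close>

lemma path_sig_increment:
  assumes f: "continuous_on {s..T} f" and Q: "Q \<subseteq> {s..T}"
  obtains K where "K \<ge> 0" "\<And>a b \<omega>. close_points f Q a b \<omega> \<Longrightarrow>
     \<bar>path_sig f s b v - path_sig f s a v\<bar> \<le> K * (\<bar>f b - f a\<bar> + (b - a))"
proof (cases v rule: rev_cases)
  case Nil
  then show ?thesis using that[of 0] by simp
next
  case (snoc w i)
  obtain K where K: "\<And>a. a \<in> {s..T} \<Longrightarrow> \<bar>path_sig f s a w\<bar> \<le> K"
    by (rule path_sig_bounded[OF f, of w]) blast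
  obtain C where C0: "C \<ge> 0" and C: "\<And>a b \<omega>. close_points f Q a b \<omega> \<Longrightarrow>
     \<bar>trapezoid_error f s w i a b\<bar> \<le> C * (\<bar>f b - f a\<bar> ^ 3 + (b - a) * (b - a + \<omega>))"
    using trapezoid_error_negligible[OF f Q, of w i] unfolding negligible_on_def by blast
  show ?thesis
  proof (rule that[of "\<bar>K\<bar> + 2 * C"])
    fix a b \<omega> assume cl: "close_points f Q a b \<omega>"
    note * = close_pointsD[OF cl]
    let ?L = "\<bar>f b - f a\<bar> + (b - a)"
    have d: "\<bar>f b - f a\<bar> \<le> 1" using * by force
    have om0: "0 \<le> \<omega>" using * by force
    have 1: "\<bar>coord f i b - coord f i a\<bar> \<le> ?L"
      using * by (cases i) (auto simp: coord_def)
    have "\<bar>(path_sig f s a w + path_sig f s b w) / 2\<bar> \<le> \<bar>K\<bar>"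
      using K[of a] K[of b] * Q by (auto simp: abs_le_iff subset_iff)
    from mult_mono[OF this 1] have 2: "\<bar>(path_sig f s a w + path_sig f s b w) / 2 * (coord f i b - coord f i a)\<bar> \<le> \<bar>K\<bar> * ?L"
      by (simp add: abs_mult)
    have "\<bar>f b - f a\<bar> ^ 3 \<le> \<bar>f b - f a\<bar> ^ 1" using d by (intro power_decreasing) auto
    moreover have "(b - a) * (b - a + \<omega>) \<le> (b - a) * 2" using * by (intro mult_left_mono) auto
    ultimately have "\<bar>f b - f a\<bar> ^ 3 + (b - a) * (b - a + \<omega>) \<le> 2 * ?L"
    proof -
      have "x3 \<le> x ^ 1 \<Longrightarrow> 0 \<le> x \<Longrightarrow> r \<le> h * 2 \<Longrightarrow> x3 + r \<le> 2 * (x + h)" for x3 x r h :: real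
        by simp
      then show "\<bar>f b - f a\<bar> ^ 3 \<le> \<bar>f b - f a\<bar> ^ 1 \<Longrightarrow> (b - a) * (b - a + \<omega>) \<le> (b - a) * 2 \<Longrightarrow> ?thesis"
        by (metis abs_ge_zero)
    qed
    then have "C * (\<bar>f b - f a\<bar> ^ 3 + (b - a) * (b - a + \<omega>)) \<le> C * (2 * ?L)"
      using C0 by (rule mult_left_mono)
    from order_trans[OF C[OF cl] this] have 3: "\<bar>trapezoid_error f s w i a b\<bar> \<le> 2 * C * ?L"
      by (simp only: mult_ac)
    have "path_sig f s b v - path_sig f s a v = trapezoid_error f s w i a b
        + (path_sig f s a w + path_sig f s b w) / 2 * (coord f i b - coord f i a)"
      by (simp add: trapezoid_error_def snoc)
    then have "\<bar>path_sig f s b v - path_sig f s a v\<bar> \<le> \<bar>trapezoid_error f s w i a b\<bar>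
        + \<bar>(path_sig f s a w + path_sig f s b w) / 2 * (coord f i b - coord f i a)\<bar>"
      by (simp only: abs_triangle_ineq)
    also have "\<dots> \<le> 2 * C * ?L + \<bar>K\<bar> * ?L" by (rule add_mono[OF 3 2])
    also have "\<dots> = (\<bar>K\<bar> + 2 * C) * ?L" by (simp only: distrib_right add.commute)
    finally show "\<bar>path_sig f s b v - path_sig f s a v\<bar> \<le> (\<bar>K\<bar> + 2 * C) * ?L" .
  qed (use C0 in auto)
qed

lemma triple_increment_negligible:
  assumes f: "continuous_on {s..T} f" and Q: "Q \<subseteq> {s..T}"
  shows "negligible_on f Q (\<lambda>a b. (path_sig f s b v - path_sig f s a v) *
    (path_sig f s b w - path_sig f s a w) * (coord f i b - coord f i a))"
proof -
  obtain K where K0: "K \<ge> 0" and K: "\<And>a b \<omega>. close_points f Q a b \<omega> \<Longrightarrow>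
     \<bar>path_sig f s b v - path_sig f s a v\<bar> \<le> K * (\<bar>f b - f a\<bar> + (b - a))"
    by (rule path_sig_increment[OF f Q, of v]) blast
  obtain L where L0: "L \<ge> 0" and L: "\<And>a b \<omega>. close_points f Q a b \<omega> \<Longrightarrow>
     \<bar>path_sig f s b w - path_sig f s a w\<bar> \<le> L * (\<bar>f b - f a\<bar> + (b - a))"
    by (rule path_sig_increment[OF f Q, of w]) blast
  show ?thesis
  proof (rule negligible_onI[where C = "K * L * 4"])
    fix a b \<omega> assume cl: "close_points f Q a b \<omega>"
    note * = close_pointsD[OF cl]
    let ?d = "\<bar>f b - f a\<bar>" and ?h = "b - a"
    have om0: "0 \<le> \<omega>" using * by force
    have 1: "\<bar>coord f i b - coord f i a\<bar> \<le> ?d + ?h"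
      using * by (cases i) (auto simp: coord_def)
    have "\<bar>path_sig f s b v - path_sig f s a v\<bar> * \<bar>path_sig f s b w - path_sig f s a w\<bar> * \<bar>coord f i b - coord f i a\<bar>
        \<le> (K * (?d + ?h)) * (L * (?d + ?h)) * (?d + ?h)"
      by (intro mult_mono K[OF cl] L[OF cl] 1) (use K0 L0 * in auto)
    also have "\<dots> = K * L * (?d + ?h) ^ 3" by (simp add: power3_eq_cube mult_ac)
    also have "\<dots> \<le> K * L * (4 * (?d ^ 3 + ?h * (?h + \<omega>)))"
    proof (rule mult_left_mono)
      have p: "(x + y) ^ 3 \<le> 4 * (x ^ 3 + y ^ 3)" if "0 \<le> x" "0 \<le> y" for x y :: real
      proof -
        have "4 * (x ^ 3 + y ^ 3) - (x + y) ^ 3 = 3 * ((x + y) * (x - y)\<^sup>2)"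
          by (simp add: power3_eq_cube power2_eq_square algebra_simps)
        moreover have "0 \<le> 3 * ((x + y) * (x - y)\<^sup>2)" using that by auto
        ultimately show ?thesis by linarith
      qed
      have "?h ^ 3 \<le> ?h ^ 2" using * by (intro power_decreasing) auto
      also have "\<dots> \<le> ?h * (?h + \<omega>)" using om0 * by (simp add: power2_eq_square mult_left_mono)
      finally show "(?d + ?h) ^ 3 \<le> 4 * (?d ^ 3 + ?h * (?h + \<omega>))"
        using p[of ?d ?h] * by auto
    qed (use K0 L0 in auto)
    finally show "\<bar>(path_sig f s b v - path_sig f s a v) * (path_sig f s b w - path_sig f s a w) * (coord f i b - coord f i a)\<bar>
       \<le> K * L * 4 * (?d ^ 3 + ?h * (?h + \<omega>))"
      by (simp add: abs_mult mult_ac)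
  qed
qed

lemma sum_mset_subtractf:
  fixes g h :: "'b \<Rightarrow> real"
  shows "(\<Sum>u\<in>#A. g u - h u) = (\<Sum>u\<in>#A. g u) - (\<Sum>u\<in>#A. h u)"
  by (induction A) auto

text \<open>One half of the product rule. To first order, \<open>(x(a) + x(b)) / 2\<close> times the increment of \<open>wj\<close> is the
product of the averages of \<open>x\<close> and \<open>w\<close> times the increment of the coordinate \<open>j\<close>. The product of the
averages differs from the average of the product by a quarter of a product of two increments, and the
shuffle identity assumed for \<open>x\<close> and \<open>w\<close> makes the average of the product linear in coefficients.\<close>

lemma half_product_negligible:
  assumes f: "continuous_on {s..T} f" and Q: "Q \<subseteq> {s..T}"
    and id: "\<And>a. a \<in> Q \<Longrightarrow> path_sig f s a x * path_sig f s a w = (\<Sum>u\<in>#A. path_sig f s a u)"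
  shows "negligible_on f Q (\<lambda>a b. (path_sig f s a x + path_sig f s b x) / 2 *
       (path_sig f s b (w @ [j]) - path_sig f s a (w @ [j]))
     - (\<Sum>u\<in>#A. path_sig f s b (u @ [j]) - path_sig f s a (u @ [j])))"
proof (rule negligible_cong)
  obtain K where K: "\<And>a. a \<in> {s..T} \<Longrightarrow> \<bar>path_sig f s a x\<bar> \<le> K"
    by (rule path_sig_bounded[OF f, of x]) blast
  show "negligible_on f Q (\<lambda>a b.
      (path_sig f s a x + path_sig f s b x) / 2 * trapezoid_error f s w j a b
      + ((-1/4) * ((path_sig f s b x - path_sig f s a x) * (path_sig f s b w - path_sig f s a w)
          * (coord f j b - coord f j a))
      + (-1) * (\<Sum>u\<in>#A. trapezoid_error f s u j a b)))"
  proof (intro negligible_add)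
    show "negligible_on f Q (\<lambda>a b. (path_sig f s a x + path_sig f s b x) / 2 * trapezoid_error f s w j a b)"
    proof (rule negligible_mult[where K = K])
      fix a b assume "a \<in> Q" "b \<in> Q"
      then show "\<bar>(path_sig f s a x + path_sig f s b x) / 2\<bar> \<le> K"
        using K[of a] K[of b] Q by (simp add: subset_iff abs_le_iff)
    qed (rule trapezoid_error_negligible[OF f Q])
    show "negligible_on f Q (\<lambda>a b. (-1/4) * ((path_sig f s b x - path_sig f s a x)
        * (path_sig f s b w - path_sig f s a w) * (coord f j b - coord f j a)))"
      by (rule negligible_mult[where K = 1, OF triple_increment_negligible[OF f Q]]) simp
    show "negligible_on f Q (\<lambda>a b. (-1) * (\<Sum>u\<in>#A. trapezoid_error f s u j a b))"
      by (rule negligible_mult[where K = 1, OF negligible_sum_mset[OF trapezoid_error_negligible[OF f Q]]]) simp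
  qed
next
  fix a b assume ab: "a \<in> Q" "b \<in> Q"
  let ?d = "coord f j b - coord f j a"
  have "(\<Sum>u\<in>#A. trapezoid_error f s u j a b) =
     (\<Sum>u\<in>#A. path_sig f s b (u @ [j]) - path_sig f s a (u @ [j]))
     - (\<Sum>u\<in>#A. (path_sig f s a u + path_sig f s b u) * (?d / 2))"
    unfolding trapezoid_error_def sum_mset_subtractf by simp
  also have "(\<Sum>u\<in>#A. (path_sig f s a u + path_sig f s b u) * (?d / 2)) =
      (path_sig f s a x * path_sig f s a w + path_sig f s b x * path_sig f s b w) * (?d / 2)"
    unfolding sum_mset_distrib_right[symmetric] sum_mset.distrib id[OF ab(1)] id[OF ab(2)] ..
  finally show "(path_sig f s a x + path_sig f s b x) / 2 *
       (path_sig f s b (w @ [j]) - path_sig f s a (w @ [j]))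
     - (\<Sum>u\<in>#A. path_sig f s b (u @ [j]) - path_sig f s a (u @ [j])) =
      (path_sig f s a x + path_sig f s b x) / 2 * trapezoid_error f s w j a b
      + ((-1/4) * ((path_sig f s b x - path_sig f s a x) * (path_sig f s b w - path_sig f s a w) * ?d)
      + (-1) * (\<Sum>u\<in>#A. trapezoid_error f s u j a b))"
    unfolding trapezoid_error_def by (simp add: field_simps)
qed

text \<open>The discrete product rule \<open>\<Delta>(ab) = avg(a) \<Delta>b + avg(b) \<Delta>a\<close> is exact. Hence the defect in the shuffle
identity has negligible increments along the partitions, and it vanishes at time \<open>s\<close>.\<close>

lemma path_sig_shuffle_step:
  assumes f: "continuous_on {s..t} f" and P: "null_cubic_variation f s t \<pi> N"
    and id1: "\<And>n k. k \<le> N n \<Longrightarrow> path_sig f s (\<pi> n k) (v @ [i]) * path_sig f s (\<pi> n k) w =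
        (\<Sum>u\<in>#word_shuffle (v @ [i]) w. path_sig f s (\<pi> n k) u)"
    and id2: "\<And>n k. k \<le> N n \<Longrightarrow> path_sig f s (\<pi> n k) v * path_sig f s (\<pi> n k) (w @ [j]) =
        (\<Sum>u\<in>#word_shuffle v (w @ [j]). path_sig f s (\<pi> n k) u)"
  shows "path_sig f s t (v @ [i]) * path_sig f s t (w @ [j]) =
        (\<Sum>u\<in>#word_shuffle (v @ [i]) (w @ [j]). path_sig f s t u)"
proof -
  have part: "partition_of s t (\<pi> n) (N n)" for n using P by (simp add: null_cubic_variation_def)
  define Q where "Q = {\<pi> n k | n k. k \<le> N n}"
  have Q: "Q \<subseteq> {s..t}" using partition_of_range[OF part] by (auto simp: Q_def)
  define D where "D a = path_sig f s a (v @ [i]) * path_sig f s a (w @ [j])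
      - (\<Sum>u\<in>#word_shuffle (v @ [i]) (w @ [j]). path_sig f s a u)" for a
  have "negligible_on f Q (\<lambda>a b.
      ((path_sig f s a (v @ [i]) + path_sig f s b (v @ [i])) / 2 *
       (path_sig f s b (w @ [j]) - path_sig f s a (w @ [j]))
     - (\<Sum>u\<in>#word_shuffle (v @ [i]) w. path_sig f s b (u @ [j]) - path_sig f s a (u @ [j])))
    + ((path_sig f s a (w @ [j]) + path_sig f s b (w @ [j])) / 2 *
       (path_sig f s b (v @ [i]) - path_sig f s a (v @ [i]))
     - (\<Sum>u\<in>#word_shuffle v (w @ [j]). path_sig f s b (u @ [i]) - path_sig f s a (u @ [i]))))"
    by (intro negligible_add half_product_negligible[OF f Q])
       (use id1 id2 in \<open>auto simp: Q_def mult.commute\<close>)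
  then have "negligible_on f Q (\<lambda>a b. D b - D a)"
    by (rule negligible_cong)
       (simp add: D_def word_shuffle_snoc sum_mset_subtractf image_mset.compositionality comp_def field_simps)
  from negligible_sum_tendsto[OF f P this]
  have "(\<lambda>n. \<Sum>k<N n. D (\<pi> n (Suc k)) - D (\<pi> n k)) \<longlonglongrightarrow> 0"
    by (auto simp: Q_def)
  moreover have "(\<Sum>k<N n. D (\<pi> n (Suc k)) - D (\<pi> n k)) = D t - D s" for n
    using part[of n] sum_lessThan_telescope[of "\<lambda>k. D (\<pi> n k)" "N n"]
    by (simp add: partition_of_def)
  ultimately have "D t = D s" by (simp add: LIMSEQ_const_iff)
  also have "D s = 0"
  proof -
    have "(\<Sum>u\<in>#word_shuffle (v @ [i]) (w @ [j]). path_sig f s s u) =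
        (\<Sum>u\<in>#word_shuffle (v @ [i]) (w @ [j]). 0)"
      by (intro arg_cong[where f = sum_mset] image_mset_cong path_sig_refl)
         (auto dest: length_in_word_shuffle)
    then show ?thesis by (simp add: D_def path_sig_refl)
  qed
  finally show ?thesis by (simp add: D_def)
qed

section \<open>Growth of the signature coefficients\<close>

lemma weak_Young:
  fixes x y :: real
  assumes "0 \<le> x" "0 \<le> y"
  shows "x ^ i * y ^ j \<le> x ^ (i + j) + y ^ (i + j)"
proof (cases "x \<le> y")
  case True
  then have "x ^ i * y ^ j \<le> y ^ i * y ^ j" using assms by (intro mult_right_mono power_mono) auto
  also have "\<dots> \<le> x ^ (i + j) + y ^ (i + j)" using assms by (simp add: power_add)
  finally show ?thesis .
next
  case False
  then have "x ^ i * y ^ j \<le> x ^ i * x ^ j" using assms by (intro mult_left_mono power_mono) auto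
  also have "\<dots> \<le> x ^ (i + j) + y ^ (i + j)" using assms by (simp add: power_add)
  finally show ?thesis .
qed

lemma power_add_le:
  fixes x y :: real
  assumes "0 \<le> x" "0 \<le> y"
  shows "(x + y) ^ j \<le> 2 ^ j * (x ^ j + y ^ j)"
proof -
  have "(x + y) ^ j \<le> (2 * max x y) ^ j" using assms by (intro power_mono) auto
  also have "\<dots> = 2 ^ j * max x y ^ j" by (simp add: power_mult_distrib)
  also have "\<dots> \<le> 2 ^ j * (x ^ j + y ^ j)" using assms by (intro mult_left_mono) (auto simp: max_def)
  finally show ?thesis .
qed

text \<open>The summand 1 makes the powers of the height increasing in the exponent.\<close>

definition height :: "(real \<Rightarrow> real) \<Rightarrow> real \<Rightarrow> real \<Rightarrow> real" where
  "height f t r = 1 + \<bar>f r - f t\<bar>"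

definition moment :: "(real \<Rightarrow> real) \<Rightarrow> real \<Rightarrow> real \<Rightarrow> nat \<Rightarrow> real" where
  "moment f t T k = integral {t..T} (\<lambda>r. height f t r ^ k)"

lemma height_ge_1: "1 \<le> height f t r"
  by (simp add: height_def)

lemma height_power_ge_0 [simp]: "0 \<le> height f t r ^ k"
  by (simp add: height_def)

lemma height_integrable:
  assumes "continuous_on {t..T} f" "t \<le> T" "r \<le> T"
  shows "(\<lambda>r. height f t r ^ k) integrable_on {t..r}"
  unfolding height_def
  by (intro integrable_continuous_interval continuous_intros continuous_on_subset[OF assms(1)]) (use assms in auto)

lemma moment_ge_0: "continuous_on {t..T} f \<Longrightarrow> t \<le> T \<Longrightarrow> 0 \<le> moment f t T k"
  unfolding moment_def by (rule integral_nonneg) (auto intro!: height_integrable)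

lemma moment_mono:
  assumes "continuous_on {t..T} f" "t \<le> T" "k \<le> l"
  shows "moment f t T k \<le> moment f t T l"
  unfolding moment_def
  by (rule integral_le) (use assms height_ge_1 in \<open>auto intro!: height_integrable power_increasing\<close>)

lemma moment_times_power:
  assumes f: "continuous_on {t..T} f" and t: "t \<le> T" "T - t \<le> L" and y: "1 \<le> y"
  shows "moment f t T k * y ^ j \<le> moment f t T (k + j) + L * y ^ (k + j)"
proof -
  have i: "(\<lambda>r. height f t r ^ k) integrable_on {t..T}" for k
    by (rule height_integrable) (use assms in auto)
  have "moment f t T k * y ^ j = integral {t..T} (\<lambda>r. height f t r ^ k * y ^ j)"
    unfolding moment_def by (simp add: integral_mult_left)
  also have "\<dots> \<le> integral {t..T} (\<lambda>r. height f t r ^ (k + j) + y ^ (k + j))"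
  proof (rule integral_le)
    show "(\<lambda>r. height f t r ^ k * y ^ j) integrable_on {t..T}" by (intro integrable_on_mult_left i)
    show "(\<lambda>r. height f t r ^ (k + j) + y ^ (k + j)) integrable_on {t..T}" by (intro integrable_add i) auto
  qed (use y height_ge_1[of f t] in \<open>auto intro!: weak_Young intro: order_trans[OF zero_le_one]\<close>)
  also have "\<dots> = moment f t T (k + j) + (T - t) * y ^ (k + j)"
    unfolding moment_def by (subst integral_add[OF i]) (use t in auto)
  also have "\<dots> \<le> moment f t T (k + j) + L * y ^ (k + j)"
    using t y by (intro add_left_mono mult_right_mono) auto
  finally show ?thesis .
qed

lemma integral_height_bound:
  assumes f: "continuous_on {t..T} f" and r: "t \<le> r" "r \<le> T" "T - t \<le> L"
    and g: "continuous_on {t..r} g" and AB: "0 \<le> A" "0 \<le> B"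
    and le: "\<And>\<tau>. \<tau> \<in> {t..r} \<Longrightarrow> \<bar>g \<tau>\<bar> \<le> A * height f t \<tau> ^ k + B"
  shows "\<bar>integral {t..r} g\<bar> \<le> A * moment f t T k + L * B"
proof -
  have i: "(\<lambda>\<tau>. height f t \<tau> ^ k) integrable_on {t..r}" "(\<lambda>\<tau>. height f t \<tau> ^ k) integrable_on {t..T}"
    by (auto intro!: height_integrable[OF f] simp: r order_trans[OF r(1,2)])
  have "norm (integral {t..r} g) \<le> integral {t..r} (\<lambda>\<tau>. A * height f t \<tau> ^ k + B)"
    by (rule integral_norm_bound_integral)
       (use i le in \<open>auto intro!: integrable_continuous_interval[OF g] integrable_add integrable_on_mult_right\<close>)
  also have "\<dots> = A * integral {t..r} (\<lambda>\<tau>. height f t \<tau> ^ k) + (r - t) * B"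
    using r by (subst integral_add) (auto intro!: i integrable_on_mult_right)
  also have "\<dots> \<le> A * moment f t T k + L * B"
    unfolding moment_def
    by (intro add_mono mult_left_mono mult_right_mono integral_subset_le i) (use AB r in auto)
  finally show ?thesis by simp
qed

text \<open>A coefficient is homogeneous in \<open>f\<close> of degree the number of letters 1, and it can be bounded by powers
of exactly this degree: increments are split at the base point, and the resulting mixed products are
separated by the weak form of Young's inequality. The constant is uniform over all intervals of length
at most \<open>L\<close>.\<close>

lemma path_sig_growth:
  assumes "0 \<le> L"
  shows "\<exists>C\<ge>0. \<forall>f t T r. continuous_on {t..T} f \<longrightarrow> t \<le> r \<longrightarrow> r \<le> T \<longrightarrow> T - t \<le> L \<longrightarrow>
    \<bar>path_sig f t r v\<bar> \<le> C * (height f t r ^ count_list v L1 + moment f t T (count_list v L1))"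
proof (induction v rule: word_induct_L0)
  case (pure k)
  have "\<bar>path_sig f t r (replicate k L1)\<bar> \<le> 1 * (height f t r ^ k + moment f t T k)"
    if "continuous_on {t..T} f" "t \<le> r" "r \<le> T" for f t T r
  proof -
    have "\<bar>f r - f t\<bar> ^ k / fact k \<le> height f t r ^ k / 1"
      by (intro frac_le power_mono) (auto simp: height_def)
    moreover have "0 \<le> moment f t T k" using that by (intro moment_ge_0) auto
    ultimately show ?thesis by (simp add: path_sig_pure power_abs)
  qed
  then show ?case by (intro exI[of _ 1]) (auto simp: count_list_replicate)
next
  case (L0 v j)
  define k where "k = count_list v L1"
  obtain C where C0: "C \<ge> 0" and C: "\<And>f t T r. continuous_on {t..T} f \<Longrightarrow> t \<le> r \<Longrightarrow> r \<le> T \<Longrightarrow> T - t \<le> L \<Longrightarrow>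
    \<bar>path_sig f t r v\<bar> \<le> C * (height f t r ^ k + moment f t T k)"
    using L0 unfolding k_def by blast
  define D where "D = C * 2 ^ j"
  have D0: "0 \<le> D" using C0 by (simp add: D_def)
  \<comment> \<open>the three summands come from powers of the intermediate height, which integrate to a moment, from
    moments that are constant under the integral, and from the final height\<close>
  have bound: "\<bar>path_sig f t r (v @ L0 # replicate j L1)\<bar> \<le>
      (D * ((2 + L) + L * 2 + L * (1 + L))) * (height f t r ^ (k + j) + moment f t T (k + j))"
    if f: "continuous_on {t..T} f" and r: "t \<le> r" "r \<le> T" "T - t \<le> L" for f t T r
  proof -
    let ?h = "height f t" and ?J = "moment f t T"
    have h1: "1 \<le> ?h x" for x by (rule height_ge_1)
    have h0: "0 \<le> ?h x" for x using h1[of x] by linarith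
    have J0: "0 \<le> ?J i" for i by (rule moment_ge_0) (use f r in auto)
    have tT: "t \<le> T" using r by simp
    have pt: "\<bar>path_sig f t \<tau> v * ((f r - f \<tau>) ^ j / fact j)\<bar> \<le>
        (D * (2 + L)) * ?h \<tau> ^ (k + j) + D * ((1 + L) * ?h r ^ (k + j) + 2 * ?J (k + j))"
      if \<tau>: "\<tau> \<in> {t..r}" for \<tau>
    proof -
      have "\<bar>f r - f \<tau>\<bar> ^ j / fact j \<le> (?h r + ?h \<tau>) ^ j / 1"
        by (intro frac_le power_mono) (auto simp: height_def)
      also have "\<dots> \<le> 2 ^ j * (?h r ^ j + ?h \<tau> ^ j)"
        using power_add_le[of "?h r" "?h \<tau>" j] h0 by simp
      finally have 1: "\<bar>(f r - f \<tau>) ^ j / fact j\<bar> \<le> 2 ^ j * (?h r ^ j + ?h \<tau> ^ j)"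
        by (simp add: power_abs)
      have "\<bar>path_sig f t \<tau> v\<bar> \<le> C * (?h \<tau> ^ k + ?J k)"
        by (rule C[OF f]) (use r \<tau> in auto)
      from mult_mono[OF this 1]
      have "\<bar>path_sig f t \<tau> v * ((f r - f \<tau>) ^ j / fact j)\<bar> \<le>
          (C * (?h \<tau> ^ k + ?J k)) * (2 ^ j * (?h r ^ j + ?h \<tau> ^ j))"
        using C0 J0 by (simp add: abs_mult)
      also have "\<dots> = D * (?h \<tau> ^ k * ?h r ^ j + ?h \<tau> ^ (k + j) + ?J k * ?h r ^ j + ?J k * ?h \<tau> ^ j)"
        by (simp add: D_def algebra_simps power_add)
      also have "\<dots> \<le> D * ((?h \<tau> ^ (k + j) + ?h r ^ (k + j)) + ?h \<tau> ^ (k + j)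
          + (?J (k + j) + L * ?h r ^ (k + j)) + (?J (k + j) + L * ?h \<tau> ^ (k + j)))"
        using h0 h1 by (intro mult_left_mono add_mono D0 weak_Young moment_times_power[OF f tT r(3)] order_refl) auto
      finally show ?thesis by (simp add: algebra_simps)
    qed
    have "\<bar>path_sig f t r (v @ L0 # replicate j L1)\<bar> \<le>
        (D * (2 + L)) * ?J (k + j) + L * (D * ((1 + L) * ?h r ^ (k + j) + 2 * ?J (k + j)))"
      unfolding path_sig_L0
    proof (rule integral_height_bound[OF f r])
      show "continuous_on {t..r} (\<lambda>\<tau>. path_sig f t \<tau> v * ((f r - f \<tau>) ^ j / fact j))"
        by (rule integrand_continuous[OF f]) (use r in auto)
    qed (use pt D0 assms J0 h0 in auto)
    also have "\<dots> = D * ((2 + L) + L * 2) * ?J (k + j) + D * (L * (1 + L)) * ?h r ^ (k + j)"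
      by (simp add: algebra_simps)
    also have "\<dots> \<le> D * ((2 + L) + L * 2 + L * (1 + L)) * ?J (k + j)
        + D * ((2 + L) + L * 2 + L * (1 + L)) * ?h r ^ (k + j)"
    proof -
      have "D * ((2 + L) + L * 2) \<le> D * ((2 + L) + L * 2 + L * (1 + L))"
        "D * (L * (1 + L)) \<le> D * ((2 + L) + L * 2 + L * (1 + L))"
        using D0 assms by (auto intro!: mult_left_mono)
      then show ?thesis using J0 by (intro add_mono mult_right_mono) auto
    qed
    finally show ?thesis by (simp add: algebra_simps)
  qed
  show ?case
    using bound D0 assms
    by (intro exI[of _ "D * ((2 + L) + L * 2 + L * (1 + L))"])
       (simp add: k_def[symmetric] count_list_replicate)
qed

text \<open>The last letter 0 integrates over the end point, so its height disappears from the bound.\<close>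

lemma path_sig_growth_L0:
  assumes "0 \<le> L"
  shows "\<exists>C\<ge>0. \<forall>f t T. continuous_on {t..T} f \<longrightarrow> t \<le> T \<longrightarrow> T - t \<le> L \<longrightarrow>
    \<bar>path_sig f t T (v @ [L0])\<bar> \<le> C * moment f t T (count_list v L1)"
proof -
  let ?k = "count_list v L1"
  obtain C where C0: "C \<ge> 0" and C: "\<And>f t T r. continuous_on {t..T} f \<Longrightarrow> t \<le> r \<Longrightarrow> r \<le> T \<Longrightarrow> T - t \<le> L \<Longrightarrow>
    \<bar>path_sig f t r v\<bar> \<le> C * (height f t r ^ ?k + moment f t T ?k)"
    using path_sig_growth[OF assms, of v] by blast
  have "\<bar>path_sig f t T (v @ [L0])\<bar> \<le> (C * (1 + L)) * moment f t T ?k"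
    if f: "continuous_on {t..T} f" and t: "t \<le> T" "T - t \<le> L" for f t T
  proof -
    have "\<bar>integral {t..T} (\<lambda>\<tau>. path_sig f t \<tau> v)\<bar> \<le> C * moment f t T ?k + L * (C * moment f t T ?k)"
      by (rule integral_height_bound[OF f t(1) order_refl t(2) path_sig_continuous[OF f]])
         (use C0 C[OF f _ _ t(2)] moment_ge_0[OF f t(1)] in \<open>auto simp: distrib_left\<close>)
    then show ?thesis
      using path_sig_L0[of f t T v 0] by (simp add: algebra_simps)
  qed
  then show ?thesis using C0 assms by (intro exI[of _ "C * (1 + L)"]) auto
qed

text \<open>The words whose coefficients are dominated by powers lower than \<open>d\<close> of the final height, if \<open>A\<close> holds,
and lower than \<open>e\<close> in the moment, if \<open>B\<close> holds. In the application \<open>A\<close> and \<open>B\<close> say that the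
coefficients \<open>\<alpha>\<close> and \<open>\<beta>\<close> do not vanish, \<open>d = 2n\<close> and \<open>e = 2m\<close>; the four alternatives correspond to the
constant, to \<open>q\<close>, to \<open>r\<close> followed by the letter 0, and to \<open>s\<close>.\<close>

definition controlled :: "bool \<Rightarrow> bool \<Rightarrow> nat \<Rightarrow> nat \<Rightarrow> word \<Rightarrow> bool" where
  "controlled A B d e w \<longleftrightarrow> w = [] \<or> A \<and> count_list w L0 = 0 \<and> count_list w L1 < d
     \<or> B \<and> (\<exists>v. w = v @ [L0] \<and> count_list v L1 < e)
     \<or> A \<and> B \<and> count_list w L1 < d \<and> count_list w L1 < e"

lemma controlled_suffix:
  assumes "controlled A B d e (v @ w)"
  shows "controlled A B d e w"
proof (cases w rule: rev_cases)
  case (snoc w' i)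
  then show ?thesis using assms by (auto simp: controlled_def)
qed (simp add: controlled_def)

text \<open>Cutting a nonempty prefix off a leading word lowers its degree.\<close>

lemma controlled_proper_suffix:
  assumes "v \<noteq> []"
  shows "A \<Longrightarrow> replicate d L1 = v @ w \<Longrightarrow> controlled A B d e w"
    "B \<Longrightarrow> replicate e L1 @ [L0] = v @ w \<Longrightarrow> controlled A B d e w"
proof -
  assume A: A and eq: "replicate d L1 = v @ w"
  have "set (v @ w) \<subseteq> {L1}" using eq[symmetric] by auto
  then have "count_list w L0 = 0" by (auto simp: count_list_0_iff)
  moreover have "length v + length w = d" using arg_cong[OF eq, of length] by simp
  then have "count_list w L1 < d" using assms count_list_letters[of w] by (cases v) auto
  ultimately show "controlled A B d e w" using A by (simp add: controlled_def)
next
  assume B: B and eq: "replicate e L1 @ [L0] = v @ w"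
  show "controlled A B d e w"
  proof (cases w rule: rev_cases)
    case (snoc w' i)
    then have eq': "replicate e L1 = v @ w'" and "i = L0" using eq by auto
    moreover have "length v + length w' = e" using arg_cong[OF eq', of length] by simp
    then have "count_list w' L1 < e" using assms count_list_letters[of w'] by (cases v) auto
    ultimately show ?thesis using B snoc by (auto simp: controlled_def)
  qed (simp add: controlled_def)
qed

definition lower_order :: "bool \<Rightarrow> bool \<Rightarrow> nat \<Rightarrow> nat \<Rightarrow> (real \<Rightarrow> real) \<Rightarrow> real \<Rightarrow> real \<Rightarrow> real" where
  "lower_order A B d e f t T =
     1 + (if A then height f t T ^ (d - 1) else 0) + (if B then moment f t T (e - 1) else 0)"

lemma lower_order_ge_1:
  "continuous_on {t..T} f \<Longrightarrow> t \<le> T \<Longrightarrow> 1 \<le> lower_order A B d e f t T"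
  using moment_ge_0[of t T f] by (simp add: lower_order_def)

lemma controlled_bound:
  assumes L: "0 \<le> L" and w: "controlled A B d e w"
  shows "\<exists>C\<ge>0. \<forall>f t T. continuous_on {t..T} f \<longrightarrow> t \<le> T \<longrightarrow> T - t \<le> L \<longrightarrow>
    \<bar>path_sig f t T w\<bar> \<le> C * lower_order A B d e f t T"
proof -
  consider "w = []" | "A" "count_list w L0 = 0" "count_list w L1 < d"
    | v where "B" "w = v @ [L0]" "count_list v L1 < e"
    | "A" "B" "count_list w L1 < d" "count_list w L1 < e"
    using w by (auto simp: controlled_def)
  then show ?thesis
  proof cases
    case 1
    then show ?thesis using lower_order_ge_1 by (intro exI[of _ 1]) auto
  next
    case 2
    define k where "k = count_list w L1"
    have "length w = k" using 2 count_list_letters[of w] by (simp add: k_def)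
    moreover have "L0 \<notin> set w" using 2 by (simp add: count_list_0_iff)
    ultimately have wk: "w = replicate k L1" by (intro replicate_eqI) (auto simp: not_L0[symmetric])
    have "\<bar>path_sig f t T w\<bar> \<le> 1 * lower_order A B d e f t T" if "continuous_on {t..T} f" "t \<le> T" for f t T
    proof -
      have "\<bar>f T - f t\<bar> ^ k / fact k \<le> height f t T ^ k / 1"
        by (intro frac_le power_mono) (auto simp: height_def)
      also have "\<dots> \<le> height f t T ^ (d - 1)"
        using 2 height_ge_1[of f t T] by (auto simp: k_def intro!: power_increasing)
      also have "\<dots> \<le> lower_order A B d e f t T"
        using 2 moment_ge_0[OF that] by (simp add: lower_order_def)
      finally show ?thesis by (simp add: wk path_sig_pure power_abs)
    qed
    then show ?thesis by (intro exI[of _ 1]) auto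
  next
    case 3
    obtain C where C0: "C \<ge> 0" and C: "\<And>f t T. continuous_on {t..T} f \<Longrightarrow> t \<le> T \<Longrightarrow> T - t \<le> L \<Longrightarrow>
      \<bar>path_sig f t T w\<bar> \<le> C * moment f t T (count_list v L1)"
      using path_sig_growth_L0[OF L, of v] 3 by blast
    have "\<bar>path_sig f t T w\<bar> \<le> C * lower_order A B d e f t T"
      if f: "continuous_on {t..T} f" "t \<le> T" "T - t \<le> L" for f t T
    proof -
      have "moment f t T (count_list v L1) \<le> moment f t T (e - 1)"
        using 3 by (intro moment_mono f) auto
      also have "\<dots> \<le> lower_order A B d e f t T" using 3 by (simp add: lower_order_def)
      finally show ?thesis using C[OF f] C0 mult_left_mono order_trans by blast
    qed
    then show ?thesis using C0 by blast
  next
    case 4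
    let ?k = "count_list w L1"
    obtain C where C0: "C \<ge> 0" and C: "\<And>f t T r. continuous_on {t..T} f \<Longrightarrow> t \<le> r \<Longrightarrow> r \<le> T \<Longrightarrow> T - t \<le> L \<Longrightarrow>
      \<bar>path_sig f t r w\<bar> \<le> C * (height f t r ^ ?k + moment f t T ?k)"
      using path_sig_growth[OF L, of w] by blast
    have "\<bar>path_sig f t T w\<bar> \<le> C * lower_order A B d e f t T"
      if f: "continuous_on {t..T} f" "t \<le> T" "T - t \<le> L" for f t T
    proof -
      have "moment f t T ?k \<le> moment f t T (e - 1)" using 4 by (intro moment_mono f) auto
      moreover have "height f t T ^ ?k \<le> height f t T ^ (d - 1)"
        using 4 height_ge_1[of f t T] by (intro power_increasing) auto
      ultimately have "height f t T ^ ?k + moment f t T ?k \<le> lower_order A B d e f t T"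
        using 4 by (simp add: lower_order_def)
      then show ?thesis using C[OF f(1,2) order_refl f(3)] C0 mult_left_mono order_trans by blast
    qed
    then show ?thesis using C0 by blast
  qed
qed

section \<open>A pathwise bound for the exponent of class \<open>\<B>\<close>\<close>

lemma tensor_mult_letter:
  "(a \<otimes>\<^sub>t word_tensor [i]) (v @ [j]) = (if j = i then a v else (0 :: complex))"
  "(a \<otimes>\<^sub>t word_tensor [i]) [] = (0 :: complex)"
proof -
  have "(a \<otimes>\<^sub>t (\<lambda>w. word_tensor [i] (w @ [j]))) v =
      (\<Sum>k\<le>length v. if k = length v then (if j = i then a v else 0) else 0)"
    unfolding tensor_mult_take by (intro sum.cong) (auto simp: word_tensor_def)
  then show "(a \<otimes>\<^sub>t word_tensor [i]) (v @ [j]) = (if j = i then a v else 0)"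
    by (simp add: tensor_mult_snoc word_tensor_def)
qed (simp add: tensor_mult_Nil word_tensor_def)

lemma deg_letter_less:
  assumes "deg_letter i p < ereal (real d)" "p v \<noteq> 0"
  shows "count_list v i < d"
proof -
  have "ereal (real (count_list v i)) \<le> deg_letter i p"
    unfolding deg_letter_def by (rule SUP_upper) (use assms in auto)
  then have "ereal (real (count_list v i)) < ereal (real d)" using assms(1) by (rule le_less_trans)
  then show ?thesis by simp
qed

lemma deg_letter_le_0:
  assumes "deg_letter i p \<le> 0" "p v \<noteq> 0"
  shows "count_list v i = 0"
proof -
  have "ereal (real (count_list v i)) \<le> deg_letter i p"
    unfolding deg_letter_def by (rule SUP_upper) (use assms in auto)
  then have "ereal (real (count_list v i)) \<le> 0" using assms(1) by (rule order_trans)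
  then show ?thesis by (simp add: zero_ereal_def)
qed

text \<open>The degree conditions keep \<open>q\<close>, \<open>r\<close> and \<open>s\<close> from touching the coefficients of the two leading words.\<close>

lemma class_B_structure:
  assumes "p \<in> class_B"
  obtains \<alpha> \<beta> m n where "Re \<alpha> > 0 \<or> \<alpha> = 0" "Re \<beta> > 0 \<or> \<beta> = 0" "m \<ge> 1" "n \<ge> 1"
    "finite {v. p v \<noteq> 0}" "p (replicate (2 * n) L1) = - \<alpha>" "p (replicate (2 * m) L1 @ [L0]) = - \<beta>"
    "\<And>u. p u \<noteq> 0 \<Longrightarrow> u \<noteq> replicate (2 * n) L1 \<Longrightarrow> u \<noteq> replicate (2 * m) L1 @ [L0] \<Longrightarrow>
      controlled (\<alpha> \<noteq> 0) (\<beta> \<noteq> 0) (2 * n) (2 * m) u"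
proof -
  obtain \<alpha> \<beta> \<gamma> :: complex and m n :: nat and q r s where
    \<alpha>: "\<alpha> \<in> {z. Re z > 0} \<union> {0}" and \<beta>: "\<beta> \<in> {z. Re z > 0} \<union> {0}" and mn: "m \<ge> 1" "n \<ge> 1" and
    fin: "q \<in> finite_tensors" "r \<in> finite_tensors" "s \<in> finite_tensors" and
    q1: "deg_letter L1 q < ereal (real (2 * n))" and q0: "deg_letter L0 q \<le> 0" and
    r1: "deg_letter L1 r < ereal (real (2 * m))" and
    s1: "deg_letter L1 s < ereal (real (min (2 * m) (2 * n)))" and
    p: "p = (\<lambda>u. - \<alpha> * (word_tensor (replicate (2 * n) L1) u + q u)
              - \<beta> * ((\<lambda>v. word_tensor (replicate (2 * m) L1) v + r v) \<otimes>\<^sub>t word_tensor [L0]) u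
              + \<alpha> * \<beta> * s u + \<gamma> * word_tensor [] u)"
    using assms unfolding class_B_def mem_Collect_eq by (elim exE conjE) blast
  let ?u1 = "replicate (2 * n) L1" and ?u2 = "replicate (2 * m) L1 @ [L0]"
  have qc: "q u \<noteq> 0 \<Longrightarrow> count_list u L1 < 2 * n" "q u \<noteq> 0 \<Longrightarrow> count_list u L0 = 0" for u
    using deg_letter_less[OF q1] deg_letter_le_0[OF q0] by auto
  have rc: "r u \<noteq> 0 \<Longrightarrow> count_list u L1 < 2 * m" for u
    using deg_letter_less[OF r1] by auto
  have sc: "s u \<noteq> 0 \<Longrightarrow> count_list u L1 < 2 * m" "s u \<noteq> 0 \<Longrightarrow> count_list u L1 < 2 * n" for u
    using deg_letter_less[OF s1, of u] by auto
  have snoc: "p (v @ [i]) = - \<alpha> * (word_tensor ?u1 (v @ [i]) + q (v @ [i]))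
      - \<beta> * (if i = L0 then word_tensor (replicate (2 * m) L1) v + r v else 0) + \<alpha> * \<beta> * s (v @ [i])" for v i
    unfolding p tensor_mult_letter by (simp add: word_tensor_def)
  obtain n' where n': "?u1 = replicate n' L1 @ [L1]"
    using mn by (metis Suc_pred' mult_pos_pos zero_less_numeral less_eq_Suc_le One_nat_def replicate_Suc replicate_append_same)
  have L0u1: "count_list ?u1 L0 = 0" by (simp add: count_list_replicate)
  have "q ?u1 = 0" "s ?u1 = 0"
    using qc(1)[of ?u1] sc(2)[of ?u1] by (auto simp: count_list_replicate)
  then have P1: "p ?u1 = - \<alpha>"
    using snoc[of "replicate n' L1" L1] unfolding n'[symmetric] by (simp add: word_tensor_def)
  have "?u2 \<noteq> ?u1" using L0u1 by (metis count_list_append count_list.simps add_is_0 one_neq_zero)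
  moreover have "q ?u2 = 0" "s ?u2 = 0" "r (replicate (2 * m) L1) = 0"
    using qc(2)[of ?u2] sc(1)[of ?u2] rc[of "replicate (2 * m) L1"] by (auto simp: count_list_replicate)
  ultimately have P2: "p ?u2 = - \<beta>"
    unfolding snoc by (simp add: word_tensor_def)
  have ctl: "controlled (\<alpha> \<noteq> 0) (\<beta> \<noteq> 0) (2 * n) (2 * m) u"
    if u: "p u \<noteq> 0" "u \<noteq> ?u1" "u \<noteq> ?u2" for u
  proof (cases u rule: rev_cases)
    case (snoc v i)
    have v: "v \<noteq> replicate (2 * m) L1" if "i = L0" using u(3) snoc that by auto
    have "\<alpha> * q u \<noteq> 0 \<or> \<beta> \<noteq> 0 \<and> i = L0 \<and> r v \<noteq> 0 \<or> \<alpha> * \<beta> * s u \<noteq> 0"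
      using u(1,2) v unfolding snoc \<open>\<And>v i. p (v @ [i]) = _ v i\<close>
      by (auto simp: word_tensor_def split: if_splits)
    then show ?thesis
      using qc[of u] rc[of v] sc[of u] by (auto simp: controlled_def snoc)
  qed (simp add: controlled_def)
  have "finite {v. p v \<noteq> 0}"
  proof (rule finite_subset)
    show "{v. p v \<noteq> 0} \<subseteq> {[], ?u1, ?u2} \<union> {v. q v \<noteq> 0} \<union> (\<lambda>v. v @ [L0]) ` {v. r v \<noteq> 0} \<union> {v. s v \<noteq> 0}"
    proof
      fix u assume "u \<in> {v. p v \<noteq> 0}"
      then show "u \<in> {[], ?u1, ?u2} \<union> {v. q v \<noteq> 0} \<union> (\<lambda>v. v @ [L0]) ` {v. r v \<noteq> 0} \<union> {v. s v \<noteq> 0}"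
        by (cases u rule: rev_cases) (auto simp: snoc word_tensor_def split: if_splits)
    qed
  qed (use fin in \<open>auto simp: finite_tensors_def\<close>)
  then show ?thesis using that[of \<alpha> \<beta> m n] \<alpha> \<beta> mn P1 P2 ctl by auto
qed


text \<open>Either \<open>c x \<le> y\<close> and the power of \<open>x\<close> may be replaced by a power of \<open>y / c\<close>, or the left side is
negative.\<close>

lemma absorb_lower_power:
  fixes x y c :: real
  assumes "0 < c" "0 \<le> x" "0 \<le> y" "1 \<le> d"
  shows "y * x ^ (d - 1) - c * x ^ d \<le> y ^ d / c ^ (d - 1)"
proof -
  obtain k where d: "d = Suc k" using assms(4) by (cases d) auto
  show ?thesis
  proof (cases "c * x \<le> y")
    case True
    then have "x \<le> y / c" using assms by (simp add: pos_le_divide_eq mult.commute)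
    then have "y * x ^ k \<le> y * (y / c) ^ k" using assms by (intro mult_left_mono power_mono) auto
    moreover have "0 \<le> c * x ^ d" using assms by simp
    ultimately show ?thesis by (simp add: d power_divide)
  next
    case False
    then have "y * x ^ k \<le> (c * x) * x ^ k" using assms by (intro mult_right_mono) auto
    moreover have "0 \<le> y ^ d / c ^ (d - 1)" using assms by simp
    ultimately show ?thesis by (simp add: d mult.assoc)
  qed
qed

lemma leading_power_bound: "height f t r ^ d \<le> 2 ^ d * (1 + \<bar>f r - f t\<bar> ^ d)"
  using power_add_le[of 1 "\<bar>f r - f t\<bar>" d] by (simp add: height_def)

text \<open>For even \<open>d\<close> the leading coefficients are nonnegative and comparable to the power of the height,
because \<open>(1 + x) ^ d\<close> is at most \<open>2 ^ d (1 + x ^ d)\<close>.\<close>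

lemma leading_bounds:
  fixes f :: "real \<Rightarrow> real"
  assumes f: "continuous_on {t..T} f" and t: "t \<le> T" "T - t \<le> L" and d: "even d"
  shows "path_sig f t T (replicate d L1) \<ge> height f t T ^ d / (2 ^ d * fact d) - 1 / fact d"
    "path_sig f t T (replicate d L1 @ [L0]) \<ge> moment f t T d / (2 ^ d * fact d) - L / fact d"
proof -
  have h: "height f t r ^ d / (2 ^ d * fact d) - 1 / fact d \<le> (f r - f t) ^ d / fact d" for r
  proof -
    have "height f t r ^ d / 2 ^ d - 1 \<le> (f r - f t) ^ d"
      using leading_power_bound[of f t r d] d by (simp add: field_simps power_even_abs)
    then have "(height f t r ^ d / 2 ^ d - 1) / fact d \<le> (f r - f t) ^ d / fact d"
      by (rule divide_right_mono) simp
    then show ?thesis by (simp add: diff_divide_distrib)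
  qed
  show "path_sig f t T (replicate d L1) \<ge> height f t T ^ d / (2 ^ d * fact d) - 1 / fact d"
    unfolding path_sig_pure by (rule h)
  have i: "(\<lambda>r. height f t r ^ d) integrable_on {t..T}"
    by (rule height_integrable) (use f t in auto)
  have "moment f t T d / (2 ^ d * fact d) - L / fact d \<le> moment f t T d / (2 ^ d * fact d) - (T - t) / fact d"
    using t by (intro diff_left_mono divide_right_mono) auto
  also have "\<dots> = integral {t..T} (\<lambda>r. height f t r ^ d / (2 ^ d * fact d) - 1 / fact d)"
    unfolding moment_def
    by (subst integral_diff) (use i t in \<open>auto intro!: integrable_on_divide\<close>)
  also have "\<dots> \<le> integral {t..T} (\<lambda>r. (f r - f t) ^ d / fact d)"
    by (intro integral_le integrable_diff integrable_on_divide i integrable_const_ivl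
          integrable_continuous_interval continuous_intros f h) auto
  also have "\<dots> = path_sig f t T (replicate d L1 @ [L0])"
    using path_sig_L0[of f t T "replicate d L1" 0] by (simp add: path_sig_pure)
  finally show "path_sig f t T (replicate d L1 @ [L0]) \<ge> moment f t T d / (2 ^ d * fact d) - L / fact d" .
qed

text \<open>The nonempty words at which some shift of \<open>p\<close> can have a nonzero coefficient.\<close>

definition prefixes_of :: "complex tensor \<Rightarrow> word set" where
  "prefixes_of p = {v. v \<noteq> [] \<and> (\<exists>w. p (v @ w) \<noteq> 0)}"

lemma finite_prefixes_of:
  assumes "finite {v. p v \<noteq> 0}"
  shows "finite (prefixes_of p)" "finite {w. \<exists>v. p (v @ w) \<noteq> 0}"
proof -
  have 1: "prefixes_of p \<subseteq> (\<Union>u\<in>{v. p v \<noteq> 0}. (\<lambda>k. take k u) ` {..length u})"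
  proof
    fix v assume "v \<in> prefixes_of p"
    then obtain w where "p (v @ w) \<noteq> 0" by (auto simp: prefixes_of_def)
    then show "v \<in> (\<Union>u\<in>{v. p v \<noteq> 0}. (\<lambda>k. take k u) ` {..length u})"
      by (intro UN_I[of "v @ w"] image_eqI[of _ _ "length v"]) auto
  qed
  have 2: "{w. \<exists>v. p (v @ w) \<noteq> 0} \<subseteq> (\<Union>u\<in>{v. p v \<noteq> 0}. (\<lambda>k. drop k u) ` {..length u})"
  proof
    fix w assume "w \<in> {w. \<exists>v. p (v @ w) \<noteq> 0}"
    then obtain v where "p (v @ w) \<noteq> 0" by auto
    then show "w \<in> (\<Union>u\<in>{v. p v \<noteq> 0}. (\<lambda>k. drop k u) ` {..length u})"
      by (intro UN_I[of "v @ w"] image_eqI[of _ _ "length v"]) auto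
  qed
  show "finite (prefixes_of p)" by (rule finite_subset[OF 1]) (use assms in auto)
  show "finite {w. \<exists>v. p (v @ w) \<noteq> 0}" by (rule finite_subset[OF 2]) (use assms in auto)
qed

text \<open>The leading words give the negative terms. All other words of \<open>p\<close> are controlled, and so is what
remains of any word after its nonempty prefix has been cut off.\<close>

lemma class_B_estimates:
  assumes p: "p \<in> class_B" and L: "0 \<le> L"
  obtains A B d e c K where "0 < c" "0 \<le> K" "1 \<le> d" "1 \<le> e"
    "\<And>f t T. continuous_on {t..T} f \<Longrightarrow> t \<le> T \<Longrightarrow> T - t \<le> L \<Longrightarrow>
      Re (pairing p (path_sig f t T)) \<le> K * lower_order A B d e f t T
        - c * ((if A then height f t T ^ d else 0) + (if B then moment f t T e else 0))"
    "\<And>f t T. continuous_on {t..T} f \<Longrightarrow> t \<le> T \<Longrightarrow> T - t \<le> L \<Longrightarrow>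
      (\<Sum>v\<in>prefixes_of p. cmod (shift_tensor p (path_sig f t T) v))
        \<le> (if A \<or> B then K * lower_order A B d e f t T else 0)"
    "A \<Longrightarrow> \<exists>u. p u \<noteq> 0 \<and> count_list u L1 = d" "B \<Longrightarrow> \<exists>u. p u \<noteq> 0 \<and> count_list u L1 = e"
proof -
  obtain \<alpha> \<beta> m n where \<alpha>: "Re \<alpha> > 0 \<or> \<alpha> = 0" and \<beta>: "Re \<beta> > 0 \<or> \<beta> = 0" and mn: "m \<ge> 1" "n \<ge> 1"
    and fin: "finite {v. p v \<noteq> 0}"
    and p1: "p (replicate (2 * n) L1) = - \<alpha>" and p2: "p (replicate (2 * m) L1 @ [L0]) = - \<beta>"
    and ctl: "\<And>u. p u \<noteq> 0 \<Longrightarrow> u \<noteq> replicate (2 * n) L1 \<Longrightarrow> u \<noteq> replicate (2 * m) L1 @ [L0] \<Longrightarrow>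
      controlled (\<alpha> \<noteq> 0) (\<beta> \<noteq> 0) (2 * n) (2 * m) u"
    by (rule class_B_structure[OF p]) blast
  define A B d e where "A = (\<alpha> \<noteq> 0)" and "B = (\<beta> \<noteq> 0)" and "d = 2 * n" and "e = 2 * m"
  define u1 u2 where "u1 = replicate d L1" and "u2 = replicate e L1 @ [L0]"
  define S where "S = {v. p v \<noteq> 0}"
  define W where "W = {w. \<exists>v. p (v @ w) \<noteq> 0}"
  note ctl = ctl[folded A_def B_def d_def e_def, folded u1_def u2_def]
  note p1 = p1[folded d_def, folded u1_def] and p2 = p2[folded e_def, folded u2_def]
  have ctl': "controlled A B d e w" if "p (v @ w) \<noteq> 0" "v \<noteq> []" for v w
  proof (cases "v @ w = u1 \<or> v @ w = u2")
    case True
    then show ?thesis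
    proof
      assume "v @ w = u1"
      then show ?thesis using that p1 controlled_proper_suffix(1)[OF that(2), of A d w B e]
        by (simp add: A_def u1_def)
    next
      assume "v @ w = u2"
      then show ?thesis using that p2 controlled_proper_suffix(2)[OF that(2), of B e w A d]
        by (simp add: B_def u2_def)
    qed
  next
    case False
    then show ?thesis using ctl[OF that(1)] controlled_suffix by blast
  qed
  have "\<forall>w. \<exists>C\<ge>0. controlled A B d e w \<longrightarrow> (\<forall>f t T. continuous_on {t..T} f \<longrightarrow> t \<le> T \<longrightarrow> T - t \<le> L \<longrightarrow>
    \<bar>path_sig f t T w\<bar> \<le> C * lower_order A B d e f t T)"
  proof
    fix w show "\<exists>C\<ge>0. controlled A B d e w \<longrightarrow> (\<forall>f t T. continuous_on {t..T} f \<longrightarrow> t \<le> T \<longrightarrow> T - t \<le> L \<longrightarrow>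
      \<bar>path_sig f t T w\<bar> \<le> C * lower_order A B d e f t T)"
      using controlled_bound[OF L, of A B d e w] by (cases "controlled A B d e w") auto
  qed
  then obtain Cf where Cf0: "\<And>w. Cf w \<ge> 0" and Cf: "\<And>w f t T. controlled A B d e w \<Longrightarrow>
      continuous_on {t..T} f \<Longrightarrow> t \<le> T \<Longrightarrow> T - t \<le> L \<Longrightarrow> \<bar>path_sig f t T w\<bar> \<le> Cf w * lower_order A B d e f t T"
    by metis
  define K1 where "K1 = Re \<alpha> / fact d + Re \<beta> * (L / fact e) + (\<Sum>v\<in>S - {u1, u2}. cmod (p v) * Cf v)"
  define K2 where "K2 = (\<Sum>v\<in>prefixes_of p. \<Sum>w\<in>W. cmod (p (v @ w)) * Cf w)"
  \<comment> \<open>where a leading term is absent, the value 1 keeps the minimum of the two constants positive\<close>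
  define c1 c2 where "c1 = (if A then Re \<alpha> / (2 ^ d * fact d) else 1)"
    and "c2 = (if B then Re \<beta> / (2 ^ e * fact e) else 1)"
  have \<alpha>0: "0 \<le> Re \<alpha>" and \<beta>0: "0 \<le> Re \<beta>" using \<alpha> \<beta> by auto
  have c12: "0 < c1" "0 < c2" using \<alpha> \<beta> by (auto simp: c1_def c2_def A_def B_def)
  have K10: "0 \<le> K1" unfolding K1_def using \<alpha>0 \<beta>0 L Cf0
    by (intro add_nonneg_nonneg sum_nonneg mult_nonneg_nonneg divide_nonneg_nonneg) auto
  have K20: "0 \<le> K2" unfolding K2_def using Cf0 by (intro sum_nonneg mult_nonneg_nonneg) auto
  show ?thesis
  proof (rule that[of "min c1 c2" "K1 + K2" d e A B])
    fix f :: "real \<Rightarrow> real" and t T assume f: "continuous_on {t..T} f" "t \<le> T" "T - t \<le> L"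
    let ?Y = "path_sig f t T" and ?L = "lower_order A B d e f t T"
    have L1: "1 \<le> ?L" by (rule lower_order_ge_1[OF f(1,2)])
    have h0: "0 \<le> height f t T ^ d" and m0: "0 \<le> moment f t T e" using moment_ge_0[OF f(1,2)] by auto
    have ne: "u1 \<noteq> u2"
    proof
      assume "u1 = u2"
      then have "count_list u1 L0 = count_list u2 L0" by simp
      then show False by (simp add: u1_def u2_def count_list_replicate)
    qed
    have "pairing p ?Y = (\<Sum>v\<in>insert u1 (insert u2 (S - {u1, u2})). p v * complex_of_real (?Y v))"
      by (rule pairing_finite) (use fin in \<open>auto simp: S_def\<close>)
    also have "\<dots> = - \<alpha> * ?Y u1 + (- \<beta> * ?Y u2 + (\<Sum>v\<in>S - {u1, u2}. p v * complex_of_real (?Y v)))"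
      using fin ne by (simp add: S_def p1 p2)
    finally have eq: "Re (pairing p ?Y) = - (Re \<alpha> * ?Y u1) - Re \<beta> * ?Y u2 + Re (\<Sum>v\<in>S - {u1, u2}. p v * complex_of_real (?Y v))"
      by simp
    have r1: "Re (\<Sum>v\<in>S - {u1, u2}. p v * complex_of_real (?Y v)) \<le> (\<Sum>v\<in>S - {u1, u2}. cmod (p v) * Cf v * ?L)"
    proof (rule order_trans[OF complex_Re_le_cmod], rule sum_norm_le)
      fix v assume "v \<in> S - {u1, u2}"
      then have "\<bar>?Y v\<bar> \<le> Cf v * ?L" using Cf[OF ctl f] by (auto simp: S_def)
      then show "cmod (p v * complex_of_real (?Y v)) \<le> cmod (p v) * Cf v * ?L"
        by (simp add: norm_mult mult.assoc mult_left_mono)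
    qed
    have r2: "- (Re \<alpha> * ?Y u1) \<le> - (min c1 c2) * (if A then height f t T ^ d else 0) + Re \<alpha> / fact d * ?L"
    proof (cases A)
      case True
      have "Re \<alpha> * (height f t T ^ d / (2 ^ d * fact d) - 1 / fact d) \<le> Re \<alpha> * ?Y u1"
        unfolding u1_def by (intro mult_left_mono leading_bounds(1)[OF f]) (use \<alpha>0 in \<open>auto simp: d_def\<close>)
      then have "c1 * height f t T ^ d - Re \<alpha> / fact d \<le> Re \<alpha> * ?Y u1"
        using True by (simp add: c1_def right_diff_distrib)
      moreover have "min c1 c2 * height f t T ^ d \<le> c1 * height f t T ^ d"
        using h0 by (intro mult_right_mono) auto
      moreover have "Re \<alpha> / fact d * 1 \<le> Re \<alpha> / fact d * ?L"
        using L1 \<alpha>0 by (intro mult_left_mono) auto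
      ultimately show ?thesis using True by simp
    next
      case False
      then show ?thesis using L1 by (simp add: A_def)
    qed
    have r3: "Re \<beta> * ?Y u2 \<ge> min c1 c2 * (if B then moment f t T e else 0) - Re \<beta> * (L / fact e) * ?L"
    proof (cases B)
      case True
      have "Re \<beta> * (moment f t T e / (2 ^ e * fact e) - L / fact e) \<le> Re \<beta> * ?Y u2"
        unfolding u2_def by (intro mult_left_mono leading_bounds(2)[OF f]) (use \<beta>0 in \<open>auto simp: e_def\<close>)
      then have "c2 * moment f t T e - Re \<beta> * (L / fact e) \<le> Re \<beta> * ?Y u2"
        using True by (simp add: c2_def right_diff_distrib)
      moreover have "min c1 c2 * moment f t T e \<le> c2 * moment f t T e"
        using m0 by (intro mult_right_mono) auto
      moreover have "Re \<beta> * (L / fact e) * 1 \<le> Re \<beta> * (L / fact e) * ?L"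
        using L1 \<beta>0 L by (intro mult_left_mono) auto
      ultimately show ?thesis using True by simp
    next
      case False
      then show ?thesis using L1 by (simp add: B_def)
    qed
    have "Re (pairing p ?Y) \<le>
        (- (min c1 c2) * (if A then height f t T ^ d else 0) + Re \<alpha> / fact d * ?L)
        - (min c1 c2 * (if B then moment f t T e else 0) - Re \<beta> * (L / fact e) * ?L)
        + (\<Sum>v\<in>S - {u1, u2}. cmod (p v) * Cf v * ?L)"
      unfolding eq by (intro add_mono diff_mono r1 r2 r3)
    also have "\<dots> = K1 * ?L - min c1 c2 * ((if A then height f t T ^ d else 0) + (if B then moment f t T e else 0))"
      unfolding K1_def distrib_left distrib_right sum_distrib_right by simp
    also have "K1 * ?L \<le> (K1 + K2) * ?L" using K20 L1 by (intro mult_right_mono) auto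
    finally show "Re (pairing p ?Y) \<le> (K1 + K2) * ?L - min c1 c2 *
        ((if A then height f t T ^ d else 0) + (if B then moment f t T e else 0))" by simp
  next
    fix f :: "real \<Rightarrow> real" and t T assume f: "continuous_on {t..T} f" "t \<le> T" "T - t \<le> L"
    let ?Y = "path_sig f t T" and ?L = "lower_order A B d e f t T"
    have L1: "1 \<le> ?L" by (rule lower_order_ge_1[OF f(1,2)])
    have finW: "finite W" unfolding W_def by (rule finite_prefixes_of(2)[OF fin])
    have "(\<Sum>v\<in>prefixes_of p. cmod (shift_tensor p ?Y v)) \<le> K2 * ?L"
      unfolding K2_def sum_distrib_right
    proof (rule sum_mono)
      fix v assume "v \<in> prefixes_of p"
      then have v: "v \<noteq> []" by (simp add: prefixes_of_def)
      have "shift_tensor p ?Y v = (\<Sum>w\<in>W. complex_of_real (?Y w) * p (v @ w))"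
        by (rule shift_tensor_finite[OF finW]) (auto simp: W_def)
      also have "cmod \<dots> \<le> (\<Sum>w\<in>W. cmod (p (v @ w)) * Cf w * ?L)"
      proof (rule sum_norm_le)
        fix w
        show "cmod (complex_of_real (?Y w) * p (v @ w)) \<le> cmod (p (v @ w)) * Cf w * ?L"
        proof (cases "p (v @ w) = 0")
          case False
          have "\<bar>?Y w\<bar> \<le> Cf w * ?L" by (rule Cf[OF ctl'[OF False v] f])
          from mult_left_mono[OF this, of "cmod (p (v @ w))"]
          show ?thesis by (simp add: norm_mult mult_ac)
        qed simp
      qed
      finally show "cmod (shift_tensor p ?Y v) \<le> (\<Sum>w\<in>W. cmod (p (v @ w)) * Cf w * ?L)" .
    qed
    also have "\<dots> \<le> (K1 + K2) * ?L" using K10 L1 by (intro mult_right_mono) auto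
    finally have 1: "(\<Sum>v\<in>prefixes_of p. cmod (shift_tensor p ?Y v)) \<le> (K1 + K2) * ?L" .
    have "prefixes_of p = {}" if "\<not> A" "\<not> B"
    proof -
      have False if "p (v @ w) \<noteq> 0" "v \<noteq> []" for v w
      proof -
        have "v @ w \<noteq> u1" "v @ w \<noteq> u2" using that p1 p2 \<open>\<not> A\<close> \<open>\<not> B\<close> by (auto simp: A_def B_def)
        from ctl[OF that(1) this] show False using that(2) \<open>\<not> A\<close> \<open>\<not> B\<close> by (simp add: controlled_def)
      qed
      then show ?thesis by (auto simp: prefixes_of_def)
    qed
    then show "(\<Sum>v\<in>prefixes_of p. cmod (shift_tensor p ?Y v)) \<le> (if A \<or> B then (K1 + K2) * ?L else 0)"
      using 1 by auto
  next
    show "\<exists>u. p u \<noteq> 0 \<and> count_list u L1 = d" if A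
      using that p1 by (intro exI[of _ u1]) (simp add: A_def u1_def count_list_replicate)
    show "\<exists>u. p u \<noteq> 0 \<and> count_list u L1 = e" if B
      using that p2 by (intro exI[of _ u2]) (simp add: B_def u2_def count_list_replicate)
  qed (use c12 K10 K20 mn in \<open>auto simp: d_def e_def\<close>)
qed

lemma real_deg_letter:
  assumes fin: "finite {v. p v \<noteq> 0}"
  shows "0 \<le> real_of_ereal (deg_letter i p)"
    "p u \<noteq> 0 \<Longrightarrow> real (count_list u i) \<le> real_of_ereal (deg_letter i p)"
proof -
  have 1: "real (count_list u i) \<le> real_of_ereal (deg_letter i p)" if "p u \<noteq> 0" for u
  proof -
    define N where "N = Max ((\<lambda>v. count_list v i) ` {v. p v \<noteq> 0})"
    have "deg_letter i p \<le> ereal (real N)"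
      unfolding deg_letter_def by (rule SUP_least) (use fin in \<open>auto simp: N_def\<close>)
    moreover have "ereal (real (count_list u i)) \<le> deg_letter i p"
      unfolding deg_letter_def by (rule SUP_upper) (use that in auto)
    ultimately show ?thesis by (cases "deg_letter i p") auto
  qed
  then show "p u \<noteq> 0 \<Longrightarrow> real (count_list u i) \<le> real_of_ereal (deg_letter i p)" .
  show "0 \<le> real_of_ereal (deg_letter i p)"
  proof (cases "\<exists>u. p u \<noteq> 0")
    case True
    then show ?thesis using 1 of_nat_0_le_iff order_trans by blast
  next
    case False
    then show ?thesis by (simp add: deg_letter_def bot_ereal_def)
  qed
qed

lemma class_B_finite: "p \<in> class_B \<Longrightarrow> finite {v. p v \<noteq> 0}"
  by (rule class_B_structure)

text \<open>The lower order terms, even when multiplied by \<open>1 + M\<close>, are absorbed by the leading terms. The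
remainder grows like the power of \<open>1 + M\<close> whose exponent is the degree of a leading word. The bound
holds for each path separately, with a constant that does not depend on the path.\<close>

lemma class_B_exponent_bound:
  assumes p: "p \<in> class_B" and L: "0 \<le> L"
  obtains C where "C > 0" "\<And>f t T M. continuous_on {t..T} f \<Longrightarrow> t \<le> T \<Longrightarrow> T - t \<le> L \<Longrightarrow> 0 \<le> M \<Longrightarrow>
    Re (pairing p (path_sig f t T)) + M * (\<Sum>v\<in>prefixes_of p. cmod (shift_tensor p (path_sig f t T) v))
      \<le> C * (1 + M) powr real_of_ereal (deg_letter L1 p)"
proof -
  obtain A B d e c K where c: "0 < c" and K: "0 \<le> K" and de: "1 \<le> d" "1 \<le> e"
    and E1: "\<And>f t T. continuous_on {t..T} f \<Longrightarrow> t \<le> T \<Longrightarrow> T - t \<le> L \<Longrightarrow>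
      Re (pairing p (path_sig f t T)) \<le> K * lower_order A B d e f t T
        - c * ((if A then height f t T ^ d else 0) + (if B then moment f t T e else 0))"
    and E2: "\<And>f t T. continuous_on {t..T} f \<Longrightarrow> t \<le> T \<Longrightarrow> T - t \<le> L \<Longrightarrow>
      (\<Sum>v\<in>prefixes_of p. cmod (shift_tensor p (path_sig f t T) v))
        \<le> (if A \<or> B then K * lower_order A B d e f t T else 0)"
    and AB: "A \<Longrightarrow> \<exists>u. p u \<noteq> 0 \<and> count_list u L1 = d" "B \<Longrightarrow> \<exists>u. p u \<noteq> 0 \<and> count_list u L1 = e"
    by (rule class_B_estimates[OF p L]) (rule that; assumption)
  note D = real_deg_letter[OF class_B_finite[OF p], where i = L1]
  define D' where "D' = real_of_ereal (deg_letter L1 p)"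
  have AD: "A \<Longrightarrow> real d \<le> D'" and BD: "B \<Longrightarrow> real e \<le> D'"
    unfolding D'_def using AB D(2) by blast+
  have D0: "0 \<le> D'" unfolding D'_def by (rule D(1))
  define a where "a = K ^ d / c ^ (d - 1)"
  define b where "b = L * (K ^ e / c ^ (e - 1))"
  have ab: "0 \<le> a" "0 \<le> b" using K c L by (auto simp: a_def b_def)
  show ?thesis
  proof (rule that[of "1 + K + a + b"])
    fix f :: "real \<Rightarrow> real" and t T M assume f: "continuous_on {t..T} f" "t \<le> T" "T - t \<le> L" and M: "0 \<le> (M :: real)"
    let ?P = "(1 + M) powr D'" and ?L = "lower_order A B d e f t T"
    let ?G = "(if A then height f t T ^ d else 0) + (if B then moment f t T e else 0)"
    have P1: "1 \<le> ?P" using M D0 by (simp add: ge_one_powr_ge_zero)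
    have pw: "(1 + M) ^ k \<le> ?P" if "real k \<le> D'" for k
    proof -
      have "(1 + M) ^ k = (1 + M) powr real k" using M by (simp add: powr_realpow)
      also have "\<dots> \<le> ?P" using M that by (intro powr_mono) auto
      finally show ?thesis .
    qed
    have h1: "1 \<le> height f t r" for r by (rule height_ge_1)
    have "Re (pairing p (path_sig f t T)) + M * (\<Sum>v\<in>prefixes_of p. cmod (shift_tensor p (path_sig f t T) v))
        \<le> (K * ?L - c * ?G) + M * (if A \<or> B then K * ?L else 0)"
      using E1[OF f] E2[OF f] M by (intro add_mono mult_left_mono) auto
    also have "\<dots> \<le> (1 + K + a + b) * ?P"
    proof (cases "A \<or> B")
      case False
      then have "K * ?L - c * ?G + M * (if A \<or> B then K * ?L else 0) = K * 1"
        by (simp add: lower_order_def)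
      also have "\<dots> \<le> (1 + K + a + b) * ?P" using K ab P1 by (intro mult_mono) auto
      finally show ?thesis .
    next
      case True
      define y where "y = K * (1 + M)"
      have y0: "0 \<le> y" using K M by (simp add: y_def)
      have y1: "y \<le> K * ?P"
      proof -
      \<comment> \<open>the leading degree is at least 1, so a single factor \<open>1 + M\<close> is admissible\<close>
      have "real 1 \<le> D'" using True AD BD de by fastforce
        from pw[OF this] show ?thesis unfolding y_def using K by (simp add: mult_left_mono)
      qed
      have yA: "(if A then y * height f t T ^ (d - 1) - c * height f t T ^ d else 0) \<le> a * ?P"
      proof (cases A)
        case True
        have "y * height f t T ^ (d - 1) - c * height f t T ^ d \<le> y ^ d / c ^ (d - 1)"
          by (rule absorb_lower_power) (use c h1[of T] y0 de in auto)
        also have "\<dots> = a * (1 + M) ^ d" by (simp add: y_def a_def power_mult_distrib)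
        also have "\<dots> \<le> a * ?P" using ab pw[OF AD[OF True]] by (intro mult_left_mono) auto
        finally show ?thesis using True by simp
      qed (use ab P1 in auto)
      have yB: "(if B then y * moment f t T (e - 1) - c * moment f t T e else 0) \<le> b * ?P"
      proof (cases B)
        case True
        have i: "(\<lambda>r. height f t r ^ k) integrable_on {t..T}" for k
          by (rule height_integrable) (use f in auto)
        have "y * moment f t T (e - 1) - c * moment f t T e =
            integral {t..T} (\<lambda>r. y * height f t r ^ (e - 1) - c * height f t r ^ e)"
          unfolding moment_def by (subst integral_diff) (auto intro!: integrable_on_mult_right i)
        also have "\<dots> \<le> integral {t..T} (\<lambda>r. y ^ e / c ^ (e - 1))"
        proof (rule integral_le)
          fix r
          show "y * height f t r ^ (e - 1) - c * height f t r ^ e \<le> y ^ e / c ^ (e - 1)"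
            by (rule absorb_lower_power) (use c h1[of r] y0 de in auto)
        qed (auto intro!: integrable_diff integrable_on_mult_right i)
        also have "\<dots> \<le> L * (y ^ e / c ^ (e - 1))"
          using f c y0 by (auto intro!: divide_right_mono mult_right_mono)
        also have "\<dots> = b * (1 + M) ^ e" by (simp add: y_def b_def power_mult_distrib)
        also have "\<dots> \<le> b * ?P" using ab pw[OF BD[OF True]] by (intro mult_left_mono) auto
        finally show ?thesis using True by simp
      qed (use ab P1 in auto)
      have "K * ?L - c * ?G + M * (if A \<or> B then K * ?L else 0) = y
          + (if A then y * height f t T ^ (d - 1) - c * height f t T ^ d else 0)
          + (if B then y * moment f t T (e - 1) - c * moment f t T e else 0)"
        using True by (simp add: y_def lower_order_def algebra_simps)
      also have "\<dots> \<le> K * ?P + a * ?P + b * ?P" by (intro add_mono y1 yA yB)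
      also have "\<dots> \<le> (1 + K + a + b) * ?P" using P1 by (simp add: distrib_right)
      finally show ?thesis .
    qed
    finally show "Re (pairing p (path_sig f t T)) + M * (\<Sum>v\<in>prefixes_of p. cmod (shift_tensor p (path_sig f t T) v))
      \<le> (1 + K + a + b) * (1 + M) powr real_of_ereal (deg_letter L1 p)"
      unfolding D'_def .
  qed (use K ab in auto)
qed

section \<open>The Stratonovich signature of Brownian motion\<close>

text \<open>Along \<open>N\<close> equal pieces the expected cubic variation of Brownian motion is of order \<open>1 / sqrt N\<close>; the
fourth power makes it summable in \<open>n\<close>.\<close>

definition fine_count :: "nat \<Rightarrow> nat" where
  "fine_count n = (n + 1) ^ 4"

definition fine_partition :: "real \<Rightarrow> real \<Rightarrow> nat \<Rightarrow> nat \<Rightarrow> real" where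
  "fine_partition s t n k = s + (t - s) * real k / real (fine_count n)"

lemma fine_count_pos: "0 < fine_count n"
  by (simp add: fine_count_def)

lemma fine_partition_step:
  "fine_partition s t n (Suc k) - fine_partition s t n k = (t - s) / real (fine_count n)"
  by (simp add: fine_partition_def diff_divide_distrib[symmetric] right_diff_distrib[symmetric])

lemma fine_partition_of:
  assumes "s \<le> t"
  shows "partition_of s t (fine_partition s t n) (fine_count n)"
proof -
  have "fine_partition s t n k \<le> fine_partition s t n (Suc k)" for k
    using fine_partition_step[of s t n k] assms by (smt (verit) divide_nonneg_nonneg of_nat_0_le_iff)
  then show ?thesis
    using fine_count_pos[of n] by (simp add: partition_of_def fine_partition_def)
qed

lemma fine_partition_mesh:
  assumes "s \<le> t"
  shows "(\<lambda>n. mesh (fine_partition s t n) (fine_count n)) \<longlonglongrightarrow> 0"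
proof -
  have m: "mesh (fine_partition s t n) (fine_count n) = (t - s) / real (fine_count n)" for n
  proof -
    have "{..<fine_count n} \<noteq> {}" using fine_count_pos[of n] by auto
    then show ?thesis
      using assms by (simp add: mesh_def fine_partition_step image_constant_conv)
  qed
  have "(\<lambda>n. (t - s) / real (fine_count n)) \<longlonglongrightarrow> 0"
  proof (rule tendsto_divide_0[OF tendsto_const])
    have "filterlim (\<lambda>n. real (n + 1) ^ 4) at_top sequentially"
      by real_asymp
    then show "filterlim (\<lambda>n. real (fine_count n)) at_infinity sequentially"
      by (simp add: fine_count_def filterlim_at_top_imp_at_infinity add.commute)
  qed
  then show ?thesis by (simp add: m)
qed

lemma (in brownian_motion) third_moment:
  assumes "0 \<le> a" "a \<le> b"
  shows "(\<integral>\<^sup>+\<omega>. ennreal (\<bar>W b \<omega> - W a \<omega>\<bar> ^ 3) \<partial>M) \<le> ennreal (2 * sqrt (b - a) ^ 3)"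
proof (cases "a = b")
  case False
  then have ab: "a < b" using assms by auto
  let ?\<sigma> = "sqrt (b - a)"
  have "(\<integral>\<^sup>+\<omega>. ennreal (\<bar>W b \<omega> - W a \<omega>\<bar> ^ 3) \<partial>M) =
      (\<integral>\<^sup>+x. ennreal (normal_density 0 ?\<sigma> x) * ennreal (\<bar>x\<bar> ^ 3) \<partial>lborel)"
    by (rule distributed_nn_integral[OF gaussian_increments[OF assms(1) ab], symmetric]) simp
  also have "\<dots> = (\<integral>\<^sup>+x. ennreal (normal_density 0 ?\<sigma> x * \<bar>x\<bar> ^ 3) \<partial>lborel)"
    by (intro nn_integral_cong) (simp add: ennreal_mult)
  also have "\<dots> = ennreal (2 * ?\<sigma> ^ 3 * sqrt (2 / pi))"
  proof -
    have *: "has_bochner_integral lborel (\<lambda>x. normal_density 0 ?\<sigma> x * \<bar>x\<bar> ^ 3) (2 * ?\<sigma> ^ 3 * sqrt (2 / pi))"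
    proof -
      have "2 * 1 + 1 = (3 :: nat)" by simp
      then show ?thesis
        using normal_moment_abs_odd[where \<mu> = 0 and \<sigma> = ?\<sigma> and k = 1] ab
        by (simp only: power_one_right fact_1 mult_1_right diff_zero real_sqrt_gt_0_iff diff_gt_0_iff_gt)
    qed
    then have "(\<integral>\<^sup>+x. ennreal (normal_density 0 ?\<sigma> x * \<bar>x\<bar> ^ 3) \<partial>lborel)
        = ennreal (\<integral>x. normal_density 0 ?\<sigma> x * \<bar>x\<bar> ^ 3 \<partial>lborel)"
      by (intro nn_integral_eq_integral) (auto simp: has_bochner_integral_iff)
    then show ?thesis using * by (simp add: has_bochner_integral_iff)
  qed
  also have "\<dots> \<le> ennreal (2 * ?\<sigma> ^ 3)"
  proof (rule ennreal_leI)
    have "2 / pi \<le> 1" using pi_ge_two by simp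
    then have "sqrt (2 / pi) \<le> 1" by simp
    then have "2 * ?\<sigma> ^ 3 * sqrt (2 / pi) \<le> 2 * ?\<sigma> ^ 3 * 1" using ab by (intro mult_left_mono) auto
    then show "2 * ?\<sigma> ^ 3 * sqrt (2 / pi) \<le> 2 * ?\<sigma> ^ 3" by simp
  qed
  finally show ?thesis .
qed simp

text \<open>The expected cubic variations are summable, so the cubic variations are almost surely summable.\<close>

lemma (in brownian_motion) AE_null_cubic_variation:
  assumes s: "0 \<le> s" and st: "s \<le> t"
  shows "AE \<omega> in M. null_cubic_variation (\<lambda>r. W r \<omega>) s t (fine_partition s t) fine_count"
proof -
  let ?\<pi> = "fine_partition s t" and ?N = fine_count
  have part: "partition_of s t (?\<pi> n) (?N n)" for n by (rule fine_partition_of[OF st])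
  have \<pi>0: "0 \<le> ?\<pi> n k" for n k
    using s st by (simp add: fine_partition_def)
  have \<pi>m: "?\<pi> n k \<le> ?\<pi> n (Suc k)" for n k
    using fine_partition_step[of s t n k] st by (smt (verit) divide_nonneg_nonneg of_nat_0_le_iff)
  define V where "V n \<omega> = (\<Sum>k<?N n. \<bar>W (?\<pi> n (Suc k)) \<omega> - W (?\<pi> n k) \<omega>\<bar> ^ 3)" for n \<omega>
  have V0: "0 \<le> V n \<omega>" for n \<omega> unfolding V_def by (intro sum_nonneg) auto
  have [measurable]: "W (?\<pi> n k) \<in> borel_measurable M" for n k by (rule measurable_W[OF \<pi>0])
  have [measurable]: "V n \<in> borel_measurable M" for n unfolding V_def by measurable
  have "(\<integral>\<^sup>+\<omega>. ennreal (V n \<omega>) \<partial>M) \<le> ennreal (2 * sqrt (t - s) ^ 3 * (1 / real (n + 1) ^ 2))" for n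
  proof -
    have "(\<integral>\<^sup>+\<omega>. ennreal (V n \<omega>) \<partial>M) =
        (\<integral>\<^sup>+\<omega>. (\<Sum>k<?N n. ennreal (\<bar>W (?\<pi> n (Suc k)) \<omega> - W (?\<pi> n k) \<omega>\<bar> ^ 3)) \<partial>M)"
      by (rule nn_integral_cong) (simp add: V_def sum_ennreal)
    also have "\<dots> =
        (\<Sum>k<?N n. \<integral>\<^sup>+\<omega>. ennreal (\<bar>W (?\<pi> n (Suc k)) \<omega> - W (?\<pi> n k) \<omega>\<bar> ^ 3) \<partial>M)"
      by (rule nn_integral_sum) measurable
    also have "\<dots> \<le> (\<Sum>k<?N n. ennreal (2 * sqrt ((t - s) / real (?N n)) ^ 3))"
      using third_moment[OF \<pi>0 \<pi>m] by (intro sum_mono) (simp add: fine_partition_step)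
    also have "\<dots> = ennreal (real (?N n) * (2 * sqrt ((t - s) / real (?N n)) ^ 3))"
      using st by (simp add: ennreal_mult ennreal_of_nat_eq_real_of_nat)
    also have "real (?N n) * (2 * sqrt ((t - s) / real (?N n)) ^ 3) = 2 * sqrt (t - s) ^ 3 * (1 / real (n + 1) ^ 2)"
    proof -
      have "sqrt (real (?N n)) = real (n + 1) ^ 2"
        by (rule real_sqrt_unique) (auto simp: fine_count_def power_mult[symmetric])
      then have "sqrt ((t - s) / real (?N n)) = sqrt (t - s) / real (n + 1) ^ 2"
        by (simp add: real_sqrt_divide)
      moreover have "real (?N n) = real (n + 1) ^ 4" by (simp add: fine_count_def)
      moreover have "x ^ 4 * (2 * (a / x\<^sup>2) ^ 3) = 2 * a ^ 3 * (1 / x\<^sup>2)" if "x > 0" for x a :: real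
      proof -
        have "(x\<^sup>2) ^ 3 = x ^ 4 * x\<^sup>2" by (simp flip: power_mult power_add)
        then have "x ^ 4 * (2 * (a / x\<^sup>2) ^ 3) = x ^ 4 * (2 * (a ^ 3 / (x ^ 4 * x\<^sup>2)))"
          by (simp only: power_divide)
        also have "\<dots> = 2 * a ^ 3 * (1 / x\<^sup>2)"
        proof -
          have "y * (2 * (b / (y * z))) = 2 * b * (1 / z)" if "y \<noteq> 0" for y z b :: real
            using that by simp
          moreover have "x ^ 4 \<noteq> 0" using that by simp
          ultimately show ?thesis by blast
        qed
        finally show ?thesis .
      qed
      ultimately show ?thesis by simp
    qed
    finally show ?thesis .
  qed
  then have "(\<Sum>n. \<integral>\<^sup>+\<omega>. ennreal (V n \<omega>) \<partial>M) \<le> (\<Sum>n. ennreal (2 * sqrt (t - s) ^ 3 * (1 / real (n + 1) ^ 2)))"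
    by (intro suminf_le) auto
  also have "\<dots> < \<infinity>"
  proof -
    have "summable (\<lambda>n. 1 / real (n + 1) ^ 2)"
      using inverse_power_summable[of 2, where 'a = real] summable_Suc_iff[of "\<lambda>n. inverse (real n ^ 2)"]
      by (simp add: inverse_eq_divide)
    then have "summable (\<lambda>n. 2 * sqrt (t - s) ^ 3 * (1 / real (n + 1) ^ 2))" by (rule summable_mult)
    then show ?thesis
      using st by (subst suminf_ennreal2) auto
  qed
  finally have "(\<integral>\<^sup>+\<omega>. (\<Sum>n. ennreal (V n \<omega>)) \<partial>M) \<noteq> \<infinity>"
    by (subst nn_integral_suminf) auto
  then have "AE \<omega> in M. (\<Sum>n. ennreal (V n \<omega>)) \<noteq> \<infinity>"
    by (intro nn_integral_PInf_AE) auto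
  then show ?thesis
  proof eventually_elim
    case (elim \<omega>)
    then have "summable (\<lambda>n. V n \<omega>)" using V0 by (intro summable_suminf_not_top) auto
    then have "(\<lambda>n. V n \<omega>) \<longlonglongrightarrow> 0" by (rule summable_LIMSEQ_zero)
    then show ?case
      using part fine_partition_mesh[OF st] by (simp add: null_cubic_variation_def V_def)
  qed
qed

text \<open>A subsequence of a sequence converging in probability converges almost surely, by the Borel-Cantelli
lemma.\<close>

lemma (in prob_space) limit_in_probability_unique:
  fixes Z :: "nat \<Rightarrow> 'a \<Rightarrow> real"
  assumes I: "tendsto_in_probability M Z I"
    and Z[measurable]: "\<And>n. Z n \<in> borel_measurable M" and [measurable]: "I \<in> borel_measurable M"
    and L: "AE \<omega> in M. (\<lambda>n. Z n \<omega>) \<longlonglongrightarrow> L \<omega>"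
  shows "AE \<omega> in M. I \<omega> = L \<omega>"
proof -
  define A where "A e n = {\<omega> \<in> space M. \<bar>Z n \<omega> - I \<omega>\<bar> > e}" for e :: real and n
  have [measurable]: "A e n \<in> sets M" for e n unfolding A_def by measurable
  have lim: "(\<lambda>n. measure M (A e n)) \<longlonglongrightarrow> 0" if "e > 0" for e
    using I that by (simp add: tendsto_in_probability_def A_def)
  have "\<exists>n\<ge>k. measure M (A ((1/2) ^ k) n) < (1/2) ^ k" for k
  proof -
    have "eventually (\<lambda>n. measure M (A ((1/2) ^ k) n) < (1/2) ^ k) sequentially"
      by (rule order_tendstoD(2)[OF lim]) auto
    then obtain n0 where "\<forall>n\<ge>n0. measure M (A ((1/2) ^ k) n) < (1/2) ^ k"
      by (auto simp: eventually_sequentially)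
    then show ?thesis by (intro exI[of _ "max n0 k"]) auto
  qed
  then obtain r where r: "\<And>k. r k \<ge> k" "\<And>k. measure M (A ((1/2) ^ k) (r k)) < (1/2) ^ k" by metis
  have "AE \<omega> in M. eventually (\<lambda>k. \<omega> \<in> space M - A ((1/2) ^ k) (r k)) sequentially"
  proof (rule borel_cantelli_AE1)
    show "summable (\<lambda>k. measure M (A ((1/2) ^ k) (r k)))"
    proof (rule summable_comparison_test'[where N = 0])
      show "summable (\<lambda>k. (1/2 :: real) ^ k)" by (rule summable_geometric) auto
    qed (use r(2) in \<open>auto intro: less_imp_le\<close>)
  qed (auto simp: less_top[symmetric])
  with L show ?thesis
  proof eventually_elim
    case (elim \<omega>)
    have rt: "filterlim r at_top sequentially"
      by (rule filterlim_at_top_mono[OF filterlim_ident]) (auto intro: always_eventually r(1))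
    have 1: "(\<lambda>k. Z (r k) \<omega>) \<longlonglongrightarrow> L \<omega>" by (rule filterlim_compose[OF elim(1) rt])
    have "(\<lambda>k. Z (r k) \<omega> - I \<omega>) \<longlonglongrightarrow> 0"
    proof (rule Lim_null_comparison)
      show "eventually (\<lambda>k. norm (Z (r k) \<omega> - I \<omega>) \<le> (1/2) ^ k) sequentially"
        using elim(2) by eventually_elim (auto simp: A_def)
      show "(\<lambda>k. (1/2 :: real) ^ k) \<longlonglongrightarrow> 0" by (rule LIMSEQ_power_zero) auto
    qed
    then have "(\<lambda>k. Z (r k) \<omega>) \<longlonglongrightarrow> I \<omega>" by (rule LIM_zero_cancel)
    from LIMSEQ_unique[OF this 1] show ?case .
  qed
qed

text \<open>The information carried by the increments of the path over \<open>[s, t]\<close>.\<close>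

definition increment_algebra :: "'a measure \<Rightarrow> (real \<Rightarrow> 'a \<Rightarrow> real) \<Rightarrow> real \<Rightarrow> real \<Rightarrow> 'a measure" where
  "increment_algebra M W s t =
     sigma (space M) {(\<lambda>\<omega>. W r \<omega> - W s \<omega>) -` A \<inter> space M | r A. s \<le> r \<and> r \<le> t \<and> A \<in> sets borel}"

lemma space_increment_algebra [simp]: "space (increment_algebra M W s t) = space M"
  unfolding increment_algebra_def by (rule space_measure_of) auto

lemma sets_increment_algebra: "sets (increment_algebra M W s t) = sigma_sets (space M)
   {(\<lambda>\<omega>. W r \<omega> - W s \<omega>) -` A \<inter> space M | r A. s \<le> r \<and> r \<le> t \<and> A \<in> sets borel}"
  unfolding increment_algebra_def by (rule sets_measure_of) auto

lemma space_natural_filtration [simp]: "space (natural_filtration M W t) = space M"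
  unfolding natural_filtration_def by (rule space_measure_of) auto

lemma sets_natural_filtration: "sets (natural_filtration M W t) = sigma_sets (space M)
   {W s -` A \<inter> space M | s A. 0 \<le> s \<and> s \<le> t \<and> A \<in> sets borel}"
  unfolding natural_filtration_def by (rule sets_measure_of) auto

lemma measurable_increment:
  fixes s r :: real
  shows "s \<le> r \<Longrightarrow> r \<le> t \<Longrightarrow> (\<lambda>\<omega>. W r \<omega> - W s \<omega>) \<in> borel_measurable (increment_algebra M W s t)"
  by (rule measurableI) (auto simp: sets_increment_algebra intro!: sigma_sets.Basic)

lemma measurable_natural_filtration:
  fixes s :: real
  shows "0 \<le> s \<Longrightarrow> s \<le> t \<Longrightarrow> W s \<in> borel_measurable (natural_filtration M W t)"
  by (rule measurableI) (auto simp: sets_natural_filtration intro!: sigma_sets.Basic)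

lemma sets_increment_algebra_mono:
  fixes t :: real
  shows "t \<le> t' \<Longrightarrow> sets (increment_algebra M W s t) \<subseteq> sets (increment_algebra M W s t')"
  unfolding sets_increment_algebra by (intro sigma_sets_mono') force

lemma sets_increment_algebra_natural:
  fixes s :: real
  shows "0 \<le> s \<Longrightarrow> sets (increment_algebra M W s t) \<subseteq> sets (natural_filtration M W t)"
  unfolding sets_increment_algebra
proof (rule sets.sigma_sets_subset', safe)
  fix r A assume "0 \<le> s" "s \<le> r" "r \<le> t" and A: "A \<in> sets (borel :: real measure)"
  then have [measurable]: "W r \<in> borel_measurable (natural_filtration M W t)" "W s \<in> borel_measurable (natural_filtration M W t)"
    by (auto intro!: measurable_natural_filtration)
  have "(\<lambda>\<omega>. W r \<omega> - W s \<omega>) \<in> borel_measurable (natural_filtration M W t)" by measurable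
  from measurable_sets[OF this A]
  show "(\<lambda>\<omega>. W r \<omega> - W s \<omega>) -` A \<inter> space M \<in> sets (natural_filtration M W t)" by simp
qed (use sets.top[of "natural_filtration M W t"] in simp)

lemma (in brownian_motion) sets_natural_filtration_M: "sets (natural_filtration M W t) \<subseteq> sets M"
  unfolding sets_natural_filtration
proof (rule sets.sigma_sets_subset, safe)
  fix s :: real and A assume "0 \<le> s" and A: "A \<in> sets (borel :: real measure)"
  then show "W s -` A \<inter> space M \<in> sets M" using measurable_sets[OF measurable_W A] by simp
qed

lemma measurable_mono_sets:
  "f \<in> measurable N K \<Longrightarrow> sets N \<subseteq> sets N' \<Longrightarrow> space N = space N' \<Longrightarrow> f \<in> measurable N' K"
  unfolding measurable_def by auto

lemma signature_measurable:
  assumes "is_signature M W S" "0 \<le> s" "s \<le> t"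
  shows "(\<lambda>\<omega>. S s t \<omega> v) \<in> borel_measurable M"
proof (cases v rule: rev_cases)
  case Nil
  have "(\<lambda>\<omega>. S s t \<omega> v) \<in> borel_measurable M \<longleftrightarrow> (\<lambda>\<omega>. 1 :: real) \<in> borel_measurable M"
    by (rule measurable_cong) (use assms Nil in \<open>auto simp: is_signature_def\<close>)
  then show ?thesis by simp
next
  case (snoc w i)
  then show ?thesis using assms by (auto simp: is_signature_def has_stratonovich_integral_def)
qed

text \<open>The Stratonovich sums of a word are trapezoid sums of a shorter word. They converge almost surely to
the explicit signature along the fine partitions, and this identifies the limit in probability. The
second claim runs along in the same induction: the sums are built from coefficients at the partition
points, whose versions may be taken measurable with respect to the increments, and the limit of these
sums is a measurable version of the next coefficient. Versions matter because the natural filtration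
is not completed.\<close>

lemma (in brownian_motion) signature_explicit:
  assumes S: "is_signature M W S"
  shows "0 \<le> s \<Longrightarrow> s \<le> t \<Longrightarrow> (AE \<omega> in M. S s t \<omega> v = path_sig (\<lambda>r. W r \<omega>) s t v) \<and>
    (\<exists>Z. Z \<in> borel_measurable (increment_algebra M W s t) \<and> (AE \<omega> in M. S s t \<omega> v = Z \<omega>))"
proof (induction v arbitrary: s t rule: rev_induct)
  case Nil
  have "S s t \<omega> [] = 1" if "\<omega> \<in> space M" for \<omega> using S Nil that by (simp add: is_signature_def)
  then show ?case by (auto intro!: exI[of _ "\<lambda>_. 1"])
next
  case (snoc i v)
  note s = snoc.prems(1) and st = snoc.prems(2)
  let ?\<pi> = "fine_partition s t" and ?N = fine_count and ?H = "increment_algebra M W s t"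
  have part: "partition_of s t (?\<pi> n) (?N n)" for n by (rule fine_partition_of[OF st])
  have r: "s \<le> ?\<pi> n k" "?\<pi> n k \<le> t" if "k \<le> ?N n" for n k
    using partition_of_range[OF part that] by auto
  let ?Y = "\<lambda>r \<omega>. S s r \<omega> v"
  let ?X = "time_augmented W i"
  define Sm where "Sm n = stratonovich_sum ?Y ?X (?\<pi> n) (?N n)" for n
  have hs: "has_stratonovich_integral M ?Y ?X s t (\<lambda>\<omega>. S s t \<omega> (v @ [i]))"
    using S s st by (simp add: is_signature_def)
  have ind: "(AE \<omega> in M. S s r \<omega> v = path_sig (\<lambda>r. W r \<omega>) s r v) \<and>
    (\<exists>Z. Z \<in> borel_measurable (increment_algebra M W s r) \<and> (AE \<omega> in M. S s r \<omega> v = Z \<omega>))" if "s \<le> r" for r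
    using snoc.IH[OF s that] .
  obtain Z where Z: "\<And>r. s \<le> r \<Longrightarrow> Z r \<in> borel_measurable (increment_algebra M W s r)"
    "\<And>r. s \<le> r \<Longrightarrow> AE \<omega> in M. S s r \<omega> v = Z r \<omega>"
    using ind by metis
  have AEp: "AE \<omega> in M. \<forall>n. \<forall>k\<in>{..?N n}. S s (?\<pi> n k) \<omega> v = path_sig (\<lambda>r. W r \<omega>) s (?\<pi> n k) v
      \<and> S s (?\<pi> n k) \<omega> v = Z (?\<pi> n k) \<omega>"
    unfolding AE_all_countable
  proof (intro allI AE_finite_allI)
    fix n k assume "k \<in> {..?N n}"
    then have "s \<le> ?\<pi> n k" using r by auto
    with ind[of "?\<pi> n k"] Z(2)[of "?\<pi> n k"]
    show "AE \<omega> in M. S s (?\<pi> n k) \<omega> v = path_sig (\<lambda>r. W r \<omega>) s (?\<pi> n k) v \<and> S s (?\<pi> n k) \<omega> v = Z (?\<pi> n k) \<omega>"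
      by auto
  qed simp
  have lim: "AE \<omega> in M. (\<lambda>n. Sm n \<omega>) \<longlonglongrightarrow> path_sig (\<lambda>r. W r \<omega>) s t (v @ [i])"
    using AEp continuous_paths AE_null_cubic_variation[OF s st]
  proof eventually_elim
    case (elim \<omega>)
    have c: "continuous_on {s..t} (\<lambda>r. W r \<omega>)"
      using elim(2) s by (auto intro: continuous_on_subset)
    have "Sm n \<omega> = (\<Sum>k<?N n. (path_sig (\<lambda>r. W r \<omega>) s (?\<pi> n k) v + path_sig (\<lambda>r. W r \<omega>) s (?\<pi> n (Suc k)) v) / 2 *
      (coord (\<lambda>r. W r \<omega>) i (?\<pi> n (Suc k)) - coord (\<lambda>r. W r \<omega>) i (?\<pi> n k)))" for n
      unfolding Sm_def stratonovich_sum_def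
      by (intro sum.cong refl) (use elim(1) in \<open>cases i; simp add: coord_def\<close>)
    then show ?case using trapezoid_sums_tendsto[OF c elim(3), of v i] by simp
  qed
  have XM: "?X r \<in> borel_measurable M" if "0 \<le> r" for r
  proof (cases i)
    case L0
    have "time_augmented W L0 r = (\<lambda>_. r)" by auto
    then show ?thesis using L0 by simp
  next
    case L1
    have "time_augmented W L1 r = W r" by auto
    then show ?thesis using L1 measurable_W[OF that] by simp
  qed
  have SmM: "Sm n \<in> borel_measurable M" for n
    unfolding Sm_def stratonovich_sum_def
    by (intro borel_measurable_sum borel_measurable_times borel_measurable_diff borel_measurable_divide
        borel_measurable_add borel_measurable_const XM signature_measurable[OF S s])
       (use r s in \<open>auto intro: order_trans\<close>)
  have tp: "tendsto_in_probability M Sm (\<lambda>\<omega>. S s t \<omega> (v @ [i]))"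
    using hs part fine_partition_mesh[OF st]
    unfolding has_stratonovich_integral_def Sm_def by blast
  have eq: "AE \<omega> in M. S s t \<omega> (v @ [i]) = path_sig (\<lambda>r. W r \<omega>) s t (v @ [i])"
    by (rule limit_in_probability_unique[OF tp SmM signature_measurable[OF S s st] lim])
  \<comment> \<open>increments of the path are written through increments from \<open>s\<close>, the generators of the algebra\<close>
  define XD where "XD a b \<omega> = (if i = L0 then b - a else (W b \<omega> - W s \<omega>) - (W a \<omega> - W s \<omega>))" for a b \<omega>
  \<comment> \<open>the Stratonovich sums, with versions that are functions of the increments\<close>
  define ZS where "ZS n \<omega> = (\<Sum>k<?N n. (Z (?\<pi> n k) \<omega> + Z (?\<pi> n (Suc k)) \<omega>) / 2 * XD (?\<pi> n k) (?\<pi> n (Suc k)) \<omega>)" for n \<omega>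
  have ZH: "Z (?\<pi> n k) \<in> borel_measurable ?H" if "k \<le> ?N n" for n k
    by (rule measurable_mono_sets[OF Z(1) sets_increment_algebra_mono]) (use r that in auto)
  have XDH: "XD (?\<pi> n k) (?\<pi> n (Suc k)) \<in> borel_measurable ?H" if "k < ?N n" for n k
  proof -
    have [measurable]: "(\<lambda>\<omega>. W (?\<pi> n k) \<omega> - W s \<omega>) \<in> borel_measurable ?H"
      "(\<lambda>\<omega>. W (?\<pi> n (Suc k)) \<omega> - W s \<omega>) \<in> borel_measurable ?H"
      using r[of k n] r[of "Suc k" n] that by (auto intro!: measurable_increment)
    show ?thesis unfolding XD_def by measurable
  qed
  have ZSH: "ZS n \<in> borel_measurable ?H" for n
    unfolding ZS_def
    by (intro borel_measurable_sum borel_measurable_times borel_measurable_divide borel_measurable_add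
        borel_measurable_const ZH XDH) auto
  have "AE \<omega> in M. S s t \<omega> (v @ [i]) = lim (\<lambda>n. ZS n \<omega>)"
    using AEp lim eq
  proof eventually_elim
    case (elim \<omega>)
    have "ZS n \<omega> = Sm n \<omega>" for n
      unfolding Sm_def stratonovich_sum_def ZS_def
      by (intro sum.cong refl) (use elim(1) in \<open>cases i; simp add: XD_def\<close>)
    then show ?case using elim by (simp add: limI)
  qed
  moreover have "(\<lambda>\<omega>. lim (\<lambda>n. ZS n \<omega>)) \<in> borel_measurable ?H"
    by (rule borel_measurable_lim_metric) (rule ZSH)
  ultimately show ?case using eq by blast
qed

text \<open>There are only countably many words.\<close>

lemma AE_all_words:
  assumes "\<And>v :: word. AE \<omega> in M. P \<omega> v"
  shows "AE \<omega> in M. \<forall>v. P \<omega> v"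
proof -
  have "countable (UNIV :: letter set)" by (simp add: UNIV_letter)
  then have "countable (UNIV :: word set)" using countable_lists[of "UNIV :: letter set"] by simp
  from AE_ball_countable[OF this, of P M] assms show ?thesis by simp
qed

text \<open>The induction step needs the identity for shorter words only at the partition points of countably
many partitions, so the exceptional null sets can be collected.\<close>

lemma (in brownian_motion) AE_path_sig_shuffle:
  "0 \<le> s \<Longrightarrow> s \<le> t \<Longrightarrow> AE \<omega> in M. path_sig (\<lambda>r. W r \<omega>) s t v * path_sig (\<lambda>r. W r \<omega>) s t w =
     (\<Sum>u\<in>#word_shuffle v w. path_sig (\<lambda>r. W r \<omega>) s t u)"
proof (induction "length v + length w" arbitrary: v w t rule: less_induct)
  case less
  show ?case
  proof (cases v rule: rev_cases)
    case v: (snoc v' i)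
    show ?thesis
    proof (cases w rule: rev_cases)
      case w: (snoc w' j)
      let ?\<pi> = "fine_partition s t" and ?N = fine_count
      have part: "partition_of s t (?\<pi> n) (?N n)" for n by (rule fine_partition_of[OF less.prems(2)])
      have "AE \<omega> in M. \<forall>n. \<forall>k\<in>{..?N n}.
          path_sig (\<lambda>r. W r \<omega>) s (?\<pi> n k) v * path_sig (\<lambda>r. W r \<omega>) s (?\<pi> n k) w' =
            (\<Sum>u\<in>#word_shuffle v w'. path_sig (\<lambda>r. W r \<omega>) s (?\<pi> n k) u) \<and>
          path_sig (\<lambda>r. W r \<omega>) s (?\<pi> n k) v' * path_sig (\<lambda>r. W r \<omega>) s (?\<pi> n k) w =
            (\<Sum>u\<in>#word_shuffle v' w. path_sig (\<lambda>r. W r \<omega>) s (?\<pi> n k) u)"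
        unfolding AE_all_countable
      proof (intro allI AE_finite_allI)
        fix n k assume "k \<in> {..?N n}"
        then have "s \<le> ?\<pi> n k" using partition_of_range[OF part] by auto
        then show "AE \<omega> in M. path_sig (\<lambda>r. W r \<omega>) s (?\<pi> n k) v * path_sig (\<lambda>r. W r \<omega>) s (?\<pi> n k) w' =
            (\<Sum>u\<in>#word_shuffle v w'. path_sig (\<lambda>r. W r \<omega>) s (?\<pi> n k) u) \<and>
          path_sig (\<lambda>r. W r \<omega>) s (?\<pi> n k) v' * path_sig (\<lambda>r. W r \<omega>) s (?\<pi> n k) w =
            (\<Sum>u\<in>#word_shuffle v' w. path_sig (\<lambda>r. W r \<omega>) s (?\<pi> n k) u)"
          using less.hyps[of v w' "?\<pi> n k"] less.hyps[of v' w "?\<pi> n k"] less.prems v w by simp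
      qed simp
      then show ?thesis
        using continuous_paths AE_null_cubic_variation[OF less.prems]
      proof eventually_elim
        case (elim \<omega>)
        have c: "continuous_on {s..t} (\<lambda>r. W r \<omega>)"
          using elim(2) less.prems by (auto intro: continuous_on_subset)
        show ?case
          unfolding v w
          by (rule path_sig_shuffle_step[OF c elim(3)]) (use elim(1) v w in auto)
      qed
    qed simp
  qed simp
qed

lemma (in brownian_motion) AE_signature:
  assumes S: "is_signature M W S" and st: "0 \<le> s" "s \<le> t"
  shows "AE \<omega> in M. S s t \<omega> = path_sig (\<lambda>r. W r \<omega>) s t"
proof -
  have "AE \<omega> in M. \<forall>v. S s t \<omega> v = path_sig (\<lambda>r. W r \<omega>) s t v"
    by (rule AE_all_words) (use signature_explicit[OF S st] in blast)
  then show ?thesis by (auto simp: fun_eq_iff)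
qed

lemma (in brownian_motion) AE_signature_group_like:
  assumes S: "is_signature M W S" and st: "0 \<le> s" "s \<le> t"
  shows "AE \<omega> in M. S s t \<omega> \<in> group_like"
proof -
  have "AE \<omega> in M. \<forall>v w. path_sig (\<lambda>r. W r \<omega>) s t v * path_sig (\<lambda>r. W r \<omega>) s t w =
     (\<Sum>u\<in>#word_shuffle v w. path_sig (\<lambda>r. W r \<omega>) s t u)"
    by (intro AE_all_words AE_path_sig_shuffle[OF st])
  then show ?thesis using AE_signature[OF S st]
    by eventually_elim (simp add: group_like_iff)
qed

lemma (in brownian_motion) AE_signature_Chen:
  assumes S: "is_signature M W S" and st: "0 \<le> s" "s \<le> u" "u \<le> t"
  shows "AE \<omega> in M. S s t \<omega> = S s u \<omega> \<otimes>\<^sub>t S u t \<omega>"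
proof -
  have "AE \<omega> in M. S s t \<omega> = path_sig (\<lambda>r. W r \<omega>) s t"
    "AE \<omega> in M. S s u \<omega> = path_sig (\<lambda>r. W r \<omega>) s u"
    "AE \<omega> in M. S u t \<omega> = path_sig (\<lambda>r. W r \<omega>) u t"
    by (rule AE_signature[OF S]; use st in simp)+
  then show ?thesis using continuous_paths
proof eventually_elim
  case (elim \<omega>)
  have "continuous_on {s..t} (\<lambda>r. W r \<omega>)"
    using elim(4) st by (auto intro: continuous_on_subset)
  then show ?case
    unfolding elim(1-3) using st by (intro ext path_sig_Chen) auto
qed
qed

section \<open>Independence of past and future\<close>

text \<open>All times are sorted into one sequence. The two events then depend on disjoint blocks of its
independent increments.\<close>

lemma (in brownian_motion) increments_independent_finite:
  assumes t: "0 \<le> t" and J: "finite J" "J \<subseteq> {0..t}" and K: "finite K" "K \<subseteq> {t..}"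
    and A[measurable]: "\<And>r. A r \<in> sets (borel :: real measure)" and B[measurable]: "\<And>r. B r \<in> sets (borel :: real measure)"
  shows "prob ({\<omega> \<in> space M. \<forall>r\<in>J. W r \<omega> - W 0 \<omega> \<in> A r} \<inter> {\<omega> \<in> space M. \<forall>r\<in>K. W r \<omega> - W t \<omega> \<in> B r}) =
    prob {\<omega> \<in> space M. \<forall>r\<in>J. W r \<omega> - W 0 \<omega> \<in> A r} * prob {\<omega> \<in> space M. \<forall>r\<in>K. W r \<omega> - W t \<omega> \<in> B r}"
proof -
  define P where "P = J \<union> K \<union> {0, t}"
  define L where "L = sorted_list_of_set P"
  define \<tau> where "\<tau> k = L ! k" for k
  define n where "n = length L - 1"
  have finP: "finite P" using J K by (simp add: P_def)
  have setL: "set L = P" using finP by (simp add: L_def)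
  have P0: "0 \<le> x" if "x \<in> P" for x using that J K t by (auto simp: P_def)
  have "L \<noteq> []" using setL by (auto simp: P_def)
  then have len: "length L = Suc n" by (cases L) (auto simp: n_def)
  have less: "\<tau> k < \<tau> l" if "k < l" "l \<le> n" for k l
    unfolding \<tau>_def using that len strict_sorted_list_of_set[of P]
    by (intro sorted_wrt_nth_less[of "(<)"]) (auto simp: L_def)
  have in_P: "\<tau> k \<in> P" if "k \<le> n" for k
    using that len setL nth_mem[of k L] by (auto simp: \<tau>_def)
  have "\<forall>r\<in>P. \<exists>k\<le>n. \<tau> k = r"
    using setL len by (auto simp: in_set_conv_nth \<tau>_def less_Suc_eq_le)
  then obtain idx where idx: "\<And>r. r \<in> P \<Longrightarrow> idx r \<le> n" "\<And>r. r \<in> P \<Longrightarrow> \<tau> (idx r) = r" by metis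
  have mono: "idx r \<le> idx r'" if "r \<le> r'" "r \<in> P" "r' \<in> P" for r r'
    using less[of "idx r'" "idx r"] idx that by (metis leD linorder_le_less_linear)
  have mem: "0 \<in> P" "t \<in> P" "r \<in> J \<Longrightarrow> r \<in> P" "r \<in> K \<Longrightarrow> r \<in> P" for r by (auto simp: P_def)
  have \<tau>0: "\<tau> 0 = 0"
  proof (cases "idx 0 = 0")
    case True
    then show ?thesis using idx(2)[OF mem(1)] by simp
  next
    case False
    then have "\<tau> 0 < \<tau> (idx 0)" using idx(1)[OF mem(1)] by (intro less) auto
    then show ?thesis using P0[OF in_P[of 0]] idx(2)[OF mem(1)] by simp
  qed
  define D where "D k \<omega> = W (\<tau> (Suc k)) \<omega> - W (\<tau> k) \<omega>" for k \<omega>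
  have ind: "indep_vars (\<lambda>_. borel) D {..<n}"
    unfolding D_def[abs_def] by (rule independent_increments) (use \<tau>0 less in \<open>auto intro: less_imp_le\<close>)
  have tel: "(\<Sum>i\<in>{k..<l}. D i \<omega>) = W (\<tau> l) \<omega> - W (\<tau> k) \<omega>" if "k \<le> l" for k l \<omega>
    unfolding D_def using that sum_Suc_diff'[of k l "\<lambda>i. W (\<tau> i) \<omega>"] by simp
  let ?I1 = "{0..<idx t}" and ?I2 = "{idx t..<n}"
  let ?S1 = "PiM ?I1 (\<lambda>_. borel :: real measure)" and ?S2 = "PiM ?I2 (\<lambda>_. borel :: real measure)"
  have indv: "indep_var ?S1 (\<lambda>\<omega>. restrict (\<lambda>i. D i \<omega>) ?I1) ?S2 (\<lambda>\<omega>. restrict (\<lambda>i. D i \<omega>) ?I2)"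
    by (rule indep_var_restrict[OF ind]) (use idx(1)[OF mem(2)] in auto)
  have J1: "{0..<idx r} \<subseteq> ?I1" if "r \<in> J" for r
    using mono[of r t] that mem J by auto
  have K1: "idx t \<le> idx r" "{idx t..<idx r} \<subseteq> ?I2" if "r \<in> K" for r
    using mono[of t r] idx(1)[of r] that mem K by auto
  \<comment> \<open>both events are pulled back from sums of coordinates of the two blocks of increments\<close>
  define E1 where "E1 = {x \<in> space ?S1. \<forall>r\<in>J. (\<Sum>i\<in>{0..<idx r}. x i) \<in> A r}"
  define E2 where "E2 = {x \<in> space ?S2. \<forall>r\<in>K. (\<Sum>i\<in>{idx t..<idx r}. x i) \<in> B r}"
  have E1: "E1 \<in> sets ?S1"
    unfolding E1_def
  proof (rule sets.sets_Collect_finite_All[OF _ J(1)])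
    fix r assume r: "r \<in> J"
    have [measurable]: "(\<lambda>x. \<Sum>i\<in>{0..<idx r}. x i) \<in> borel_measurable ?S1"
      by (intro borel_measurable_sum measurable_component_singleton) (use J1[OF r] in auto)
    show "{x \<in> space ?S1. (\<Sum>i\<in>{0..<idx r}. x i) \<in> A r} \<in> sets ?S1" by measurable
  qed
  have E2: "E2 \<in> sets ?S2"
    unfolding E2_def
  proof (rule sets.sets_Collect_finite_All[OF _ K(1)])
    fix r assume r: "r \<in> K"
    have [measurable]: "(\<lambda>x. \<Sum>i\<in>{idx t..<idx r}. x i) \<in> borel_measurable ?S2"
      by (intro borel_measurable_sum measurable_component_singleton) (use K1(2)[OF r] in auto)
    show "{x \<in> space ?S2. (\<Sum>i\<in>{idx t..<idx r}. x i) \<in> B r} \<in> sets ?S2" by measurable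
  qed
  have s1: "(\<Sum>i\<in>{0..<idx r}. restrict (\<lambda>i. D i \<omega>) ?I1 i) = W r \<omega> - W 0 \<omega>" if "r \<in> J" for r \<omega>
  proof -
    have "(\<Sum>i\<in>{0..<idx r}. restrict (\<lambda>i. D i \<omega>) ?I1 i) = (\<Sum>i\<in>{0..<idx r}. D i \<omega>)"
      using J1[OF that] by (intro sum.cong) auto
    then show ?thesis using that mem idx(2) \<tau>0 by (simp add: tel)
  qed
  have s2: "(\<Sum>i\<in>{idx t..<idx r}. restrict (\<lambda>i. D i \<omega>) ?I2 i) = W r \<omega> - W t \<omega>" if "r \<in> K" for r \<omega>
  proof -
    have "(\<Sum>i\<in>{idx t..<idx r}. restrict (\<lambda>i. D i \<omega>) ?I2 i) = (\<Sum>i\<in>{idx t..<idx r}. D i \<omega>)"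
      using K1[OF that] by (intro sum.cong) auto
    then show ?thesis using that mem idx(2) K1(1)[OF that] by (simp add: tel)
  qed
  have e1: "(\<lambda>\<omega>. restrict (\<lambda>i. D i \<omega>) ?I1) -` E1 \<inter> space M = {\<omega> \<in> space M. \<forall>r\<in>J. W r \<omega> - W 0 \<omega> \<in> A r}"
    using s1 by (auto simp: E1_def space_PiM)
  have e2: "(\<lambda>\<omega>. restrict (\<lambda>i. D i \<omega>) ?I2) -` E2 \<inter> space M = {\<omega> \<in> space M. \<forall>r\<in>K. W r \<omega> - W t \<omega> \<in> B r}"
    using s2 by (auto simp: E2_def space_PiM)
  have "(\<lambda>\<omega>. (restrict (\<lambda>i. D i \<omega>) ?I1, restrict (\<lambda>i. D i \<omega>) ?I2)) -` (E1 \<times> E2) \<inter> space M =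
    {\<omega> \<in> space M. \<forall>r\<in>J. W r \<omega> - W 0 \<omega> \<in> A r} \<inter> {\<omega> \<in> space M. \<forall>r\<in>K. W r \<omega> - W t \<omega> \<in> B r}"
    unfolding e1[symmetric] e2[symmetric] by auto
  then show ?thesis
    using indep_varD[OF indv E1 E2] by (simp add: e1 e2)
qed

text \<open>A generator, stable under intersection, of the \<open>\<sigma>\<close>-algebra of a family of random variables.\<close>

definition cylinders :: "'a set \<Rightarrow> (real \<Rightarrow> 'a \<Rightarrow> real) \<Rightarrow> real set \<Rightarrow> 'a set set" where
  "cylinders \<Omega> f I = {{\<omega> \<in> \<Omega>. \<forall>r\<in>J. f r \<omega> \<in> A r} | J A. finite J \<and> J \<subseteq> I \<and> (\<forall>r. A r \<in> sets borel)}"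

lemma Int_stable_cylinders: "Int_stable (cylinders \<Omega> f I)"
proof (rule Int_stableI)
  fix a b assume "a \<in> cylinders \<Omega> f I" "b \<in> cylinders \<Omega> f I"
  then obtain J A K B where a: "a = {\<omega> \<in> \<Omega>. \<forall>r\<in>J. f r \<omega> \<in> A r}" "finite J" "J \<subseteq> I" "\<And>r. A r \<in> sets borel"
    and b: "b = {\<omega> \<in> \<Omega>. \<forall>r\<in>K. f r \<omega> \<in> B r}" "finite K" "K \<subseteq> I" "\<And>r. B r \<in> sets borel"
    unfolding cylinders_def by blast
  define C where "C r = (if r \<in> J then A r else UNIV) \<inter> (if r \<in> K then B r else UNIV)" for r
  have "a \<inter> b = {\<omega> \<in> \<Omega>. \<forall>r\<in>J \<union> K. f r \<omega> \<in> C r}"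
    unfolding a b C_def by auto
  moreover have "C r \<in> sets borel" for r using a(4) b(4) by (auto simp: C_def)
  moreover have "finite (J \<union> K)" "J \<union> K \<subseteq> I" using a(2,3) b(2,3) by auto
  ultimately show "a \<inter> b \<in> cylinders \<Omega> f I"
    unfolding cylinders_def mem_Collect_eq by (intro exI[of _ "J \<union> K"] exI[of _ C]) simp
qed

lemma cylinders_single: "s \<in> I \<Longrightarrow> A \<in> sets borel \<Longrightarrow> f s -` A \<inter> \<Omega> \<in> cylinders \<Omega> f I"
  unfolding cylinders_def by (auto intro!: exI[of _ "{s}"] exI[of _ "\<lambda>_. A"])

text \<open>The past contains the value at time 0, which is almost surely 0; up to null sets a cylinder of the past
is therefore a cylinder of increments.\<close>

lemma (in brownian_motion) past_future_independent:
  assumes t: "0 \<le> t" "t \<le> T"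
  shows "indep_set (sets (natural_filtration M W t)) (sets (increment_algebra M W t T))"
proof -
  let ?G1 = "cylinders (space M) W {0..t}" and ?G2 = "cylinders (space M) (\<lambda>r \<omega>. W r \<omega> - W t \<omega>) {t..T}"
  have M1: "{\<omega> \<in> space M. \<forall>r\<in>J. f r \<omega> \<in> A r} \<in> sets M"
    if "finite J" "\<And>r. A r \<in> sets (borel :: real measure)" "\<And>r. r \<in> J \<Longrightarrow> f r \<in> borel_measurable M" for J A f
  proof (rule sets.sets_Collect_finite_All[OF _ that(1)])
    fix r assume "r \<in> J"
    then have [measurable]: "f r \<in> borel_measurable M" "A r \<in> sets borel" using that by auto
    show "{\<omega> \<in> space M. f r \<omega> \<in> A r} \<in> sets M" by measurable
  qed
  have Wm: "W r \<in> borel_measurable M" if "0 \<le> r" for r by (rule measurable_W[OF that])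
  have ind: "indep_set ?G1 ?G2"
  proof (rule indep_setI)
    have cyl: "cylinders (space M) f I \<subseteq> events" if f: "\<And>r. r \<in> I \<Longrightarrow> f r \<in> borel_measurable M" for f I
    proof
      fix a assume "a \<in> cylinders (space M) f I"
      then obtain J A where a: "a = {\<omega> \<in> space M. \<forall>r\<in>J. f r \<omega> \<in> A r}" "finite J" "J \<subseteq> I" "\<And>r. A r \<in> sets borel"
        unfolding cylinders_def by blast
      show "a \<in> events" unfolding a(1) by (rule M1) (use a f in auto)
    qed
    show "?G1 \<subseteq> events" by (rule cyl) (use Wm in auto)
    show "?G2 \<subseteq> events" by (rule cyl) (use Wm t in \<open>auto intro!: borel_measurable_diff\<close>)
  next
    fix a b assume "a \<in> ?G1" "b \<in> ?G2"
    then obtain J A K B where a: "a = {\<omega> \<in> space M. \<forall>r\<in>J. W r \<omega> \<in> A r}" "finite J" "J \<subseteq> {0..t}" "\<And>r. A r \<in> sets borel"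
      and b: "b = {\<omega> \<in> space M. \<forall>r\<in>K. W r \<omega> - W t \<omega> \<in> B r}" "finite K" "K \<subseteq> {t..T}" "\<And>r. B r \<in> sets borel"
      unfolding cylinders_def by blast
    let ?a = "{\<omega> \<in> space M. \<forall>r\<in>J. W r \<omega> - W 0 \<omega> \<in> A r}"
    have am: "a \<in> events" unfolding a(1) by (rule M1) (use a Wm in auto)
    have am': "?a \<in> events"
      by (rule M1[of J A "\<lambda>r \<omega>. W r \<omega> - W 0 \<omega>"]) (use a Wm in \<open>auto intro!: borel_measurable_diff\<close>)
    have bm: "b \<in> events" unfolding b(1)
      by (rule M1[of K B "\<lambda>r \<omega>. W r \<omega> - W t \<omega>"]) (use b Wm t in \<open>auto intro!: borel_measurable_diff\<close>)
    have AE: "AE \<omega> in M. \<omega> \<in> a \<longleftrightarrow> \<omega> \<in> ?a"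
      using start_zero by eventually_elim (auto simp: a)
    have "prob a = prob ?a" by (rule finite_measure_eq_AE[OF AE am am'])
    moreover have "prob (a \<inter> b) = prob (?a \<inter> b)"
      by (rule finite_measure_eq_AE) (use AE am am' bm in auto)
    moreover have "prob (?a \<inter> b) = prob ?a * prob b"
      unfolding b(1) by (rule increments_independent_finite[OF t(1)]) (use a b in auto)
    ultimately show "prob (a \<inter> b) = prob a * prob b" by simp
  qed
  have ind': "indep_set (sigma_sets (space M) ?G1) (sigma_sets (space M) ?G2)"
    by (rule indep_set_sigma_sets[OF ind Int_stable_cylinders Int_stable_cylinders])
  have 1: "sets (natural_filtration M W t) \<subseteq> sigma_sets (space M) ?G1"
    unfolding sets_natural_filtration
    by (rule sigma_sets_mono') (auto intro!: cylinders_single)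
  have 2: "sets (increment_algebra M W t T) \<subseteq> sigma_sets (space M) ?G2"
    unfolding sets_increment_algebra
    by (rule sigma_sets_mono') (auto intro!: cylinders_single[of _ _ _ "\<lambda>r \<omega>. W r \<omega> - W t \<omega>"])
  have 3: "sigma_sets (space M) ?G1 \<subseteq> events" "sigma_sets (space M) ?G2 \<subseteq> events"
    using ind' by (auto simp: indep_set_def indep_sets_def UNIV_bool)
  show ?thesis
    by (rule indep_setI) (use 1 2 3 indep_setD[OF ind'] in blast)+
qed

text \<open>By independence, past and future have a product law under the diagonal map, and Fubini's theorem
integrates the future out while the past is kept fixed.\<close>

lemma (in prob_space) freezing_real:
  fixes \<phi> :: "'a \<times> 'a \<Rightarrow> real"
  assumes F: "subalgebra M F" and H: "subalgebra M H" and ind: "indep_set (sets F) (sets H)"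
    and \<phi>[measurable]: "\<phi> \<in> borel_measurable (F \<Otimes>\<^sub>M H)" and int: "integrable M (\<lambda>\<omega>. \<phi> (\<omega>, \<omega>))"
  shows "AE \<omega> in M. integrable M (\<lambda>\<omega>'. \<phi> (\<omega>, \<omega>')) \<and>
     real_cond_exp M F (\<lambda>\<omega>. \<phi> (\<omega>, \<omega>)) \<omega> = (\<integral>\<omega>'. \<phi> (\<omega>, \<omega>') \<partial>M)"
proof -
  have sp: "space F = space M" "space H = space M" and le: "sets F \<subseteq> sets M" "sets H \<subseteq> sets M"
    using F H by (auto simp: subalgebra_def)
  have idF[measurable]: "(\<lambda>\<omega>. \<omega>) \<in> measurable M F" and idH[measurable]: "(\<lambda>\<omega>. \<omega>) \<in> measurable M H"
    using sp le sets.sets_into_space[of _ F] sets.sets_into_space[of _ H]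
    by (auto intro!: measurableI simp: subset_iff Int_absorb2)
  have sF: "sigma_sets (space M) {(\<lambda>\<omega>. \<omega>) -` A \<inter> space M | A. A \<in> sets F} = sets F"
  proof -
    have "{(\<lambda>\<omega>. \<omega>) -` A \<inter> space M | A. A \<in> sets F} = sets F"
      using sets.sets_into_space[of _ F] sp by (auto simp: Int_absorb2 intro!: exI)
    then show ?thesis using sets.sigma_sets_eq[of F] sp by simp
  qed
  have sH: "sigma_sets (space M) {(\<lambda>\<omega>. \<omega>) -` A \<inter> space M | A. A \<in> sets H} = sets H"
  proof -
    have "{(\<lambda>\<omega>. \<omega>) -` A \<inter> space M | A. A \<in> sets H} = sets H"
      using sets.sets_into_space[of _ H] sp by (auto simp: Int_absorb2 intro!: exI)
    then show ?thesis using sets.sigma_sets_eq[of H] sp by simp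
  qed
  have iv: "indep_var F (\<lambda>\<omega>. \<omega>) H (\<lambda>\<omega>. \<omega>)"
    unfolding indep_var_eq sF sH using ind idF idH by simp
  let ?P1 = "distr M F (\<lambda>\<omega>. \<omega>)" and ?P2 = "distr M H (\<lambda>\<omega>. \<omega>)"
  have D: "?P1 \<Otimes>\<^sub>M ?P2 = distr M (F \<Otimes>\<^sub>M H) (\<lambda>\<omega>. (\<omega>, \<omega>))"
    using iv unfolding indep_var_distribution_eq by blast
  interpret P1: prob_space ?P1 by (rule prob_space_distr[OF idF])
  interpret P2: prob_space ?P2 by (rule prob_space_distr[OF idH])
  interpret PP: pair_prob_space ?P1 ?P2 by unfold_locales
  have diag[measurable]: "(\<lambda>\<omega>. (\<omega>, \<omega>)) \<in> measurable M (F \<Otimes>\<^sub>M H)" by measurable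
  have iP: "integrable (?P1 \<Otimes>\<^sub>M ?P2) \<phi>"
    unfolding D by (subst integrable_distr_eq) (use int in auto)
  \<comment> \<open>the future integrated out under its own law, which makes the result measurable for the past\<close>
  define \<psi> where "\<psi> \<omega> = (\<integral>\<omega>'. \<phi> (\<omega>, \<omega>') \<partial>?P2)" for \<omega>
  have sec: "(\<lambda>\<omega>'. \<phi> (\<omega>, \<omega>')) \<in> borel_measurable H" if "\<omega> \<in> space M" for \<omega>
    using that sp by (intro measurable_compose_Pair1[OF _ \<phi>]) simp
  have \<psi>M: "\<psi> \<omega> = (\<integral>\<omega>'. \<phi> (\<omega>, \<omega>') \<partial>M)" if "\<omega> \<in> space M" for \<omega>
    unfolding \<psi>_def by (rule integral_distr[OF idH sec[OF that]])
  have "AE \<omega> in ?P1. integrable ?P2 (\<lambda>\<omega>'. \<phi> (\<omega>, \<omega>'))"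
    by (rule PP.AE_integrable_fst'[OF iP])
  then obtain N where N: "N \<in> null_sets ?P1" "{\<omega> \<in> space ?P1. \<not> integrable ?P2 (\<lambda>\<omega>'. \<phi> (\<omega>, \<omega>'))} \<subseteq> N"
    by (auto simp: eventually_ae_filter)
  have NM: "N \<in> null_sets M"
  proof -
    have NF: "N \<in> sets F" and "emeasure ?P1 N = 0" using N(1) by auto
    moreover have "emeasure ?P1 N = emeasure M N"
      using NF sets.sets_into_space[OF NF] sp by (simp add: emeasure_distr Int_absorb2)
    ultimately show ?thesis using le by auto
  qed
  have AEi: "AE \<omega> in M. integrable M (\<lambda>\<omega>'. \<phi> (\<omega>, \<omega>'))"
  proof (rule AE_I'[OF NM], safe)
    fix \<omega> assume \<omega>: "\<omega> \<in> space M" "\<not> integrable M (\<lambda>\<omega>'. \<phi> (\<omega>, \<omega>'))"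
    then have "\<not> integrable ?P2 (\<lambda>\<omega>'. \<phi> (\<omega>, \<omega>'))"
      using integrable_distr_eq[OF idH sec[OF \<omega>(1)]] by simp
    then show "\<omega> \<in> N" using N(2) \<omega> sp by auto
  qed
  have \<psi>F: "\<psi> \<in> borel_measurable F"
  proof -
    have "(\<lambda>\<omega>. \<integral>\<omega>'. \<phi> (\<omega>, \<omega>') \<partial>?P2) \<in> borel_measurable F"
      by (rule P2.borel_measurable_lebesgue_integral) (simp add: split_beta')
    then show ?thesis by (simp add: \<psi>_def[abs_def])
  qed
  have \<psi>i1: "integrable ?P1 \<psi>" unfolding \<psi>_def[abs_def] by (rule PP.integrable_fst'[OF iP])
  have \<psi>i: "integrable M \<psi>"
    using \<psi>i1 integrable_distr_eq[OF idF \<psi>F] by simp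
  interpret fin: finite_measure_subalgebra M F by unfold_locales (rule F)
  have "AE \<omega> in M. real_cond_exp M F (\<lambda>\<omega>. \<phi> (\<omega>, \<omega>)) \<omega> = \<psi> \<omega>"
  proof (rule fin.real_cond_exp_charact[OF _ int \<psi>i \<psi>F])
    fix A assume A[measurable]: "A \<in> sets F"
    have iA: "integrable (?P1 \<Otimes>\<^sub>M ?P2) (\<lambda>z. indicator A (fst z) *\<^sub>R \<phi> z)"
    proof (rule Bochner_Integration.integrable_bound[OF iP])
      show "AE z in ?P1 \<Otimes>\<^sub>M ?P2. norm (indicator A (fst z) *\<^sub>R \<phi> z) \<le> norm (\<phi> z)"
        by (auto simp: indicator_def)
    qed measurable
    have "(\<integral>\<omega>\<in>A. \<phi> (\<omega>, \<omega>) \<partial>M) = (\<integral>z. indicator A (fst z) *\<^sub>R \<phi> z \<partial>distr M (F \<Otimes>\<^sub>M H) (\<lambda>\<omega>. (\<omega>, \<omega>)))"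
      unfolding set_lebesgue_integral_def by (subst integral_distr) auto
    also have "\<dots> = (\<integral>\<omega>. (\<integral>\<omega>'. indicator A (fst (\<omega>, \<omega>')) *\<^sub>R \<phi> (\<omega>, \<omega>') \<partial>?P2) \<partial>?P1)"
      unfolding D[symmetric] by (rule PP.integral_fst'[OF iA, symmetric])
    also have "\<dots> = (\<integral>\<omega>. indicator A \<omega> *\<^sub>R \<psi> \<omega> \<partial>?P1)"
      by (simp add: \<psi>_def)
    also have "\<dots> = (\<integral>\<omega>\<in>A. \<psi> \<omega> \<partial>M)"
      unfolding set_lebesgue_integral_def by (rule integral_distr[OF idF]) (use \<psi>F in measurable)
    finally show "(\<integral>\<omega>\<in>A. \<phi> (\<omega>, \<omega>) \<partial>M) = (\<integral>\<omega>\<in>A. \<psi> \<omega> \<partial>M)" .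
  qed
  with AEi AE_space show ?thesis by eventually_elim (simp add: \<psi>M)
qed

lemma (in prob_space) freezing:
  fixes \<Phi> :: "'a \<times> 'a \<Rightarrow> complex"
  assumes F: "subalgebra M F" and H: "subalgebra M H" and ind: "indep_set (sets F) (sets H)"
    and \<Phi>[measurable]: "\<Phi> \<in> borel_measurable (F \<Otimes>\<^sub>M H)" and int: "integrable M (\<lambda>\<omega>. \<Phi> (\<omega>, \<omega>))"
  shows "AE \<omega> in M. complex_cond_exp M F (\<lambda>\<omega>. \<Phi> (\<omega>, \<omega>)) \<omega> = (\<integral>\<omega>'. \<Phi> (\<omega>, \<omega>') \<partial>M)"
proof -
  have "AE \<omega> in M. integrable M (\<lambda>\<omega>'. Re (\<Phi> (\<omega>, \<omega>'))) \<and>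
     real_cond_exp M F (\<lambda>\<omega>. Re (\<Phi> (\<omega>, \<omega>))) \<omega> = (\<integral>\<omega>'. Re (\<Phi> (\<omega>, \<omega>')) \<partial>M)"
    by (rule freezing_real[OF F H ind, of "\<lambda>z. Re (\<Phi> z)"]) (use int in auto)
  moreover have "AE \<omega> in M. integrable M (\<lambda>\<omega>'. Im (\<Phi> (\<omega>, \<omega>'))) \<and>
     real_cond_exp M F (\<lambda>\<omega>. Im (\<Phi> (\<omega>, \<omega>))) \<omega> = (\<integral>\<omega>'. Im (\<Phi> (\<omega>, \<omega>')) \<partial>M)"
    by (rule freezing_real[OF F H ind, of "\<lambda>z. Im (\<Phi> z)"]) (use int in auto)
  ultimately show ?thesis
  proof eventually_elim
    case (elim \<omega>)
    have "integrable M (\<lambda>\<omega>'. complex_of_real (Re (\<Phi> (\<omega>, \<omega>'))) + \<i> * complex_of_real (Im (\<Phi> (\<omega>, \<omega>'))))"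
      using elim by (intro Bochner_Integration.integrable_add integrable_mult_right integrable_of_real) auto
    then have "integrable M (\<lambda>\<omega>'. \<Phi> (\<omega>, \<omega>'))"
      by (simp add: complex_eq[symmetric])
    then show ?case using elim by (simp add: complex_cond_exp_def complex_eq_iff)
  qed
qed

section \<open>Expectations of shuffle exponentials\<close>

lemma shift_tensor_support:
  assumes "finite {v. p v \<noteq> 0}" "shift_tensor p Y v \<noteq> 0"
  shows "v \<in> insert [] (prefixes_of p)"
proof -
  have "shift_tensor p Y v = (\<Sum>w\<in>{w. \<exists>v. p (v @ w) \<noteq> 0}. complex_of_real (Y w) * p (v @ w))"
    by (rule shift_tensor_finite[OF finite_prefixes_of(2)[OF assms(1)]]) auto
  with assms(2) have "(\<Sum>w\<in>{w. \<exists>v. p (v @ w) \<noteq> 0}. complex_of_real (Y w) * p (v @ w)) \<noteq> 0"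
    by simp
  from sum.not_neutral_contains_not_neutral[OF this] obtain w where "p (v @ w) \<noteq> 0"
    by auto
  then show ?thesis by (auto simp: prefixes_of_def)
qed

lemma M_bound_nonneg_and_bound:
  assumes fin: "finite {v. p v \<noteq> 0}"
  shows "0 \<le> M_bound p X" "v \<in> prefixes_of p \<Longrightarrow> \<bar>X v\<bar> \<le> M_bound p X"
proof -
  let ?S = "{v. 1 \<le> length v \<and> ereal (real (length v)) \<le> deg p}"
  define N where "N = Max (length ` {v. p v \<noteq> 0})"
  have "deg p \<le> ereal (real N)"
    unfolding deg_def by (rule SUP_least) (use fin in \<open>auto simp: N_def\<close>)
  then have "?S \<subseteq> {v. length v \<le> N}"
    using order_trans[of _ "deg p" "ereal (real N)"] by fastforce
  then have finS: "finite (insert 0 ((\<lambda>v. \<bar>X v\<bar>) ` ?S))"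
    using finite_subset[OF _ finite_words_le] by blast
  show "0 \<le> M_bound p X" unfolding M_bound_def by (rule Max_ge[OF finS]) simp
  assume "v \<in> prefixes_of p"
  then obtain w where v: "v \<noteq> []" and w: "p (v @ w) \<noteq> 0" by (auto simp: prefixes_of_def)
  have "ereal (real (length v)) \<le> ereal (real (length (v @ w)))" by simp
  also have "\<dots> \<le> deg p" unfolding deg_def by (rule SUP_upper) (use w in auto)
  finally have "v \<in> ?S" using v by (cases v) auto
  then show "\<bar>X v\<bar> \<le> M_bound p X" unfolding M_bound_def by (intro Max_ge[OF finS]) auto
qed

definition exponent_sum :: "complex tensor \<Rightarrow> real tensor \<Rightarrow> real" where
  "exponent_sum p Y = (\<Sum>v\<in>prefixes_of p. cmod (shift_tensor p Y v))"

text \<open>The constant term of the shifted tensor is the pairing of \<open>p\<close> with \<open>Y\<close>; the rest is measured by the sum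
of its absolute coefficients, weighted with the largest relevant coefficient of \<open>X\<close>.\<close>

lemma shuffle_exp_shift:
  assumes fin: "finite {v. p v \<noteq> 0}" and X: "X \<in> group_like"
  shows "summable (\<lambda>n. cmod (level (shuffle_exp (shift_tensor p Y)) X n))"
    "(\<Sum>n. cmod (level (shuffle_exp (shift_tensor p Y)) X n))
      \<le> exp (Re (pairing p Y) + M_bound p X * exponent_sum p Y)"
    "pairing (shuffle_exp (shift_tensor p Y)) X = exp (pairing p (X \<otimes>\<^sub>t Y))"
proof -
  let ?l = "shift_tensor p Y" and ?A = "insert [] (prefixes_of p)"
  have A: "finite ?A" "\<And>v. ?l v \<noteq> 0 \<Longrightarrow> v \<in> ?A"
    using finite_prefixes_of(1)[OF fin] shift_tensor_support[OF fin] by auto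
  have B: "\<bar>X v\<bar> \<le> M_bound p X" if "v \<noteq> []" "?l v \<noteq> 0" for v
    using that A(2)[of v] M_bound_nonneg_and_bound(2)[OF fin] by auto
  have X1: "X [] = 1" using X by (simp add: group_like_iff)
  have L: "summable (\<lambda>n. cmod (level (reduced ?l) X n))"
    "(\<Sum>n. cmod (level (reduced ?l) X n)) \<le> M_bound p X * (\<Sum>v\<in>?A - {[]}. cmod (?l v))"
    "?l [] + pairing (reduced ?l) X = pairing ?l X"
    by (rule level_reduced_finite[of ?A ?l X "M_bound p X"]; use A B X1 in blast)+
  note E = shuffle_exp_group_like[OF X L(1)]
  show "summable (\<lambda>n. cmod (level (shuffle_exp ?l) X n))" by (rule E(1))
  have "?A - {[]} = prefixes_of p" by (auto simp: prefixes_of_def)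
  then have "(\<Sum>n. cmod (level (reduced ?l) X n)) \<le> M_bound p X * exponent_sum p Y"
    using L(2) by (simp add: exponent_sum_def)
  then have "exp (Re (?l []) + (\<Sum>n. cmod (level (reduced ?l) X n)))
      \<le> exp (Re (pairing p Y) + M_bound p X * exponent_sum p Y)"
    by (simp add: shift_tensor_Nil[OF fin])
  with E(2) show "(\<Sum>n. cmod (level (shuffle_exp ?l) X n)) \<le> exp (Re (pairing p Y) + M_bound p X * exponent_sum p Y)"
    by (rule order_trans)
  show "pairing (shuffle_exp ?l) X = exp (pairing p (X \<otimes>\<^sub>t Y))"
    unfolding E(3) L(3) pairing_tensor_mult[OF fin] ..
qed

lemma shuffle_exp_shift_coeff:
  assumes fin: "finite {v. p v \<noteq> 0}"
  shows "\<exists>K\<ge>0. \<forall>Y. cmod (shuffle_exp (shift_tensor p Y) u) \<le> exp (Re (pairing p Y) + K * exponent_sum p Y)"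
proof -
  obtain K where K0: "K \<ge> 0" and K: "\<And>l R. (\<And>v. cmod (reduced l v) \<le> R) \<Longrightarrow>
      cmod (shuffle_exp l u) \<le> exp (Re (l []) + K * R)"
    using shuffle_exp_coeff_bound[of u] by blast
  have "cmod (shuffle_exp (shift_tensor p Y) u) \<le> exp (Re (pairing p Y) + K * exponent_sum p Y)" for Y
  proof -
    have "cmod (reduced (shift_tensor p Y) v) \<le> exponent_sum p Y" for v
    proof (cases "v \<in> prefixes_of p")
      case True
      then have "v \<noteq> []" by (simp add: prefixes_of_def)
      then show ?thesis using True finite_prefixes_of(1)[OF fin]
        by (auto simp: exponent_sum_def reduced_other intro!: member_le_sum)
    next
      case False
      then have "reduced (shift_tensor p Y) v = 0"
        using shift_tensor_support[OF fin, of Y v] by (cases "v = []") (auto simp: reduced_other)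
      then show ?thesis by (auto simp: exponent_sum_def intro!: sum_nonneg)
    qed
    from K[OF this] show ?thesis by (simp add: shift_tensor_Nil[OF fin])
  qed
  then show ?thesis using K0 by blast
qed

lemma shuffle_exp_Nil:
  assumes fin: "finite {v. p v \<noteq> 0}"
  shows "shuffle_exp (shift_tensor p Y) [] = exp (pairing p Y)"
proof -
  have "(\<Sum>k. shuffle_power (reduced (shift_tensor p Y)) k [] / fact k) = (\<Sum>k\<in>{0}. shuffle_power (reduced (shift_tensor p Y)) k [] / fact k)"
    by (rule suminf_finite) (auto simp: shuffle_power_eq_0)
  then show ?thesis by (simp add: shuffle_exp_reduced shift_tensor_Nil[OF fin] word_tensor_def)
qed

text \<open>Expectations of shuffle exponentials are computed for any random tensor whose exponent satisfies the
bound of class \<open>\<B>\<close> almost surely. The parameter \<open>m\<close> in this bound is quantified inside, since it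
is instantiated both by coefficients of group-like elements and by combinatorial constants.\<close>

locale random_tensor = prob_space M for M :: "'a measure" +
  fixes p :: "complex tensor" and Y :: "'a \<Rightarrow> real tensor" and C D :: real
  assumes fin: "finite {v. p v \<noteq> 0}"
    and Y_measurable [measurable]: "\<And>v. (\<lambda>\<omega>. Y \<omega> v) \<in> borel_measurable M"
    and exponent: "AE \<omega> in M. \<forall>m\<ge>0. Re (pairing p (Y \<omega>)) + m * exponent_sum p (Y \<omega>) \<le> C * (1 + m) powr D"
begin

abbreviation \<xi> :: "'a \<Rightarrow> complex tensor" where
  "\<xi> \<omega> \<equiv> shuffle_exp (shift_tensor p (Y \<omega>))"

abbreviation u :: "complex tensor" where
  "u \<equiv> \<lambda>v. \<integral>\<omega>. \<xi> \<omega> v \<partial>M"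

lemma shift_measurable [measurable]: "(\<lambda>\<omega>. shift_tensor p (Y \<omega>) v) \<in> borel_measurable M"
proof -
  have "shift_tensor p (Y \<omega>) v = (\<Sum>w\<in>{w. \<exists>v. p (v @ w) \<noteq> 0}. complex_of_real (Y \<omega> w) * p (v @ w))" for \<omega>
    by (rule shift_tensor_finite[OF finite_prefixes_of(2)[OF fin]]) auto
  then show ?thesis by simp
qed

lemma pairing_mult_measurable [measurable]: "(\<lambda>\<omega>. pairing p (X \<otimes>\<^sub>t Y \<omega>)) \<in> borel_measurable M"
proof -
  have "pairing p (X \<otimes>\<^sub>t Y \<omega>) = (\<Sum>v\<in>{v. p v \<noteq> 0}. p v * complex_of_real (\<Sum>k\<le>length v. X (take k v) * Y \<omega> (drop k v)))" for \<omega>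
    by (subst pairing_finite[OF fin]) (auto simp: tensor_mult_take)
  then show ?thesis by simp
qed

lemma pairing_measurable [measurable]: "(\<lambda>\<omega>. pairing p (Y \<omega>)) \<in> borel_measurable M"
  by (subst pairing_finite[OF fin]) auto

lemma \<xi>_measurable [measurable]: "(\<lambda>\<omega>. \<xi> \<omega> v) \<in> borel_measurable M"
proof -
  have red: "(\<lambda>\<omega>. reduced (shift_tensor p (Y \<omega>)) v) \<in> borel_measurable M" for v
    unfolding reduced_def by measurable
  have pow: "(\<lambda>\<omega>. shuffle_power (reduced (shift_tensor p (Y \<omega>))) k v) \<in> borel_measurable M" for k v
  proof (induction k arbitrary: v)
    case (Suc k)
    show ?case
      unfolding shuffle_power.simps shuffle_def case_prod_unfold
      by (intro borel_measurable_sum borel_measurable_times red Suc borel_measurable_const)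
  qed simp
  have "\<xi> \<omega> v = exp (shift_tensor p (Y \<omega>) []) *
      (\<Sum>k\<le>length v. shuffle_power (reduced (shift_tensor p (Y \<omega>))) k v / fact k)" for \<omega>
    unfolding shuffle_exp_reduced
    by (subst suminf_finite[of "{..length v}"]) (auto simp: shuffle_power_eq_0)
  moreover have "(\<lambda>\<omega>. exp (shift_tensor p (Y \<omega>) []) *
      (\<Sum>k\<le>length v. shuffle_power (reduced (shift_tensor p (Y \<omega>))) k v / fact k)) \<in> borel_measurable M"
    by (intro borel_measurable_times borel_measurable_sum borel_measurable_divide pow borel_measurable_const) measurable
  ultimately show ?thesis by simp
qed

lemma \<xi>_integrable: "integrable M (\<lambda>\<omega>. \<xi> \<omega> v)"
proof -
  obtain K where K0: "K \<ge> 0" and K: "\<And>Y. cmod (shuffle_exp (shift_tensor p Y) v) \<le> exp (Re (pairing p Y) + K * exponent_sum p Y)"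
    using shuffle_exp_shift_coeff[OF fin, of v] by blast
  show ?thesis
  proof (rule integrable_const_bound[where B = "exp (C * (1 + K) powr D)"])
    show "AE \<omega> in M. norm (\<xi> \<omega> v) \<le> exp (C * (1 + K) powr D)"
      using exponent
    proof eventually_elim
      case (elim \<omega>)
      have "cmod (\<xi> \<omega> v) \<le> exp (Re (pairing p (Y \<omega>)) + K * exponent_sum p (Y \<omega>))" by (rule K)
      also have "\<dots> \<le> exp (C * (1 + K) powr D)" using elim K0 by simp
      finally show ?case .
    qed
  qed measurable
qed

lemma AE_exp_pairing_bound: "AE \<omega> in M. norm (exp (pairing p (Y \<omega>))) \<le> exp C"
  using exponent
proof eventually_elim
  case (elim \<omega>)
  from elim[rule_format, of 0] show ?case by (simp add: norm_exp_eq_Re)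
qed

lemma exp_pairing_integrable: "integrable M (\<lambda>\<omega>. exp (pairing p (Y \<omega>)))"
  by (rule integrable_const_bound[OF AE_exp_pairing_bound]) measurable

text \<open>The absolute values of the levels add up to at most a constant, almost surely. This allows for
interchanging the sum over the levels with the expectation.\<close>

lemma expected_group_like:
  assumes X: "X \<in> group_like"
  shows "tensor_norm u X \<le> ennreal (exp (C * (1 + M_bound p X) powr D))"
    "integrable M (\<lambda>\<omega>. exp (pairing p (X \<otimes>\<^sub>t Y \<omega>)))"
    "(\<integral>\<omega>. exp (pairing p (X \<otimes>\<^sub>t Y \<omega>)) \<partial>M) = pairing u X"
proof -
  let ?B = "exp (C * (1 + M_bound p X) powr D)"
  define Z where "Z n \<omega> = level (\<xi> \<omega>) X n" for n \<omega>
  note E = shuffle_exp_shift[OF fin X]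
  have Zi: "integrable M (Z n)" for n
    unfolding Z_def[abs_def] level_def
    by (intro Bochner_Integration.integrable_sum integrable_mult_left \<xi>_integrable)
  then have [measurable]: "Z n \<in> borel_measurable M" for n by auto
  have lev: "level u X n = (\<integral>\<omega>. Z n \<omega> \<partial>M)" for n
    unfolding level_def Z_def
    by (subst Bochner_Integration.integral_sum) (auto intro!: integrable_mult_left \<xi>_integrable)
  have sZ: "summable (\<lambda>n. cmod (Z n \<omega>))" for \<omega> unfolding Z_def by (rule E(1))
  have AEB: "AE \<omega> in M. (\<Sum>n. cmod (Z n \<omega>)) \<le> ?B"
    using exponent
  proof eventually_elim
    case (elim \<omega>)
    have "(\<Sum>n. cmod (Z n \<omega>)) \<le> exp (Re (pairing p (Y \<omega>)) + M_bound p X * exponent_sum p (Y \<omega>))"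
      unfolding Z_def by (rule E(2))
    also have "\<dots> \<le> ?B" using elim M_bound_nonneg_and_bound(1)[OF fin, of X] by simp
    finally show ?case .
  qed
  have nnB: "(\<Sum>n. \<integral>\<^sup>+\<omega>. ennreal (cmod (Z n \<omega>)) \<partial>M) \<le> ennreal ?B"
  proof -
    have "(\<Sum>n. \<integral>\<^sup>+\<omega>. ennreal (cmod (Z n \<omega>)) \<partial>M) = (\<integral>\<^sup>+\<omega>. (\<Sum>n. ennreal (cmod (Z n \<omega>))) \<partial>M)"
      by (rule nn_integral_suminf[symmetric]) measurable
    also have "\<dots> \<le> (\<integral>\<^sup>+\<omega>. ennreal ?B \<partial>M)"
    proof (rule nn_integral_mono_AE)
      show "AE \<omega> in M. (\<Sum>n. ennreal (cmod (Z n \<omega>))) \<le> ennreal ?B"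
        using AEB by eventually_elim (subst suminf_ennreal2; use sZ in \<open>simp add: ennreal_leI\<close>)
    qed
    also have "\<dots> = ennreal ?B" by (simp add: emeasure_space_1)
    finally show ?thesis .
  qed
  have tn: "tensor_norm u X \<le> (\<Sum>n. \<integral>\<^sup>+\<omega>. ennreal (cmod (Z n \<omega>)) \<partial>M)"
    unfolding tensor_norm_level lev
    by (intro suminf_le integral_norm_bound_ennreal Zi) auto
  from tn nnB show "tensor_norm u X \<le> ennreal ?B" by (rule order_trans)
  have sI: "summable (\<lambda>n. \<integral>\<omega>. cmod (Z n \<omega>) \<partial>M)"
  proof (rule summable_suminf_not_top)
    have "ennreal (\<integral>\<omega>. cmod (Z n \<omega>) \<partial>M) = (\<integral>\<^sup>+\<omega>. ennreal (cmod (Z n \<omega>)) \<partial>M)" for n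
      by (rule nn_integral_eq_integral[symmetric]) (use Zi in auto)
    then show "(\<Sum>n. ennreal (\<integral>\<omega>. cmod (Z n \<omega>) \<partial>M)) \<noteq> top"
      using nnB by (auto simp: top_unique)
  qed auto
  have AEs: "AE \<omega> in M. summable (\<lambda>n. norm (Z n \<omega>))" using sZ by simp
  have eq: "(\<Sum>n. Z n \<omega>) = exp (pairing p (X \<otimes>\<^sub>t Y \<omega>))" for \<omega>
    using E(3)[of "Y \<omega>"] by (simp add: Z_def pairing_level)
  show "integrable M (\<lambda>\<omega>. exp (pairing p (X \<otimes>\<^sub>t Y \<omega>)))"
    using integrable_suminf[OF Zi AEs sI] by (simp add: eq)
  show "(\<integral>\<omega>. exp (pairing p (X \<otimes>\<^sub>t Y \<omega>)) \<partial>M) = pairing u X"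
    using integral_suminf[OF Zi AEs sI] by (simp add: eq pairing_level lev)
qed

end

section \<open>Continuity, conditional expectations and norms for the Brownian signature\<close>

lemma (in brownian_motion) signature_random_tensor:
  assumes p: "p \<in> class_B" and S: "is_signature M W S" and t: "0 \<le> t" "t \<le> T"
    and C: "\<And>f t T' m. continuous_on {t..T'} f \<Longrightarrow> t \<le> T' \<Longrightarrow> T' - t \<le> T \<Longrightarrow> 0 \<le> m \<Longrightarrow>
      Re (pairing p (path_sig f t T')) + m * exponent_sum p (path_sig f t T') \<le> C * (1 + m) powr D"
  shows "random_tensor M p (S t T) C D"
proof
  show "finite {v. p v \<noteq> 0}" by (rule class_B_finite[OF p])
  show "(\<lambda>\<omega>. S t T \<omega> v) \<in> borel_measurable M" for v by (rule signature_measurable[OF S t])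
  show "AE \<omega> in M. \<forall>m\<ge>0. Re (pairing p (S t T \<omega>)) + m * exponent_sum p (S t T \<omega>) \<le> C * (1 + m) powr D"
    using AE_signature[OF S t] continuous_paths
  proof eventually_elim
    case (elim \<omega>)
    have "continuous_on {t..T} (\<lambda>r. W r \<omega>)"
      using elim(2) t by (auto intro: continuous_on_subset)
    then show ?case unfolding elim(1) using t C by auto
  qed
qed

text \<open>The explicit signature is continuous in its starting time, and the exponentials are bounded by one
constant.\<close>

lemma (in brownian_motion) expected_exp_continuous:
  assumes p: "p \<in> class_B" and S: "is_signature M W S"
    and R: "\<And>t. t \<in> {0..T} \<Longrightarrow> random_tensor M p (S t T) C D"
  shows "continuous_on {0..T} (\<lambda>t. \<integral>\<omega>. exp (pairing p (S t T \<omega>)) \<partial>M)"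
proof (rule continuous_on_sequentiallyI)
  fix s :: "nat \<Rightarrow> real" and t assume s: "\<forall>n. s n \<in> {0..T}" and t: "t \<in> {0..T}" and lim: "s \<longlonglongrightarrow> t"
  note fin = class_B_finite[OF p]
  show "(\<lambda>n. \<integral>\<omega>. exp (pairing p (S (s n) T \<omega>)) \<partial>M) \<longlonglongrightarrow> (\<integral>\<omega>. exp (pairing p (S t T \<omega>)) \<partial>M)"
  proof (rule integral_dominated_convergence[where w = "\<lambda>_. exp C"])
    have Rs: "random_tensor M p (S (s n) T) C D" for n using R s by auto
    show "(\<lambda>\<omega>. exp (pairing p (S t T \<omega>))) \<in> borel_measurable M"
      by (intro borel_measurable_integrable random_tensor.exp_pairing_integrable[OF R[OF t]])
    show "(\<lambda>\<omega>. exp (pairing p (S (s n) T \<omega>))) \<in> borel_measurable M" for n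
      by (intro borel_measurable_integrable random_tensor.exp_pairing_integrable[OF Rs])
    show "AE \<omega> in M. norm (exp (pairing p (S (s n) T \<omega>))) \<le> exp C" for n
      by (rule random_tensor.AE_exp_pairing_bound[OF Rs])
    have "AE \<omega> in M. \<forall>n. S (s n) T \<omega> = path_sig (\<lambda>r. W r \<omega>) (s n) T"
      unfolding AE_all_countable using s by (auto intro!: AE_signature[OF S])
    moreover have "AE \<omega> in M. S t T \<omega> = path_sig (\<lambda>r. W r \<omega>) t T"
      using t by (auto intro!: AE_signature[OF S])
    ultimately show "AE \<omega> in M. (\<lambda>n. exp (pairing p (S (s n) T \<omega>))) \<longlonglongrightarrow> exp (pairing p (S t T \<omega>))"
      using continuous_paths
    proof eventually_elim
      case (elim \<omega>)
      have "continuous_on {0..T} (\<lambda>r. W r \<omega>)" using elim(3) by (auto intro: continuous_on_subset)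
      then have "continuous_on {0..T} (\<lambda>t. path_sig (\<lambda>r. W r \<omega>) t T v)" for v
        by (rule path_sig_continuous_start)
      then have "(\<lambda>n. path_sig (\<lambda>r. W r \<omega>) (s n) T v) \<longlonglongrightarrow> path_sig (\<lambda>r. W r \<omega>) t T v" for v
        using s t lim unfolding continuous_on_sequentially comp_def by blast
      then have "(\<lambda>n. exp (\<Sum>v\<in>{v. p v \<noteq> 0}. p v * complex_of_real (path_sig (\<lambda>r. W r \<omega>) (s n) T v)))
          \<longlonglongrightarrow> exp (\<Sum>v\<in>{v. p v \<noteq> 0}. p v * complex_of_real (path_sig (\<lambda>r. W r \<omega>) t T v))"
        by (intro tendsto_intros)
      moreover have "pairing p X = (\<Sum>v\<in>{v. p v \<noteq> 0}. p v * complex_of_real (X v))" for X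
        by (rule pairing_finite[OF fin]) auto
      ultimately show ?case using elim by simp
    qed
  qed auto
qed

text \<open>Chen's identity writes the exponent as a function of the signature up to time \<open>t\<close>, which belongs to the
past, and of the signature after time \<open>t\<close>, which depends on later increments only. Freezing the past
leaves an expectation of the form treated before, since the signature up to time \<open>t\<close> is group-like.\<close>

lemma (in brownian_motion) signature_cond_exp:
  assumes p: "p \<in> class_B" and S: "is_signature M W S" and t: "0 \<le> t" "t \<le> T"
    and R: "\<And>t. t \<in> {0..T} \<Longrightarrow> random_tensor M p (S t T) C D"
  shows "AE \<omega> in M. complex_cond_exp M (natural_filtration M W t) (\<lambda>\<omega>. exp (pairing p (S 0 T \<omega>))) \<omega>
    = pairing (expected_xi M p T S t) (S 0 t \<omega>)"
proof -
  let ?F = "natural_filtration M W t" and ?H = "increment_algebra M W t T"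
  note fin = class_B_finite[OF p]
  interpret rt: random_tensor M p "S t T" C D by (rule R) (use t in auto)
  interpret r0: random_tensor M p "S 0 T" C D by (rule R) (use t in auto)
  have F: "subalgebra M ?F" using sets_natural_filtration_M by (simp add: subalgebra_def)
  have "sets ?H \<subseteq> sets (natural_filtration M W T)" by (rule sets_increment_algebra_natural[OF t(1)])
  then have H: "subalgebra M ?H" using sets_natural_filtration_M[of T] by (auto simp: subalgebra_def)
  have "\<forall>v. \<exists>Z. Z \<in> borel_measurable (increment_algebra M W 0 t) \<and> (AE \<omega> in M. S 0 t \<omega> v = Z \<omega>)"
    using signature_explicit[OF S order_refl t(1)] by blast
  then obtain X where X0: "\<And>v. X v \<in> borel_measurable (increment_algebra M W 0 t)"
    and X: "\<And>v. AE \<omega> in M. S 0 t \<omega> v = X v \<omega>" by metis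
  have XF[measurable]: "X v \<in> borel_measurable ?F" for v
    by (rule measurable_mono_sets[OF X0 sets_increment_algebra_natural]) auto
  have "\<forall>v. \<exists>Z. Z \<in> borel_measurable ?H \<and> (AE \<omega> in M. S t T \<omega> v = Z \<omega>)"
    using signature_explicit[OF S t] by blast
  then obtain Y where YH[measurable]: "\<And>v. Y v \<in> borel_measurable ?H"
    and Y: "\<And>v. AE \<omega> in M. S t T \<omega> v = Y v \<omega>" by metis
  have AX: "AE \<omega> in M. S 0 t \<omega> = (\<lambda>v. X v \<omega>)"
    using AE_all_words[where P = "\<lambda>\<omega> v. S 0 t \<omega> v = X v \<omega>", OF X] by (auto simp: fun_eq_iff)
  have AY: "AE \<omega> in M. S t T \<omega> = (\<lambda>v. Y v \<omega>)"
    using AE_all_words[where P = "\<lambda>\<omega> v. S t T \<omega> v = Y v \<omega>", OF Y] by (auto simp: fun_eq_iff)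
  define \<Phi> where "\<Phi> z = exp (pairing p ((\<lambda>v. X v (fst z)) \<otimes>\<^sub>t (\<lambda>v. Y v (snd z))))" for z
  have \<Phi>_eq: "\<Phi> z = exp (\<Sum>v\<in>{v. p v \<noteq> 0}. p v * complex_of_real (\<Sum>k\<le>length v. X (take k v) (fst z) * Y (drop k v) (snd z)))" for z
    unfolding \<Phi>_def by (subst pairing_finite[OF fin]) (auto simp: tensor_mult_take)
  have \<Phi>m: "\<Phi> \<in> borel_measurable (?F \<Otimes>\<^sub>M ?H)"
    unfolding \<Phi>_eq[abs_def] by measurable
  have A0: "AE \<omega> in M. \<Phi> (\<omega>, \<omega>) = exp (pairing p (S 0 T \<omega>))"
    using AX AY AE_signature_Chen[OF S order_refl t]
    by eventually_elim (simp add: \<Phi>_def)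
  have idF: "(\<lambda>\<omega>. \<omega>) \<in> measurable M ?F"
    using F sets.sets_into_space[of _ ?F] by (auto intro!: measurableI simp: subalgebra_def subset_iff Int_absorb2)
  have idH: "(\<lambda>\<omega>. \<omega>) \<in> measurable M ?H"
    using H sets.sets_into_space[of _ ?H] by (auto intro!: measurableI simp: subalgebra_def subset_iff Int_absorb2)
  have dm: "(\<lambda>\<omega>. \<Phi> (\<omega>, \<omega>)) \<in> borel_measurable M"
    using measurable_compose[OF measurable_Pair[OF idF idH] \<Phi>m] by simp
  have int: "integrable M (\<lambda>\<omega>. \<Phi> (\<omega>, \<omega>))"
  proof (rule integrable_cong_AE_imp[OF r0.exp_pairing_integrable dm])
    show "AE \<omega> in M. exp (pairing p (S 0 T \<omega>)) = \<Phi> (\<omega>, \<omega>)"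
      using A0 by eventually_elim simp
  qed
  note fr = freezing[OF F H past_future_independent[OF t] \<Phi>m int]
  interpret fs: finite_measure_subalgebra M ?F by unfold_locales (rule F)
  have em: "(\<lambda>\<omega>. exp (pairing p (S 0 T \<omega>))) \<in> borel_measurable M" by measurable
  have cRe: "AE \<omega> in M. real_cond_exp M ?F (\<lambda>\<omega>. Re (exp (pairing p (S 0 T \<omega>)))) \<omega> = real_cond_exp M ?F (\<lambda>\<omega>. Re (\<Phi> (\<omega>, \<omega>))) \<omega>"
    by (rule fs.real_cond_exp_cong) (use A0 dm em in auto)
  have cIm: "AE \<omega> in M. real_cond_exp M ?F (\<lambda>\<omega>. Im (exp (pairing p (S 0 T \<omega>)))) \<omega> = real_cond_exp M ?F (\<lambda>\<omega>. Im (\<Phi> (\<omega>, \<omega>))) \<omega>"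
    by (rule fs.real_cond_exp_cong) (use A0 dm em in auto)
  show ?thesis
    using fr cRe cIm AX AE_signature_group_like[OF S order_refl t(1)] AE_space
  proof eventually_elim
    case (elim \<omega>)
    have "complex_cond_exp M ?F (\<lambda>\<omega>. exp (pairing p (S 0 T \<omega>))) \<omega> = (\<integral>\<omega>'. \<Phi> (\<omega>, \<omega>') \<partial>M)"
      using elim(1-3) by (simp add: complex_cond_exp_def)
    also have "\<dots> = (\<integral>\<omega>'. exp (pairing p (S 0 t \<omega> \<otimes>\<^sub>t S t T \<omega>')) \<partial>M)"
    proof (rule integral_cong_AE)
      have "(\<lambda>\<omega>'. \<Phi> (\<omega>, \<omega>')) \<in> borel_measurable ?H"
        by (rule measurable_compose_Pair1[OF _ \<Phi>m]) (use elim(6) in simp)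
      then show "(\<lambda>\<omega>'. \<Phi> (\<omega>, \<omega>')) \<in> borel_measurable M"
        using measurable_compose[OF idH] by blast
      show "(\<lambda>\<omega>'. exp (pairing p (S 0 t \<omega> \<otimes>\<^sub>t S t T \<omega>'))) \<in> borel_measurable M" by measurable
      show "AE \<omega>' in M. \<Phi> (\<omega>, \<omega>') = exp (pairing p (S 0 t \<omega> \<otimes>\<^sub>t S t T \<omega>'))"
        using AY by eventually_elim (simp add: \<Phi>_def elim(4))
    qed
    also have "\<dots> = pairing (expected_xi M p T S t) (S 0 t \<omega>)"
      unfolding expected_xi_def xi_def by (rule rt.expected_group_like(3)[OF elim(5)])
    finally show ?case .
  qed
qed

theorem theorem4p6:
  fixes p :: "complex tensor" and T :: real
  assumes "p \<in> class_B" and "T > 0"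
  shows "\<exists>C>0. \<forall>(M :: 'a measure) W S. brownian_motion M W \<longrightarrow> is_signature M W S \<longrightarrow>
    (let u = expected_xi M p T S in
      (\<forall>t\<in>{0..T}. \<forall>v. integrable M (\<lambda>\<omega>. xi p T S t \<omega> v))
    \<and> (\<forall>t\<in>{0..T}. u t \<in> A_infinity)
    \<and> (\<forall>X\<in>group_like. \<forall>t\<in>{0..T}.
          integrable M (\<lambda>\<omega>. exp (pairing p (X \<otimes>\<^sub>t S t T \<omega>))) \<and>
          (\<integral>\<omega>. exp (pairing p (X \<otimes>\<^sub>t S t T \<omega>)) \<partial>M) = pairing (u t) X)
    \<and> integrable M (\<lambda>\<omega>. exp (pairing p (S 0 T \<omega>)))
    \<and> (\<forall>t\<in>{0..T}. AE \<omega> in M.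
          complex_cond_exp M (natural_filtration M W t) (\<lambda>\<omega>. exp (pairing p (S 0 T \<omega>))) \<omega>
          = pairing (u t) (S 0 t \<omega>))
    \<and> (\<forall>X\<in>group_like.
          (SUP t\<in>{0..T}. tensor_norm (u t) X)
            \<le> ennreal (exp (C * (1 + M_bound p X) powr real_of_ereal (deg_letter L1 p)))
        \<and> ennreal (exp (C * (1 + M_bound p X) powr real_of_ereal (deg_letter L1 p))) < \<infinity>)
    \<and> continuous_on {0..T} (\<lambda>t. u t []))"
proof -
  let ?D = "real_of_ereal (deg_letter L1 p)"
  note fin = class_B_finite[OF assms(1)]
  obtain C where C0: "C > 0" and C: "\<And>f t T' m. continuous_on {t..T'} f \<Longrightarrow> t \<le> T' \<Longrightarrow> T' - t \<le> T \<Longrightarrow> 0 \<le> m \<Longrightarrow>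
      Re (pairing p (path_sig f t T')) + m * exponent_sum p (path_sig f t T') \<le> C * (1 + m) powr ?D"
    using class_B_exponent_bound[OF assms(1), of T] assms(2) unfolding exponent_sum_def by (metis less_imp_le)
  show ?thesis
  proof (intro exI[of _ C] conjI allI impI C0)
    fix M :: "'a measure" and W S assume bm: "brownian_motion M W" and S: "is_signature M W S"
    interpret brownian_motion M W by (rule bm)
    have R: "random_tensor M p (S t T) C ?D" if "t \<in> {0..T}" for t
      by (rule signature_random_tensor[OF assms(1) S]) (use that C in auto)
    have u: "expected_xi M p T S t = (\<lambda>v. \<integral>\<omega>. shuffle_exp (shift_tensor p (S t T \<omega>)) v \<partial>M)" for t
      by (simp add: expected_xi_def xi_def)
    have norm: "tensor_norm (expected_xi M p T S t) X \<le> ennreal (exp (C * (1 + M_bound p X) powr ?D))"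
      if "t \<in> {0..T}" "X \<in> group_like" for t X
      unfolding u by (rule random_tensor.expected_group_like(1)[OF R[OF that(1)] that(2)])
    have 1: "integrable M (\<lambda>\<omega>. xi p T S t \<omega> v)" if "t \<in> {0..T}" for t v
      unfolding xi_def by (rule random_tensor.\<xi>_integrable[OF R[OF that]])
    have 2: "expected_xi M p T S t \<in> A_infinity" if "t \<in> {0..T}" for t
      using norm[OF that] by (auto simp: A_infinity_def A_space_def intro: le_less_trans ennreal_less_top)
    have 3: "integrable M (\<lambda>\<omega>. exp (pairing p (X \<otimes>\<^sub>t S t T \<omega>)))"
      "(\<integral>\<omega>. exp (pairing p (X \<otimes>\<^sub>t S t T \<omega>)) \<partial>M) = pairing (expected_xi M p T S t) X"
      if "t \<in> {0..T}" "X \<in> group_like" for t X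
      unfolding u by (rule random_tensor.expected_group_like[OF R[OF that(1)] that(2)])+
    have 4: "integrable M (\<lambda>\<omega>. exp (pairing p (S 0 T \<omega>)))"
      by (rule random_tensor.exp_pairing_integrable[OF R]) (use assms(2) in simp)
    have 5: "AE \<omega> in M. complex_cond_exp M (natural_filtration M W t) (\<lambda>\<omega>. exp (pairing p (S 0 T \<omega>))) \<omega>
        = pairing (expected_xi M p T S t) (S 0 t \<omega>)" if "t \<in> {0..T}" for t
      by (rule signature_cond_exp[OF assms(1) S _ _ R]) (use that in auto)
    have 6: "(SUP t\<in>{0..T}. tensor_norm (expected_xi M p T S t) X) \<le> ennreal (exp (C * (1 + M_bound p X) powr ?D))"
      if "X \<in> group_like" for X
      by (rule SUP_least) (rule norm[OF _ that])
    have 7: "continuous_on {0..T} (\<lambda>t. expected_xi M p T S t [])"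
      using expected_exp_continuous[OF assms(1) S R] by (simp add: u shuffle_exp_Nil[OF fin])
    show "let u = expected_xi M p T S in
      (\<forall>t\<in>{0..T}. \<forall>v. integrable M (\<lambda>\<omega>. xi p T S t \<omega> v))
    \<and> (\<forall>t\<in>{0..T}. u t \<in> A_infinity)
    \<and> (\<forall>X\<in>group_like. \<forall>t\<in>{0..T}.
          integrable M (\<lambda>\<omega>. exp (pairing p (X \<otimes>\<^sub>t S t T \<omega>))) \<and>
          (\<integral>\<omega>. exp (pairing p (X \<otimes>\<^sub>t S t T \<omega>)) \<partial>M) = pairing (u t) X)
    \<and> integrable M (\<lambda>\<omega>. exp (pairing p (S 0 T \<omega>)))
    \<and> (\<forall>t\<in>{0..T}. AE \<omega> in M.
          complex_cond_exp M (natural_filtration M W t) (\<lambda>\<omega>. exp (pairing p (S 0 T \<omega>))) \<omega>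
          = pairing (u t) (S 0 t \<omega>))
    \<and> (\<forall>X\<in>group_like.
          (SUP t\<in>{0..T}. tensor_norm (u t) X)
            \<le> ennreal (exp (C * (1 + M_bound p X) powr real_of_ereal (deg_letter L1 p)))
        \<and> ennreal (exp (C * (1 + M_bound p X) powr real_of_ereal (deg_letter L1 p))) < \<infinity>)
    \<and> continuous_on {0..T} (\<lambda>t. u t [])"
      unfolding Let_def using 1 2 3 4 5 6 7 by auto
  qed
qed

end
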